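(* Let $n,d\ge 1$ be integers, $\epsilon\in(0,1)$, and let $p:\mathbb{R}^n\to\mathbb{R}$ be a nonzero polynomial of degree at most $d$. There is a choice of $\lambda=(\epsilon/d)^{O(1)}$ (with $L:=1/\lambda$ a positive integer) and of $k=\Theta(d)$ (the hidden constants being absolute) such that the following holds. Let $x\sim N(0,1)^n$ and let $z_1,\dots,z_L$ be independent random vectors, each of which is a $k$-wise independent $n$-dimensional Gaussian random vector, and set $Z:=\sqrt{\lambda}z_1+\cdots+\sqrt{\lambda}z_L$. Then $$\left|\mathbb{E}[\mathrm{sign}(p(Z))]-\mathbb{E}[\mathrm{sign}(p(x))]\right|\le\epsilon.$$
   Context: A random vector $z=(z_1,\dots,z_n)$ in $\mathbb{R}^n$ is a $k$-wise independent $n$-dimensional Gaussian if each coordinate $z_i$ has distribution $N(0,1)$ and for every choice of $k$ indices $i_1,\dots,i_k$ the random variables $z_{i_1},\dots,z_{i_k}$ are independent. $\mathrm{sign}$ denotes the sign function with values in $\{-1,1\}$. *)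

theory Defs
  imports "HOL-Probability.Probability" "HOL-Library.Poly_Mapping"
begin

text \<open>
  The constants of the theorem must not depend on the dimension \<open>n\<close>, so \<open>n\<close> is a natural number
  and not a type: a vector in \<open>\<real>\<^sup>n\<close> is a function \<open>nat \<Rightarrow> real\<close> of which only the values at
  \<open>i < n\<close> matter, with the product \<open>\<sigma>\<close>-algebra below.
\<close>

abbreviation Rvec :: "nat \<Rightarrow> (nat \<Rightarrow> real) measure" where
  "Rvec n \<equiv> Pi\<^sub>M {..<n} (\<lambda>_. borel)"

text \<open>
  Real polynomials in the variables \<open>x\<^sub>0, x\<^sub>1, \<dots>\<close> are finitely supported maps from monomials
  to coefficients, and monomials are finitely supported maps from variable indices to exponents.
\<close>

type_synonym rpoly = "(nat \<Rightarrow>\<^sub>0 nat) \<Rightarrow>\<^sub>0 real"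

definition polys_in :: "nat \<Rightarrow> rpoly set" where
  "polys_in n = {p. \<forall>m \<in> Poly_Mapping.keys p. Poly_Mapping.keys m \<subseteq> {..<n}}"

definition total_degree_le :: "rpoly \<Rightarrow> nat \<Rightarrow> bool" where
  "total_degree_le p d \<longleftrightarrow>
     (\<forall>m \<in> Poly_Mapping.keys p. (\<Sum>i \<in> Poly_Mapping.keys m. Poly_Mapping.lookup m i) \<le> d)"

definition eval_poly :: "rpoly \<Rightarrow> (nat \<Rightarrow> real) \<Rightarrow> real" where
  "eval_poly p x =
     (\<Sum>m \<in> Poly_Mapping.keys p.
        Poly_Mapping.lookup p m * (\<Prod>i \<in> Poly_Mapping.keys m. x i ^ Poly_Mapping.lookup m i))"

text \<open>
  Unlike \<^const>\<open>sgn\<close>, this takes values in \<open>{-1, 1}\<close> only. The value at \<open>0\<close> is a convention;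
  exchanging it amounts to replacing \<open>p\<close> by \<open>-p\<close> in the theorem.
\<close>

definition pm_sign :: "real \<Rightarrow> real" where
  "pm_sign t = (if 0 \<le> t then 1 else -1)"

definition std_gaussian :: "nat \<Rightarrow> (nat \<Rightarrow> real) measure" where
  "std_gaussian n = Pi\<^sub>M {..<n} (\<lambda>_. density lborel (\<lambda>t. ennreal (std_normal_density t)))"

text \<open>
  Independence is required of every set of at most \<open>k\<close> coordinates. For \<open>k \<le> n\<close> this is the same
  as for every set of exactly \<open>k\<close> coordinates; for \<open>k > n\<close> the latter would be vacuous,
  whereas here all \<open>n\<close> coordinates are then independent.
\<close>

definition kwise_indep_gaussian ::
    "'a measure \<Rightarrow> nat \<Rightarrow> nat \<Rightarrow> ('a \<Rightarrow> nat \<Rightarrow> real) \<Rightarrow> bool" where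
  "kwise_indep_gaussian M k n z \<longleftrightarrow>
     z \<in> measurable M (Rvec n) \<and>
     (\<forall>i<n. distributed M lborel (\<lambda>\<omega>. z \<omega> i) (\<lambda>t. ennreal (std_normal_density t))) \<and>
     (\<forall>J. J \<subseteq> {..<n} \<and> card J \<le> k \<longrightarrow>
        prob_space.indep_vars M (\<lambda>_. borel) (\<lambda>i \<omega>. z \<omega> i) J)"

end

theory Submission
  imports Defs "HOL-Computational_Algebra.Fundamental_Theorem_Algebra"
begin

text \<open>
  Write \<open>A = (\<Sum>w. \<tau>\<^bsup>\<bar>w\<bar>\<^esup> / \<bar>w\<bar>! (\<partial>\<^sub>w p)\<^sup>2)\<close>, summed over the words \<open>w\<close> of length at most \<open>d\<close>,
  and call \<open>r = p / sqrt A\<close>, a function with values in \<open>[-1, 1]\<close>, the certainty of \<open>p\<close>. Since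
  \<open>\<bar>sign p - r\<bar> \<le> 1 - r\<^sup>2\<close>, it suffices that \<open>r\<close> and \<open>r\<^sup>2\<close> have nearly the same expectation under
  \<open>Z\<close> and \<open>x\<close>, and that \<open>1 - r\<^sup>2\<close> is small in the mean under \<open>x\<close>. The latter is anticoncentration:
  for independent Gaussian \<open>x, y\<close> the ratio of \<open>\<partial>\<^sub>y p\<close> and \<open>p\<close> at \<open>x\<close> is distributed like a logarithmic
  derivative of a trigonometric polynomial of degree \<open>d\<close> at a random angle, hence rarely exceeds
  \<open>O(d\<^sup>2)\<close> by much.

  For the former, the summands \<open>z\<^sub>j\<close> are replaced by Gaussian vectors one at a time. In one step the
  jet \<open>V\<^sub>w = sqrt (\<tau>\<^bsup>\<bar>w\<bar>\<^esup> / \<bar>w\<bar>!) \<partial>\<^sub>w p\<close> deviates from its mean, relative to its length, by \<open>O(\<theta>)\<close> in mean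
  square, \<open>\<theta> = \<lambda> d / \<tau>\<close>, wherever the step starts. The second order Taylor polynomials of
  \<open>r\<close> and \<open>r\<^sup>2\<close> in this deviation, and the quartic bound of the remainder, have degree at most \<open>4 d\<close> in
  \<open>z\<^sub>j\<close>, so for \<open>k = 4 d\<close> their expectations agree exactly. One step costs \<open>O(\<theta>\<^bsup>3/2\<^esup>)\<close>, and \<open>1/\<lambda>\<close>
  steps cost \<open>O(\<theta>\<^bsup>3/2\<^esup> / \<lambda>)\<close>, which is small for small \<open>\<lambda>\<close>.

  As \<open>\<epsilon> / d\<close> approaches \<open>1\<close>, the requirement \<open>\<lambda> = (\<epsilon> / d)\<^bsup>O(1)\<^esup>\<close> forces \<open>\<lambda> = 1\<close>. Then \<open>d = 1\<close>, and the
  first four moments of an affine function determine the probability of a halfspace well enough.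
\<close>

section \<open>Polynomial functions\<close>

text \<open>The whole jet stands in the denominator because near a zero of \<open>p\<close> one step
  may change \<open>p\<close> by far more than its size, while the logarithmic gradient of the jet
  is at most sqrt (d / \<tau>) at every point. So no starting point is exceptional and no bad event
  has to be carried through the steps. The square of the certainty is followed too, because the
  distance to the sign has to be controlled under \<open>Z\<close>, where no anticoncentration is
  available.

  No estimate depends on the dimension or on the number of words: second and fourth moments of the
  deviation come from the Poincare inequality, applied once more to the squared length of the
  deviation, which takes the place of hypercontractivity.

  The parameter \<tau> is squeezed from two sides. The certainty is near 1 if \<tau> T^2 is about
  \<epsilon> for some T of order d^3 / \<epsilon>, so \<tau> is of order \<epsilon>^3 / d^6, while
  \<theta> wants \<tau> large. The cost \<theta>^(3/2) / \<lambda> becomes \<lambda>^(1/2) (d^7 /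
  \<epsilon>^3)^(3/2), which fixes the power of \<epsilon> / d.\<close>

inductive polyfun :: "nat \<Rightarrow> nat \<Rightarrow> ((nat \<Rightarrow> real) \<Rightarrow> real) \<Rightarrow> bool" for n d where
  monomial: "(\<Sum>i<n. m i) \<le> d \<Longrightarrow> polyfun n d (\<lambda>x. c * (\<Prod>i<n. x i ^ m i))"
| add: "polyfun n d f \<Longrightarrow> polyfun n d g \<Longrightarrow> polyfun n d (\<lambda>x. f x + g x)"

lemma polyfun_const [intro, simp]: "polyfun n d (\<lambda>x. c)"
  using polyfun.monomial[of "\<lambda>_. 0" n d c] by simp

lemma polyfun_coord:
  assumes "i < n" "1 \<le> d" shows "polyfun n d (\<lambda>x. x i)"
proof -
  have "(\<Prod>j<n. x j ^ (if j = i then 1 else 0)) = x i" for x :: "nat \<Rightarrow> real"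
  proof -
    have "(\<Prod>j<n. x j ^ (if j = i then 1 else 0)) = (\<Prod>j<n. if j = i then x j else 1)"
      by (rule prod.cong) auto
    then show ?thesis using assms by (simp add: prod.delta)
  qed
  moreover have "(\<Sum>j<n. if j = i then 1 else 0 :: nat) \<le> d"
    using assms by simp
  ultimately show ?thesis
    using polyfun.monomial[of "\<lambda>j. if j = i then 1 else 0" n d 1] by simp
qed

lemma polyfun_mono: "polyfun n d f \<Longrightarrow> d \<le> e \<Longrightarrow> polyfun n e f"
  by (induction rule: polyfun.induct) (auto intro: polyfun.intros order_trans)

lemma polyfun_sum:
  "(\<And>j. j \<in> J \<Longrightarrow> polyfun n d (f j)) \<Longrightarrow> polyfun n d (\<lambda>x. \<Sum>j\<in>J. f j x)"
  by (induction J rule: infinite_finite_induct) (auto intro: polyfun.add)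

lemma polyfun_mult:
  assumes "polyfun n d f" "polyfun n e g"
  shows "polyfun n (d + e) (\<lambda>x. f x * g x)"
  using assms(1)
proof (induction rule: polyfun.induct)
  case (monomial m c)
  show ?case using assms(2)
  proof (induction rule: polyfun.induct)
    case (monomial m' c')
    have "polyfun n (d + e) (\<lambda>x. (c * c') * (\<Prod>i<n. x i ^ (m i + m' i)))"
      using \<open>sum m {..<n} \<le> d\<close> monomial by (intro polyfun.monomial) (simp add: sum.distrib add_mono)
    then show ?case by (simp add: power_add prod.distrib algebra_simps)
  next
    case (add f g)
    then show ?case using polyfun.add by (force simp: algebra_simps)
  qed
next
  case (add f g)
  then show ?case using polyfun.add by (force simp: algebra_simps)
qed

lemma polyfun_cmult: "polyfun n d f \<Longrightarrow> polyfun n d (\<lambda>x. c * f x)"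
  using polyfun_mult[of n 0 "\<lambda>_. c" d f] by simp

lemma polyfun_diff: "polyfun n d f \<Longrightarrow> polyfun n d g \<Longrightarrow> polyfun n d (\<lambda>x. f x - g x)"
  using polyfun.add[of n d f "\<lambda>x. -1 * g x"] polyfun_cmult[of n d g "-1"] by simp

lemma polyfun_power: "polyfun n d f \<Longrightarrow> polyfun n (k * d) (\<lambda>x. f x ^ k)"
  by (induction k) (auto intro: polyfun_mult)

lemma polyfun_prod:
  "(\<And>i. i \<in> I \<Longrightarrow> polyfun n (e i) (f i)) \<Longrightarrow> polyfun n (\<Sum>i\<in>I. e i) (\<lambda>x. \<Prod>i\<in>I. f i x)"
  by (induction I rule: infinite_finite_induct) (auto intro: polyfun_mult)

lemma polyfun_affine:
  assumes "polyfun n d f"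
  shows "polyfun n d (\<lambda>y. f (\<lambda>i. w i + s * y i))"
  using assms
proof (induction rule: polyfun.induct)
  case (monomial m c)
  have "polyfun n (\<Sum>i<n. m i * 1) (\<lambda>y. \<Prod>i<n. (w i + s * y i) ^ m i)"
    by (intro polyfun_prod polyfun_power polyfun.add polyfun_cmult polyfun_coord) auto
  then show ?case using monomial by (intro polyfun_cmult) (auto intro: polyfun_mono)
next
  case (add f g)
  then show ?case by (auto intro: polyfun.add)
qed

text \<open>One coordinate factor is split off at a time, and the degree bound varies along with the
  function: \<open>mult\<close> raises it by exactly one. Degree bounds for derivatives and for
  restrictions to circles are obtained this way, which the monomial rule with its whole exponent
  vector would hide.\<close>

lemma polyfun_induct [consumes 1, case_names const mult add]:
  assumes "polyfun n d f"
    and const: "\<And>d c. P d (\<lambda>x. c)"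
    and mult: "\<And>d f j. j < n \<Longrightarrow> polyfun n d f \<Longrightarrow> P d f \<Longrightarrow> P (Suc d) (\<lambda>x. x j * f x)"
    and add: "\<And>d f g. polyfun n d f \<Longrightarrow> P d f \<Longrightarrow> polyfun n d g \<Longrightarrow> P d g \<Longrightarrow> P d (\<lambda>x. f x + g x)"
  shows "P d f"
  using assms(1)
proof (induction rule: polyfun.induct)
  case (monomial m c)
  have "(\<Sum>i<n. m i) \<le> d \<Longrightarrow> P d (\<lambda>x. c * (\<Prod>i<n. x i ^ m i))" for m d
  proof (induction "\<Sum>i<n. m i" arbitrary: m d)
    case 0
    then have "m i = 0" if "i < n" for i using that by auto
    then show ?case by (simp add: const)
  next
    case (Suc k)
    then obtain j where j: "j < n" "m j > 0"
      by (metis lessThan_iff not_gr_zero sum.neutral nat.distinct(1))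
    define m' where "m' = m(j := m j - 1)"
    have s: "(\<Sum>i<n. m i) = Suc (\<Sum>i<n. m' i)"
    proof -
      have "(\<Sum>i<n. m i) = m j + (\<Sum>i\<in>{..<n}-{j}. m i)" using j by (intro sum.remove) auto
      moreover have "(\<Sum>i<n. m' i) = m' j + (\<Sum>i\<in>{..<n}-{j}. m' i)" using j by (intro sum.remove) auto
      moreover have "(\<Sum>i\<in>{..<n}-{j}. m' i) = (\<Sum>i\<in>{..<n}-{j}. m i)"
        by (rule sum.cong) (auto simp: m'_def)
      ultimately show ?thesis using j by (simp add: m'_def)
    qed
    have p: "(\<Prod>i<n. x i ^ m i) = x j * (\<Prod>i<n. x i ^ m' i)" for x :: "nat \<Rightarrow> real"
    proof -
      have "(\<Prod>i<n. x i ^ m i) = x j ^ m j * (\<Prod>i\<in>{..<n}-{j}. x i ^ m i)" using j by (intro prod.remove) auto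
      moreover have "(\<Prod>i<n. x i ^ m' i) = x j ^ m' j * (\<Prod>i\<in>{..<n}-{j}. x i ^ m' i)" using j by (intro prod.remove) auto
      moreover have "(\<Prod>i\<in>{..<n}-{j}. x i ^ m' i) = (\<Prod>i\<in>{..<n}-{j}. x i ^ m i)"
        by (rule prod.cong) (auto simp: m'_def)
      moreover have "x j ^ m j = x j * x j ^ m' j" using j by (simp add: m'_def power_eq_if)
      ultimately show ?thesis by simp
    qed
    obtain e where d: "d = Suc e" using Suc.prems s by (cases d) auto
    have "P e (\<lambda>x. c * (\<Prod>i<n. x i ^ m' i))"
      using Suc s d by (intro Suc.hyps(1)) auto
    then have "P (Suc e) (\<lambda>x. x j * (c * (\<Prod>i<n. x i ^ m' i)))"
      using j Suc.prems s d by (intro mult) (auto intro: polyfun.monomial)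
    then show ?case by (simp add: d p mult_ac)
  qed
  then show ?case using monomial by blast
next
  case (add f g)
  then show ?case by (auto intro: assms)
qed

text \<open>Points of the product measure are \<open>undefined\<close> beyond \<open>n\<close>, sums
  and rotations of vectors in general are not. Polynomial functions do not see the
  difference.\<close>

lemma polyfun_cong_coords:
  assumes "polyfun n d f" "\<And>i. i < n \<Longrightarrow> x i = y i"
  shows "f x = f y"
  using assms by (induction rule: polyfun_induct) auto

lemma polyfun_measurable:
  assumes "polyfun n d f" "\<And>i. i < n \<Longrightarrow> (\<lambda>\<omega>. X \<omega> i) \<in> borel_measurable N"
  shows "(\<lambda>\<omega>. f (X \<omega>)) \<in> borel_measurable N"
  using assms by (induction rule: polyfun_induct) auto

section \<open>Partial derivatives and the chain rule\<close>

definition pd :: "nat \<Rightarrow> ((nat \<Rightarrow> real) \<Rightarrow> real) \<Rightarrow> (nat \<Rightarrow> real) \<Rightarrow> real" where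
  "pd l f x = deriv (\<lambda>t. f (x(l := t))) (x l)"

text \<open>The chain rule along every curve with differentiable first \<open>n\<close> coordinates
  serves as the definition. It passes through sums and products in an induction, and it is the form
  in which derivatives are used later: along segments, circles and coordinate lines.\<close>

definition gradient :: "nat \<Rightarrow> ((nat \<Rightarrow> real) \<Rightarrow> real) \<Rightarrow> (nat \<Rightarrow> (nat \<Rightarrow> real) \<Rightarrow> real) \<Rightarrow> bool" where
  "gradient n f D \<longleftrightarrow> (\<forall>c c' t. (\<forall>i<n. ((\<lambda>t. c t i) has_real_derivative c' i) (at t)) \<longrightarrow>
      ((\<lambda>t. f (c t)) has_real_derivative (\<Sum>l<n. D l (c t) * c' l)) (at t))"

text \<open>The bound \<open>d - 1\<close> is truncated at \<open>d = 0\<close>, so the vanishing of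
  the derivatives of constants is carried along as a clause of its own. The product step needs it:
  there \<open>x j * D l x\<close> would otherwise have degree 1 where degree 0 is required.\<close>

lemma polyfun_gradient:
  assumes "polyfun n d f"
  shows "\<exists>D. (\<forall>l<n. polyfun n (d - 1) (D l)) \<and> (d = 0 \<longrightarrow> D = (\<lambda>l x. 0)) \<and> gradient n f D"
  using assms
proof (induction rule: polyfun_induct)
  case (const d c)
  show ?case by (rule exI[of _ "\<lambda>l x. 0"]) (simp add: gradient_def)
next
  case (mult d f j)
  from mult.IH obtain D where D: "\<forall>l<n. polyfun n (d - 1) (D l)" "d = 0 \<longrightarrow> D = (\<lambda>l x. 0)"
    "gradient n f D" by (elim exE conjE)
  define E where "E l x = (if l = j then f x else 0) + x j * D l x" for l x
  have "polyfun n d (E l)" if "l < n" for l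
  proof -
    have "polyfun n d (\<lambda>x. x j * D l x)"
    proof (cases "d = 0")
      case True then show ?thesis using D by simp
    next
      case False
      then have "polyfun n (1 + (d - 1)) (\<lambda>x. x j * D l x)"
        using that mult D by (intro polyfun_mult polyfun_coord) auto
      then show ?thesis using False by simp
    qed
    moreover have "polyfun n d (\<lambda>x. if l = j then f x else 0)"
      using mult by (cases "l = j") auto
    ultimately show ?thesis using polyfun.add[of n d "\<lambda>x. if l = j then f x else 0" "\<lambda>x. x j * D l x"] by (simp add: E_def[abs_def])
  qed
  moreover have "gradient n (\<lambda>x. x j * f x) E"
    unfolding gradient_def
  proof (intro allI impI)
    fix c :: "real \<Rightarrow> nat \<Rightarrow> real" and c' t
    assume *: "\<forall>i<n. ((\<lambda>t. c t i) has_real_derivative c' i) (at t)"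
    have "((\<lambda>t. c t j * f (c t)) has_real_derivative
        c' j * f (c t) + (\<Sum>l<n. D l (c t) * c' l) * c t j) (at t)"
      using * D(3) mult(1) by (intro DERIV_mult) (auto simp: gradient_def)
    moreover have "(\<Sum>l<n. E l (c t) * c' l) = c' j * f (c t) + (\<Sum>l<n. D l (c t) * c' l) * c t j"
    proof -
      have "(\<Sum>l<n. E l (c t) * c' l) = (\<Sum>l<n. if l = j then f (c t) * c' l else 0) + (\<Sum>l<n. c t j * D l (c t) * c' l)"
        unfolding sum.distrib[symmetric] by (rule sum.cong) (auto simp: E_def algebra_simps)
      then show ?thesis using mult(1) by (simp add: sum_distrib_left mult_ac sum_distrib_right)
    qed
    ultimately show "((\<lambda>t. c t j * f (c t)) has_real_derivative (\<Sum>l<n. E l (c t) * c' l)) (at t)" by simp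
  qed
  ultimately show ?case by (intro exI[of _ E]) simp
next
  case (add d f g)
  from add.IH(1) obtain D where D: "\<forall>l<n. polyfun n (d - 1) (D l)" "d = 0 \<longrightarrow> D = (\<lambda>l x. 0)"
    "gradient n f D" by (elim exE conjE)
  from add.IH(2) obtain E where E: "\<forall>l<n. polyfun n (d - 1) (E l)" "d = 0 \<longrightarrow> E = (\<lambda>l x. 0)"
    "gradient n g E" by (elim exE conjE)
  have "gradient n (\<lambda>x. f x + g x) (\<lambda>l x. D l x + E l x)"
    unfolding gradient_def
  proof (intro allI impI)
    fix c :: "real \<Rightarrow> nat \<Rightarrow> real" and c' t
    assume *: "\<forall>i<n. ((\<lambda>t. c t i) has_real_derivative c' i) (at t)"
    have "((\<lambda>t. f (c t) + g (c t)) has_real_derivative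
        (\<Sum>l<n. D l (c t) * c' l) + (\<Sum>l<n. E l (c t) * c' l)) (at t)"
      using D(3) E(3) * by (intro DERIV_add) (simp_all add: gradient_def)
    then show "((\<lambda>t. f (c t) + g (c t)) has_real_derivative
        (\<Sum>l<n. (D l (c t) + E l (c t)) * c' l)) (at t)"
      by (simp only: distrib_right sum.distrib)
  qed
  then show ?case
    using D(1,2) E(1,2) by (intro exI[of _ "\<lambda>l x. D l x + E l x"]) (simp add: polyfun.add)
qed

lemma
  assumes "polyfun n d f"
  shows polyfun_pd: "l < n \<Longrightarrow> polyfun n (d - 1) (pd l f)"
    and pd_degree_0: "l < n \<Longrightarrow> d = 0 \<Longrightarrow> pd l f = (\<lambda>x. 0)"
    and gradient_pd: "gradient n f (\<lambda>l. pd l f)"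
proof -
  from polyfun_gradient[OF assms] obtain D where D: "\<forall>l<n. polyfun n (d - 1) (D l)"
    "d = 0 \<longrightarrow> D = (\<lambda>l x. 0)" "gradient n f D" by (elim exE conjE)
  \<comment> \<open>The chain rule along the curve that moves coordinate \<open>l\<close> alone
    identifies every gradient with the analytically defined \<open>pd\<close>.\<close>
  have pd: "pd l f = D l" if "l < n" for l
  proof
    fix x :: "nat \<Rightarrow> real"
    have "((\<lambda>t. f (x(l := t))) has_real_derivative
        (\<Sum>k<n. D k (x(l := x l)) * (if k = l then 1 else 0))) (at (x l))"
      by (rule D(3)[unfolded gradient_def, rule_format]) (auto intro!: derivative_eq_intros)
    then show "pd l f x = D l x"
      using that by (simp add: pd_def if_distrib DERIV_imp_deriv cong: if_cong)
  qed
  show "l < n \<Longrightarrow> polyfun n (d - 1) (pd l f)" using D(1) pd by simp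
  show "l < n \<Longrightarrow> d = 0 \<Longrightarrow> pd l f = (\<lambda>x. 0)" using D(2) pd by simp
  show "gradient n f (\<lambda>l. pd l f)"
    using D(3) by (simp add: gradient_def pd)
qed

lemma polyfun_chain:
  assumes "polyfun n d f" "\<And>i. i < n \<Longrightarrow> ((\<lambda>t. c t i) has_real_derivative c' i) (at t)"
  shows "((\<lambda>t. f (c t)) has_real_derivative (\<Sum>l<n. pd l f (c t) * c' l)) (at t)"
  using gradient_pd[OF assms(1)] assms(2) by (simp add: gradient_def)

lemma pd_eqI:
  "((\<lambda>t. f (x(l := t))) has_real_derivative D) (at (x l)) \<Longrightarrow> pd l f x = D"
  unfolding pd_def by (rule DERIV_imp_deriv)

lemma polyfun_has_pd:
  assumes "polyfun n d f" "l < n"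
  shows "((\<lambda>t. f (x(l := t))) has_real_derivative pd l f x) (at (x l))"
proof -
  have "((\<lambda>t. f (x(l := t))) has_real_derivative
      (\<Sum>k<n. pd k f (x(l := x l)) * (if k = l then 1 else 0))) (at (x l))"
    by (rule polyfun_chain[OF assms(1)]) (auto intro!: derivative_eq_intros)
  then show ?thesis using assms(2) by (simp add: if_distrib cong: if_cong)
qed

lemma pd_sum:
  assumes "\<And>j. j \<in> J \<Longrightarrow> polyfun n d (f j)" "l < n"
  shows "pd l (\<lambda>x. \<Sum>j\<in>J. c j * f j x) x = (\<Sum>j\<in>J. c j * pd l (f j) x)"
  by (rule pd_eqI) (auto intro!: derivative_eq_intros polyfun_has_pd assms sum.cong)

lemma pd_cmult:
  assumes "polyfun n d f" "l < n"
  shows "pd l (\<lambda>x. c * f x) x = c * pd l f x"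
  by (rule pd_eqI) (auto intro!: derivative_eq_intros polyfun_has_pd assms)

lemma pd_sum_squares:
  assumes "\<And>j. j \<in> J \<Longrightarrow> polyfun n d (f j)" "l < n"
  shows "pd l (\<lambda>x. \<Sum>j\<in>J. (f j x - m j)\<^sup>2) x = (\<Sum>j\<in>J. 2 * (f j x - m j) * pd l (f j) x)"
  by (rule pd_eqI) (auto intro!: derivative_eq_intros polyfun_has_pd assms sum.cong)

lemma pd_affine:
  assumes "polyfun n d f" "l < n"
  shows "pd l (\<lambda>y. f (\<lambda>i. w i + s * y i)) y = s * pd l f (\<lambda>i. w i + s * y i)"
proof (rule pd_eqI)
  have "((\<lambda>t. f (\<lambda>i. w i + s * (y(l := t)) i)) has_real_derivative
     (\<Sum>k<n. pd k f (\<lambda>i. w i + s * (y(l := y l)) i) * (if k = l then s else 0))) (at (y l))"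
    by (rule polyfun_chain[OF assms(1)]) (auto intro!: derivative_eq_intros)
  then show "((\<lambda>t. f (\<lambda>i. w i + s * (y(l := t)) i)) has_real_derivative
     s * pd l f (\<lambda>i. w i + s * y i)) (at (y l))"
    using assms(2) by (simp add: if_distrib mult_ac cong: if_cong)
qed

lemma polyfun_eval_poly:
  assumes "p \<in> polys_in n" "total_degree_le p d"
  shows "polyfun n d (eval_poly p)"
proof -
  have "polyfun n d (\<lambda>x. Poly_Mapping.lookup p m * (\<Prod>i \<in> Poly_Mapping.keys m. x i ^ Poly_Mapping.lookup m i))"
    if "m \<in> Poly_Mapping.keys p" for m
  proof -
    have sub: "Poly_Mapping.keys m \<subseteq> {..<n}" using assms(1) that by (auto simp: polys_in_def)
    have "(\<Prod>i \<in> Poly_Mapping.keys m. x i ^ Poly_Mapping.lookup m i) = (\<Prod>i<n. x i ^ Poly_Mapping.lookup m i)"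
      for x :: "nat \<Rightarrow> real"
      by (rule prod.mono_neutral_left) (use sub in \<open>auto simp: in_keys_iff\<close>)
    moreover have "(\<Sum>i \<in> Poly_Mapping.keys m. Poly_Mapping.lookup m i) = (\<Sum>i<n. Poly_Mapping.lookup m i)"
      by (rule sum.mono_neutral_left) (use sub in \<open>auto simp: in_keys_iff\<close>)
    ultimately show ?thesis
      using assms(2) that by (auto simp: total_degree_le_def intro!: polyfun.monomial)
  qed
  then have "polyfun n d (\<lambda>x. eval_poly p x)"
    unfolding eval_poly_def by (rule polyfun_sum)
  then show ?thesis .
qed

section \<open>Rotation invariance of the Gaussian measure\<close>

abbreviation gauss1 :: "real measure" where
  "gauss1 \<equiv> density lborel (\<lambda>t. ennreal (std_normal_density t))"

definition gauss :: "'i set \<Rightarrow> ('i \<Rightarrow> real) measure" where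
  "gauss I = Pi\<^sub>M I (\<lambda>_. gauss1)"

lemma std_gaussian_eq: "std_gaussian n = gauss {..<n}"
  by (simp add: std_gaussian_def gauss_def)

interpretation gauss1: prob_space gauss1
  by (rule prob_space_normal_density) simp

interpretation gauss_prod: product_sigma_finite "\<lambda>_. gauss1"
  by unfold_locales

interpretation gauss1_pair: pair_prob_space gauss1 gauss1
  by unfold_locales

lemma sets_gauss1 [measurable_cong, simp]: "sets gauss1 = sets borel" by simp

lemma prob_space_gauss: "prob_space (gauss I)"
  unfolding gauss_def by (rule prob_space_PiM) (rule gauss1.prob_space_axioms)

lemma sets_gauss [measurable_cong]: "sets (gauss I) = sets (Pi\<^sub>M I (\<lambda>_. borel))"
  unfolding gauss_def by (rule sets_PiM_cong) auto

lemma space_gauss: "space (gauss I) = extensional I"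
  by (simp add: gauss_def space_PiM PiE_def)

interpretation gauss: prob_space "gauss I" for I
  by (rule prob_space_gauss)

interpretation gauss_pair: pair_prob_space "gauss I" "gauss J" for I J
  by unfold_locales

text \<open>A rotation is a composition of two one-dimensional affine substitutions, one in each
  variable for a fixed value of the other, exchanged by Fubini. Their Jacobians cancel, but both
  need c to be nonzero; the quarter turns are reflections of the single variables after an
  exchange.\<close>

lemma nn_integral_lborel_rotate:
  fixes h :: "real \<times> real \<Rightarrow> ennreal"
  assumes [measurable]: "h \<in> borel_measurable (borel \<Otimes>\<^sub>M borel)" and cs: "c\<^sup>2 + s\<^sup>2 = (1::real)"
  shows "(\<integral>\<^sup>+a. \<integral>\<^sup>+b. h (c * a + s * b, c * b - s * a) \<partial>lborel \<partial>lborel) = (\<integral>\<^sup>+a. \<integral>\<^sup>+b. h (a, b) \<partial>lborel \<partial>lborel)"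
proof (cases "c = 0")
  case True
  then have s: "s = 1 \<or> s = -1" using cs by (auto simp: power2_eq_1_iff)
  have "(\<integral>\<^sup>+a. \<integral>\<^sup>+b. h (s * b, - (s * a)) \<partial>lborel \<partial>lborel) = (\<integral>\<^sup>+a. \<integral>\<^sup>+b. h (b, - (s * a)) \<partial>lborel \<partial>lborel)"
    using s by (subst (2) nn_integral_real_affine[where c=s and t=0]) auto
  also have "\<dots> = (\<integral>\<^sup>+a. \<integral>\<^sup>+b. h (b, a) \<partial>lborel \<partial>lborel)"
    using s by (subst (2) nn_integral_real_affine[where c="-s" and t=0]) auto
  also have "\<dots> = (\<integral>\<^sup>+a. \<integral>\<^sup>+b. h (a, b) \<partial>lborel \<partial>lborel)"
    by (rule lborel_pair.Fubini') simp
  finally show ?thesis using True by simp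
next
  case False
  define I where "I = (\<integral>\<^sup>+a. \<integral>\<^sup>+b. h (c * a + s * b, c * b - s * a) \<partial>lborel \<partial>lborel)"
  have "ennreal \<bar>c\<bar> * I = ennreal \<bar>c\<bar> * (\<integral>\<^sup>+b. \<integral>\<^sup>+a. h (c * a + s * b, c * b - s * a) \<partial>lborel \<partial>lborel)"
    unfolding I_def by (subst lborel_pair.Fubini') auto
  also have "\<dots> = (\<integral>\<^sup>+b. ennreal \<bar>c\<bar> * (\<integral>\<^sup>+a. h (c * a + s * b, c * b - s * a) \<partial>lborel) \<partial>lborel)"
    by (subst nn_integral_cmult) auto
  also have "\<dots> = (\<integral>\<^sup>+b. \<integral>\<^sup>+a. h (a, (b - s * a) / c) \<partial>lborel \<partial>lborel)"
  proof (intro nn_integral_cong)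
    fix b :: real
    have "c * b - s * a = (b - s * (s * b + c * a)) / c" for a
    proof -
      have "b - s * (s * b + c * a) = b * (1 - s\<^sup>2) - c * s * a" by (simp add: algebra_simps power2_eq_square)
      also have "1 - s\<^sup>2 = c\<^sup>2" using cs by simp
      finally show ?thesis using False by (simp add: field_simps power2_eq_square)
    qed
    then show "ennreal \<bar>c\<bar> * (\<integral>\<^sup>+a. h (c * a + s * b, c * b - s * a) \<partial>lborel) = (\<integral>\<^sup>+a. h (a, (b - s * a) / c) \<partial>lborel)"
      using False by (subst (2) nn_integral_real_affine[where c=c and t="s*b"]) (auto simp: add.commute)
  qed
  also have "\<dots> = (\<integral>\<^sup>+a. \<integral>\<^sup>+b. h (a, (b - s * a) / c) \<partial>lborel \<partial>lborel)"
    by (subst lborel_pair.Fubini') auto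
  also have "\<dots> = (\<integral>\<^sup>+a. ennreal \<bar>c\<bar> * (\<integral>\<^sup>+b. h (a, b) \<partial>lborel) \<partial>lborel)"
  proof (intro nn_integral_cong)
    fix a :: real
    have "(\<integral>\<^sup>+b. h (a, (b - s * a) / c) \<partial>lborel) = ennreal \<bar>c\<bar> * (\<integral>\<^sup>+b. h (a, (s * a + c * b - s * a) / c) \<partial>lborel)"
      using False by (subst nn_integral_real_affine[where c=c and t="s*a"]) auto
    then show "(\<integral>\<^sup>+b. h (a, (b - s * a) / c) \<partial>lborel) = ennreal \<bar>c\<bar> * (\<integral>\<^sup>+b. h (a, b) \<partial>lborel)"
      using False by simp
  qed
  also have "\<dots> = ennreal \<bar>c\<bar> * (\<integral>\<^sup>+a. \<integral>\<^sup>+b. h (a, b) \<partial>lborel \<partial>lborel)"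
    by (subst nn_integral_cmult) auto
  finally show ?thesis
    unfolding I_def[symmetric] using False by (simp add: ennreal_mult_cancel_left)
qed

text \<open>The joint density depends on a^2 + b^2 only, so the invariance reduces to that of
  Lebesgue measure on the plane.\<close>

lemma distr_gauss1_pair_rotate:
  assumes cs: "c\<^sup>2 + s\<^sup>2 = (1::real)"
  shows "distr (gauss1 \<Otimes>\<^sub>M gauss1) (gauss1 \<Otimes>\<^sub>M gauss1) (\<lambda>(a, b). (c * a + s * b, c * b - s * a)) = gauss1 \<Otimes>\<^sub>M gauss1"
    (is "distr ?N ?N ?r = _")
proof (rule measure_eqI)
  have sN[measurable_cong]: "sets ?N = sets (borel \<Otimes>\<^sub>M borel)" by (rule sets_pair_measure_cong) auto
  have nn: "(\<integral>\<^sup>+z. f z \<partial>?N) = (\<integral>\<^sup>+a. \<integral>\<^sup>+b. ennreal (std_normal_density a * std_normal_density b) * f (a, b) \<partial>lborel \<partial>lborel)"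
    if [measurable]: "f \<in> borel_measurable (borel \<Otimes>\<^sub>M borel)" for f
  proof -
    have "(\<integral>\<^sup>+z. f z \<partial>?N) = (\<integral>\<^sup>+a. \<integral>\<^sup>+b. f (a, b) \<partial>gauss1 \<partial>gauss1)"
      by (rule gauss1.nn_integral_fst[symmetric]) measurable
    also have "\<dots> = (\<integral>\<^sup>+a. ennreal (std_normal_density a) * (\<integral>\<^sup>+b. ennreal (std_normal_density b) * f (a, b) \<partial>lborel) \<partial>lborel)"
      by (simp add: nn_integral_density)
    finally show ?thesis
      by (simp add: nn_integral_cmult[symmetric] ennreal_mult mult.assoc)
  qed
  fix A assume "A \<in> sets (distr ?N ?N ?r)"
  then have [measurable]: "A \<in> sets (borel \<Otimes>\<^sub>M borel)" by (simp add: sN)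
  have phi: "std_normal_density a * std_normal_density b
     = std_normal_density (c * a + s * b) * std_normal_density (c * b - s * a)" for a b
  proof -
    have "(c * a + s * b)\<^sup>2 + (c * b - s * a)\<^sup>2 = (c\<^sup>2 + s\<^sup>2) * (a\<^sup>2 + b\<^sup>2)"
      by (simp add: power2_eq_square algebra_simps)
    then have "a\<^sup>2 + b\<^sup>2 = (c * a + s * b)\<^sup>2 + (c * b - s * a)\<^sup>2" using cs by simp
    then show ?thesis
      by (simp add: std_normal_density_def mult_exp_exp add_divide_distrib[symmetric])
  qed
  have "emeasure (distr ?N ?N ?r) A = (\<integral>\<^sup>+z. indicator A (?r z) \<partial>?N)"
  proof -
    have [measurable]: "?r \<in> measurable ?N ?N" unfolding case_prod_beta by measurable
    have "emeasure (distr ?N ?N ?r) A = (\<integral>\<^sup>+z. indicator A z \<partial>distr ?N ?N ?r)" by (simp add: sN)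
    also have "\<dots> = (\<integral>\<^sup>+z. indicator A (?r z) \<partial>?N)" by (rule nn_integral_distr) (simp_all add: sN)
    finally show ?thesis .
  qed
  also have "\<dots> = (\<integral>\<^sup>+a. \<integral>\<^sup>+b. ennreal (std_normal_density a * std_normal_density b) * indicator A (c * a + s * b, c * b - s * a) \<partial>lborel \<partial>lborel)"
    by (subst nn) auto
  also have "\<dots> = (\<integral>\<^sup>+a. \<integral>\<^sup>+b. ennreal (std_normal_density a * std_normal_density b) * indicator A (a, b) \<partial>lborel \<partial>lborel)"
    using nn_integral_lborel_rotate[OF _ cs, of "\<lambda>(a, b). ennreal (std_normal_density a * std_normal_density b) * indicator A (a, b)"]
    by (simp add: phi[symmetric])
  also have "\<dots> = emeasure ?N A"
    by (subst nn[symmetric]) (auto simp: sN)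
  finally show "emeasure (distr ?N ?N ?r) A = emeasure ?N A" .
qed simp

text \<open>Two independent vectors are regrouped into one vector of independent pairs, because
  there the rotation acts on each index separately.\<close>

lemma distr_zip_gauss:
  assumes "finite I"
  shows "distr (gauss I \<Otimes>\<^sub>M gauss I) (Pi\<^sub>M I (\<lambda>_. gauss1 \<Otimes>\<^sub>M gauss1)) (\<lambda>(x, y). \<lambda>i\<in>I. (x i, y i))
    = Pi\<^sub>M I (\<lambda>_. gauss1 \<Otimes>\<^sub>M gauss1)"
    (is "distr ?G ?P ?z = _")
proof -
  interpret P: product_sigma_finite "\<lambda>_::'a. gauss1 \<Otimes>\<^sub>M gauss1" by unfold_locales
  have sN[measurable_cong]: "sets (gauss1 \<Otimes>\<^sub>M gauss1) = sets (borel \<Otimes>\<^sub>M borel)" by (rule sets_pair_measure_cong) auto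
  have zm[measurable]: "?z \<in> measurable ?G ?P"
    by (auto simp: case_prod_beta gauss_def intro!: measurable_restrict measurable_Pair) 
  show ?thesis
  proof (rule P.PiM_eqI[OF assms])
    fix A assume A: "\<And>i. i \<in> I \<Longrightarrow> A i \<in> sets (gauss1 \<Otimes>\<^sub>M gauss1)"
    then have Am: "\<And>i. i \<in> I \<Longrightarrow> A i \<in> sets (borel \<Otimes>\<^sub>M borel)" by (simp add: sN)
    have PA: "Pi\<^sub>E I A \<in> sets ?P" using A assms by (intro sets_PiM_I_finite) auto
    have "emeasure (distr ?G ?P ?z) (Pi\<^sub>E I A) = (\<integral>\<^sup>+w. indicator (Pi\<^sub>E I A) (?z w) \<partial>?G)"
      using PA by (subst nn_integral_indicator[symmetric], simp, subst nn_integral_distr) auto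
    also have "\<dots> = (\<integral>\<^sup>+w. (\<Prod>i\<in>I. indicator (A i) (fst w i, snd w i)) \<partial>?G)"
    proof (intro nn_integral_cong)
      fix w show "indicator (Pi\<^sub>E I A) (?z w) = (\<Prod>i\<in>I. indicator (A i) (fst w i, snd w i) :: ennreal)"
      proof (cases "\<forall>i\<in>I. (fst w i, snd w i) \<in> A i")
        case True then show ?thesis by (auto simp: indicator_def case_prod_beta)
      next
        case False
        then have "(\<Prod>i\<in>I. indicator (A i) (fst w i, snd w i) :: ennreal) = 0"
          using assms by (intro prod_zero) (auto simp: indicator_def)
        then show ?thesis using False by (auto simp: indicator_def case_prod_beta PiE_iff)
      qed
    qed
    also have "\<dots> = (\<integral>\<^sup>+x. \<integral>\<^sup>+y. (\<Prod>i\<in>I. indicator (A i) (x i, y i)) \<partial>gauss I \<partial>gauss I)"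
    proof -
      have [measurable]: "(\<lambda>w. (\<Prod>i\<in>I. indicator (A i) (fst w i, snd w i) :: ennreal)) \<in> borel_measurable ?G"
      proof (rule borel_measurable_prod_ennreal)
        fix i assume i: "i \<in> I"
        have [measurable]: "A i \<in> sets (borel \<Otimes>\<^sub>M borel)" using Am i by simp
        have [measurable]: "(\<lambda>w. (fst w i, snd w i)) \<in> measurable ?G (borel \<Otimes>\<^sub>M borel)"
          using i by (auto simp: gauss_def intro!: measurable_Pair)
        show "(\<lambda>w. indicator (A i) (fst w i, snd w i) :: ennreal) \<in> borel_measurable ?G" by measurable
      qed
      show ?thesis by (subst gauss.nn_integral_fst[symmetric]) auto
    qed
    also have "\<dots> = (\<integral>\<^sup>+x. (\<Prod>i\<in>I. \<integral>\<^sup>+b. indicator (A i) (x i, b) \<partial>gauss1) \<partial>gauss I)"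
    proof (intro nn_integral_cong)
      fix x
      show "(\<integral>\<^sup>+y. (\<Prod>i\<in>I. indicator (A i) (x i, y i)) \<partial>gauss I) = (\<Prod>i\<in>I. \<integral>\<^sup>+b. indicator (A i) (x i, b) \<partial>gauss1)"
        unfolding gauss_def
      proof (rule gauss_prod.product_nn_integral_prod[OF assms])
        fix i assume i: "i \<in> I"
        have [measurable]: "A i \<in> sets (borel \<Otimes>\<^sub>M borel)" using Am i by simp
        show "(\<lambda>b. indicator (A i) (x i, b) :: ennreal) \<in> borel_measurable gauss1" by measurable
      qed
    qed
    also have "\<dots> = (\<Prod>i\<in>I. \<integral>\<^sup>+a. \<integral>\<^sup>+b. indicator (A i) (a, b) \<partial>gauss1 \<partial>gauss1)"
      unfolding gauss_def
    proof (rule gauss_prod.product_nn_integral_prod[OF assms])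
      fix i assume i: "i \<in> I"
      have [measurable]: "A i \<in> sets (borel \<Otimes>\<^sub>M borel)" using Am i by simp
      show "(\<lambda>a. \<integral>\<^sup>+b. indicator (A i) (a, b) \<partial>gauss1) \<in> borel_measurable gauss1" by measurable
    qed
    also have "\<dots> = (\<Prod>i\<in>I. emeasure (gauss1 \<Otimes>\<^sub>M gauss1) (A i))"
    proof (intro prod.cong refl)
      fix i assume i: "i \<in> I"
      have [measurable]: "A i \<in> sets (borel \<Otimes>\<^sub>M borel)" using Am i by simp
      show "(\<integral>\<^sup>+a. \<integral>\<^sup>+b. indicator (A i) (a, b) \<partial>gauss1 \<partial>gauss1) = emeasure (gauss1 \<Otimes>\<^sub>M gauss1) (A i)"
        by (subst gauss1.nn_integral_fst) (auto simp: sN)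
    qed
    finally show "emeasure (distr ?G ?P ?z) (Pi\<^sub>E I A) = (\<Prod>i\<in>I. emeasure (gauss1 \<Otimes>\<^sub>M gauss1) (A i))" .
  qed simp
qed

text \<open>For c = cos t and s = sin t the first component is the position at time t on the circle
  through \<open>x\<close> and \<open>y\<close>, the second component its velocity.\<close>

definition rot :: "'i set \<Rightarrow> real \<Rightarrow> real \<Rightarrow> ('i \<Rightarrow> real) \<times> ('i \<Rightarrow> real) \<Rightarrow> ('i \<Rightarrow> real) \<times> ('i \<Rightarrow> real)" where
  "rot I c s = (\<lambda>(x, y). (\<lambda>i\<in>I. c * x i + s * y i, \<lambda>i\<in>I. c * y i - s * x i))"

lemma measurable_rot [measurable]:
  "rot I c s \<in> measurable (gauss I \<Otimes>\<^sub>M gauss I) (gauss I \<Otimes>\<^sub>M gauss I)"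
  unfolding rot_def case_prod_beta gauss_def
  by (intro measurable_Pair measurable_restrict) measurable

text \<open>Up to regrouping, \<open>rot\<close> is the plane rotation applied at every index, and a
  product of invariant measures is invariant.\<close>

lemma distr_rot_gauss:
  assumes "finite I" and cs: "c\<^sup>2 + s\<^sup>2 = 1"
  shows "distr (gauss I \<Otimes>\<^sub>M gauss I) (gauss I \<Otimes>\<^sub>M gauss I) (rot I c s) = gauss I \<Otimes>\<^sub>M gauss I"
proof -
  let ?G = "gauss I \<Otimes>\<^sub>M gauss I" and ?N = "gauss1 \<Otimes>\<^sub>M gauss1"
  let ?P = "Pi\<^sub>M I (\<lambda>_. ?N)"
  define z where "z = (\<lambda>(x :: 'a \<Rightarrow> real, y :: 'a \<Rightarrow> real). \<lambda>i\<in>I. (x i, y i))"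
  define u where "u = (\<lambda>e :: 'a \<Rightarrow> real \<times> real. (\<lambda>i\<in>I. fst (e i), \<lambda>i\<in>I. snd (e i)))"
  define r where "r = (\<lambda>(a, b). (c * a + s * b, c * b - s * a))"
  have z[measurable]: "z \<in> measurable ?G ?P"
    by (auto simp: z_def case_prod_beta gauss_def intro!: measurable_restrict measurable_Pair)
  have u[measurable]: "u \<in> measurable ?P ?G"
    unfolding u_def gauss_def by (intro measurable_Pair measurable_restrict) measurable
  have sN[measurable_cong]: "sets ?N = sets (borel \<Otimes>\<^sub>M borel)" by (rule sets_pair_measure_cong) auto
  have r[measurable]: "r \<in> measurable ?N ?N" unfolding r_def case_prod_beta by measurable
  have cr[measurable]: "compose I r \<in> measurable ?P ?P"
    unfolding compose_def by (intro measurable_restrict) (auto intro: measurable_compose[OF _ r])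
  have zG: "distr ?G ?P z = ?P" unfolding z_def by (rule distr_zip_gauss[OF assms(1)])
  have uz: "u (z w) = w" if "w \<in> space ?G" for w
    using that by (auto simp: u_def z_def space_pair_measure space_gauss extensional_def fun_eq_iff)
  have ruz: "rot I c s w = u (compose I r (z w))" for w
    by (auto simp: u_def z_def rot_def r_def compose_def fun_eq_iff case_prod_beta)
  have "distr ?G ?G (rot I c s) = distr ?G ?G (u \<circ> (compose I r \<circ> z))"
    by (rule distr_cong) (auto simp: ruz)
  also have "\<dots> = distr (distr (distr ?G ?P z) ?P (compose I r)) ?G u"
    by (subst distr_distr, measurable, subst distr_distr) (auto simp: comp_assoc)
  also have "\<dots> = distr (distr ?P ?P (compose I r)) ?G u" by (simp add: zG)
  also have "distr ?P ?P (compose I r) = ?P"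
    using distr_PiM_finite_prob_space'[OF assms(1), of "\<lambda>_. ?N" "\<lambda>_. ?N" r]
      distr_gauss1_pair_rotate[OF cs] r gauss1_pair.prob_space_axioms by (simp add: r_def[symmetric])
  also have "distr ?P ?G u = distr (distr ?G ?P z) ?G u" by (simp add: zG)
  also have "\<dots> = distr ?G ?G (u \<circ> z)" by (rule distr_distr) measurable
  also have "\<dots> = distr ?G ?G (\<lambda>w. w)" by (rule distr_cong) (auto simp: uz)
  finally show ?thesis by (simp add: distr_id)
qed

section \<open>Moments of linear forms under the Gaussian measure\<close>

lemma measurable_gauss_coord [measurable]:
  "i \<in> I \<Longrightarrow> (\<lambda>x. x i) \<in> borel_measurable (gauss I)"
  by (auto simp: gauss_def intro!: measurable_PiM_component_rev)

lemma integrable_gauss1_power [simp]: "integrable gauss1 (\<lambda>a. a ^ k)"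
  by (subst integrable_density) (auto intro: integrable_std_normal_moment)

lemma integrable_gauss1_id [simp]: "integrable gauss1 (\<lambda>a. a)"
  using integrable_gauss1_power[of 1] by simp

lemma prob_gauss1_UNIV [simp]: "measure gauss1 UNIV = 1"
  using gauss1.prob_space by simp

lemma integral_gauss1_moments:
  "(\<integral>a. a \<partial>gauss1) = 0" "(\<integral>a. a^2 \<partial>gauss1) = 1" "(\<integral>a. a^3 \<partial>gauss1) = 0" "(\<integral>a. a^4 \<partial>gauss1) = 3"
proof -
  have *: "(\<integral>a. a ^ k \<partial>gauss1) = (\<integral>a. std_normal_density a * a ^ k \<partial>lborel)" for k
    by (subst integral_density) auto
  show "(\<integral>a. a \<partial>gauss1) = 0"
    using *[of 1] integral_std_normal_moment_odd[of 0] by simp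
  show "(\<integral>a. a^2 \<partial>gauss1) = 1"
    using *[of 2] integral_std_normal_moment_even[of 1] by simp
  show "(\<integral>a. a^3 \<partial>gauss1) = 0"
    using *[of 3] integral_std_normal_moment_odd[of 1] by (simp add: numeral_3_eq_3 numeral_2_eq_2)
  show "(\<integral>a. a^4 \<partial>gauss1) = 3"
    using *[of 4] integral_std_normal_moment_even[of 2] by (simp add: fact_numeral)
qed

lemma polyfun_integrable_gauss:
  assumes "polyfun n d f" shows "integrable (gauss {..<n}) f"
  using assms
proof (induction rule: polyfun.induct)
  case (monomial m c)
  have "integrable (gauss {..<n}) (\<lambda>x. \<Prod>i<n. x i ^ m i)"
    unfolding gauss_def by (rule gauss_prod.product_integrable_prod) auto
  then show ?case by simp
qed simp

lemma polyfun_sum_coords: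
  assumes "1 \<le> d" shows "polyfun n d (\<lambda>x. \<Sum>i<n. c i * x i)"
  using assms by (intro polyfun_sum polyfun_cmult polyfun_coord) auto

lemma integral_gauss_Suc:
  assumes "polyfun (Suc n) d f"
  shows "(\<integral>x. f x \<partial>gauss {..<Suc n}) = (\<integral>x. \<integral>a. f (x(n := a)) \<partial>gauss1 \<partial>gauss {..<n})"
  using gauss_prod.product_integral_insert[of "{..<n}" n f] polyfun_integrable_gauss[OF assms]
  by (simp add: lessThan_Suc gauss_def)

text \<open>Both moments share one induction over the coordinates, since the fourth moment picks up
  the cross term 6 (c n)^2 times the second moment of the shorter sum. The odd powers of the new
  coordinate integrate to zero.\<close>

lemma gauss_linear_moments:
  fixes n :: nat
  shows "(\<integral>x. (\<Sum>i<n. c i * x i)^2 \<partial>gauss {..<n}) = (\<Sum>i<n. (c i)^2) \<and>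
    (\<integral>x. (\<Sum>i<n. c i * x i)^4 \<partial>gauss {..<n}) = 3 * (\<Sum>i<n. (c i)^2)^2"
proof (induction n)
  case 0
  then show ?case by simp
next
  case (Suc n)
  let ?S = "\<lambda>x :: nat \<Rightarrow> real. \<Sum>i<n. c i * x i"
  have upd: "(\<Sum>i<n. c i * (x(n := a)) i) = ?S x" for x a by (rule sum.cong) auto
  have pS: "polyfun m 1 (\<lambda>x. \<Sum>i<m. c i * x i)" for m by (rule polyfun_sum_coords) simp
  have int: "integrable (gauss {..<n}) (\<lambda>x. ?S x ^ k)" for k
    using polyfun_power[OF pS, of n k] by (rule polyfun_integrable_gauss)
  have 1: "(\<integral>x. (\<Sum>i<Suc n. c i * x i)^2 \<partial>gauss {..<Suc n}) = (\<Sum>i<Suc n. (c i)^2)"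
  proof -
    have "(\<integral>x. (\<Sum>i<Suc n. c i * x i)^2 \<partial>gauss {..<Suc n}) = (\<integral>x. \<integral>a. (?S x + c n * a)^2 \<partial>gauss1 \<partial>gauss {..<n})"
      using integral_gauss_Suc[OF polyfun_power[OF pS], of n 2] by (simp add: upd)
    also have "\<dots> = (\<integral>x. ?S x ^ 2 + (c n)^2 \<partial>gauss {..<n})"
    proof (rule Bochner_Integration.integral_cong[OF refl])
      fix x
      have "(\<integral>a. (?S x + c n * a)^2 \<partial>gauss1) = (\<integral>a. ?S x ^ 2 + 2 * c n * ?S x * a + (c n)^2 * a^2 \<partial>gauss1)"
        by (rule Bochner_Integration.integral_cong) (auto simp: power2_eq_square algebra_simps)
      then show "(\<integral>a. (?S x + c n * a)^2 \<partial>gauss1) = ?S x ^ 2 + (c n)^2"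
        by (simp add: integral_gauss1_moments gauss1.prob_space)
    qed
    finally show ?thesis using Suc.IH int by (simp add: gauss.prob_space)
  qed
  have 2: "(\<integral>x. (\<Sum>i<Suc n. c i * x i)^4 \<partial>gauss {..<Suc n}) = 3 * (\<Sum>i<Suc n. (c i)^2)^2"
  proof -
    have "(\<integral>x. (\<Sum>i<Suc n. c i * x i)^4 \<partial>gauss {..<Suc n}) = (\<integral>x. \<integral>a. (?S x + c n * a)^4 \<partial>gauss1 \<partial>gauss {..<n})"
      using integral_gauss_Suc[OF polyfun_power[OF pS], of n 4] by (simp add: upd)
    also have "\<dots> = (\<integral>x. ?S x ^ 4 + 6 * (c n)^2 * ?S x ^ 2 + 3 * (c n)^4 \<partial>gauss {..<n})"
    proof (rule Bochner_Integration.integral_cong[OF refl])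
      fix x
      have "(\<integral>a. (?S x + c n * a)^4 \<partial>gauss1) = (\<integral>a. ?S x ^ 4 + (4 * c n * ?S x ^ 3) * a
          + (6 * (c n)^2 * ?S x ^ 2) * a^2 + (4 * (c n)^3 * ?S x) * a^3 + (c n)^4 * a^4 \<partial>gauss1)"
        by (rule Bochner_Integration.integral_cong) (auto simp: power2_eq_square power3_eq_cube power4_eq_xxxx algebra_simps)
      then show "(\<integral>a. (?S x + c n * a)^4 \<partial>gauss1) = ?S x ^ 4 + 6 * (c n)^2 * ?S x ^ 2 + 3 * (c n)^4"
        by (simp add: integral_gauss1_moments gauss1.prob_space)
    qed
    also have "\<dots> = (\<integral>x. ?S x ^ 4 \<partial>gauss {..<n}) + 6 * (c n)^2 * (\<integral>x. ?S x ^ 2 \<partial>gauss {..<n}) + 3 * (c n)^4"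
      using int[of 4] int[of 2] by (simp add: gauss.prob_space)
    also have "\<dots> = 3 * (\<Sum>i<Suc n. (c i)^2)^2"
      unfolding Suc.IH[THEN conjunct1] Suc.IH[THEN conjunct2]
      by (simp add: power2_eq_square power4_eq_xxxx algebra_simps)
    finally show ?thesis .
  qed
  from 1 2 show ?case by blast
qed

lemmas gauss_linear_moment_2 = gauss_linear_moments[THEN conjunct1]
lemmas gauss_linear_moment_4 = gauss_linear_moments[THEN conjunct2]

lemma polyfun_isCont:
  assumes "polyfun n d f" "\<And>i. i < n \<Longrightarrow> isCont (\<lambda>t. c t i) t"
  shows "isCont (\<lambda>t. f (c t)) t"
  using assms by (induction rule: polyfun_induct) auto

text \<open>Cauchy-Schwarz for the integral of \<open>u\<close>, read off from the nonnegative
  integral of (u - c)^2, where \<open>c\<close> is the mean slope of \<open>F\<close>.\<close>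

lemma square_diff_le_integral:
  fixes F u :: "real \<Rightarrow> real"
  assumes "a < b" and der: "\<And>t. (F has_real_derivative u t) (at t)" and cont: "\<And>t. isCont u t"
  shows "(F b - F a)\<^sup>2 \<le> (b - a) * (\<integral>t. (u t)\<^sup>2 * indicator {a..b} t \<partial>lborel)"
proof -
  define c where "c = (F b - F a) / (b - a)"
  have I1: "(\<integral>t. u t * indicator {a..b} t \<partial>lborel) = F b - F a"
    using assms by (intro integral_FTC_Icc_real) auto
  have int: "integrable lborel (\<lambda>t. g t * indicator {a..b} t)" if "\<And>t. isCont g t" for g :: "real \<Rightarrow> real"
    using borel_integrable_compact[of "{a..b}" g] that
    by (simp add: continuous_at_imp_continuous_on mult.commute)
  have "0 \<le> (\<integral>t. (u t - c)\<^sup>2 * indicator {a..b} t \<partial>lborel)"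
    by (intro integral_nonneg_AE) (auto simp: indicator_def)
  also have "(\<integral>t. (u t - c)\<^sup>2 * indicator {a..b} t \<partial>lborel)
    = (\<integral>t. (u t)\<^sup>2 * indicator {a..b} t - 2 * c * (u t * indicator {a..b} t) + c\<^sup>2 * indicator {a..b} t \<partial>lborel)"
    by (rule Bochner_Integration.integral_cong) (auto simp: power2_eq_square algebra_simps)
  also have "\<dots> = (\<integral>t. (u t)\<^sup>2 * indicator {a..b} t \<partial>lborel) - 2 * c * (F b - F a) + c\<^sup>2 * (b - a)"
    using int[of u] int[of "\<lambda>t. (u t)\<^sup>2"] int[of "\<lambda>t. 1"] cont assms(1) by (simp add: I1)
  finally have "2 * c * (F b - F a) - c\<^sup>2 * (b - a) \<le> (\<integral>t. (u t)\<^sup>2 * indicator {a..b} t \<partial>lborel)" by simp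
  moreover have "2 * c * (F b - F a) - c\<^sup>2 * (b - a) = (F b - F a)\<^sup>2 / (b - a)"
  proof -
    have "2 * (D / h) * D - (D / h)\<^sup>2 * h = D\<^sup>2 / h" if "h \<noteq> 0" for D h :: real
      using that by (simp add: field_simps power2_eq_square)
    from this[of "b - a" "F b - F a"] show ?thesis using assms(1) unfolding c_def by simp
  qed
  ultimately have "(F b - F a)\<^sup>2 / (b - a) \<le> (\<integral>t. (u t)\<^sup>2 * indicator {a..b} t \<partial>lborel)" by simp
  then show ?thesis using assms(1) by (simp add: pos_divide_le_eq mult.commute)
qed

section \<open>The Gaussian Poincare inequality\<close>

text \<open>Pisier's argument: rotate \<open>x\<close> into an independent copy \<open>y\<close> along a quarter circle; by rotation
  invariance the velocity of the path is at every time distributed like \<open>y\<close>, independently of the position.\<close>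

lemma gauss_poincare:
  assumes f: "polyfun n d f"
  shows "(\<integral>x. (f x - (\<integral>x. f x \<partial>gauss {..<n}))\<^sup>2 \<partial>gauss {..<n}) \<le> 2 * (\<integral>x. (\<Sum>l<n. (pd l f x)\<^sup>2) \<partial>gauss {..<n})"
proof -
  let ?G = "gauss {..<n}"
  let ?GG = "?G \<Otimes>\<^sub>M ?G"
  define X where "X t w i = cos t * fst w i + sin t * snd w i" for t :: real and w :: "(nat \<Rightarrow> real) \<times> (nat \<Rightarrow> real)" and i
  define Y where "Y t w i = cos t * snd w i - sin t * fst w i" for t :: real and w :: "(nat \<Rightarrow> real) \<times> (nat \<Rightarrow> real)" and i
  define u where "u t w = (\<Sum>l<n. pd l f (X t w) * Y t w l)" for t w
  define U where "U w = (\<Sum>l<n. pd l f (fst w) * snd w l)" for w :: "(nat \<Rightarrow> real) \<times> (nat \<Rightarrow> real)"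
  define m where "m = (\<integral>x. f x \<partial>?G)"
  define V where "V = (\<integral>x. (f x - m)\<^sup>2 \<partial>?G)"
  define E where "E = (\<integral>x. (\<Sum>l<n. (pd l f x)\<^sup>2) \<partial>?G)"
  have dX: "((\<lambda>t. X t w i) has_real_derivative Y t w i) (at t)" for t w i
    unfolding X_def Y_def by (auto intro!: derivative_eq_intros)
  have der: "((\<lambda>t. f (X t w)) has_real_derivative u t w) (at t)" for t w
    unfolding u_def by (rule polyfun_chain[OF f]) (rule dX)
  have cX: "isCont (\<lambda>t. X t w i) t" "isCont (\<lambda>t. Y t w i) t" for t w i
    unfolding X_def Y_def by auto
  have cu: "isCont (\<lambda>t. u t w) t" for t w
  proof -
    have "isCont (\<lambda>t. pd l f (X t w) * Y t w l) t" if "l < n" for l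
      by (rule isCont_mult[OF polyfun_isCont[OF polyfun_pd[OF f that] cX(1)] cX(2)])
    then show ?thesis unfolding u_def by (intro continuous_sum) auto
  qed
  have mX: "(\<lambda>z. X (fst z) (snd z) i) \<in> borel_measurable (lborel \<Otimes>\<^sub>M ?GG)"
      "(\<lambda>z. Y (fst z) (snd z) i) \<in> borel_measurable (lborel \<Otimes>\<^sub>M ?GG)" if "i < n" for i
  proof -
    have c: "(\<lambda>z. fst (snd z) i) \<in> borel_measurable (lborel \<Otimes>\<^sub>M ?GG)"
      "(\<lambda>z. snd (snd z) i) \<in> borel_measurable (lborel \<Otimes>\<^sub>M ?GG)"
      using that by (auto intro!: measurable_compose[OF _ measurable_gauss_coord])
    have t: "(\<lambda>z. cos (fst z :: real)) \<in> borel_measurable (lborel \<Otimes>\<^sub>M ?GG)"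
      "(\<lambda>z. sin (fst z :: real)) \<in> borel_measurable (lborel \<Otimes>\<^sub>M ?GG)"
    proof -
      have "(cos :: real \<Rightarrow> real) \<in> borel_measurable borel" "(sin :: real \<Rightarrow> real) \<in> borel_measurable borel"
        by (intro borel_measurable_continuous_onI continuous_on_cos[OF continuous_on_id] continuous_on_sin[OF continuous_on_id])+
      then show "(\<lambda>z. cos (fst z :: real)) \<in> borel_measurable (lborel \<Otimes>\<^sub>M ?GG)"
        "(\<lambda>z. sin (fst z :: real)) \<in> borel_measurable (lborel \<Otimes>\<^sub>M ?GG)"
        by (auto intro!: measurable_compose[OF measurable_fst])
    qed
    show "(\<lambda>z. X (fst z) (snd z) i) \<in> borel_measurable (lborel \<Otimes>\<^sub>M ?GG)"
      "(\<lambda>z. Y (fst z) (snd z) i) \<in> borel_measurable (lborel \<Otimes>\<^sub>M ?GG)"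
      unfolding X_def Y_def by (intro borel_measurable_add borel_measurable_diff borel_measurable_times c t)+
  qed
  have mu: "(\<lambda>z. u (fst z) (snd z)) \<in> borel_measurable (lborel \<Otimes>\<^sub>M ?GG)"
    unfolding u_def
    by (intro borel_measurable_sum borel_measurable_times polyfun_measurable[OF polyfun_pd[OF f]] mX) auto
  have mf[measurable]: "f \<in> borel_measurable ?G" 
    by (rule polyfun_measurable[OF f]) auto
  have mp: "pd l f \<in> borel_measurable ?G" if "l < n" for l
    using that by (intro polyfun_measurable[OF polyfun_pd[OF f]]) auto
  have mU: "U \<in> borel_measurable ?GG"
    unfolding U_def
  proof (intro borel_measurable_sum borel_measurable_times)
    fix l assume "l \<in> {..<n}"
    then have l: "l < n" by simp
    show "(\<lambda>w. pd l f (fst w)) \<in> borel_measurable ?GG"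
      by (rule measurable_compose[OF measurable_fst mp[OF l]])
    show "(\<lambda>w. snd w l) \<in> borel_measurable ?GG"
      using l by (intro measurable_compose[OF measurable_snd measurable_gauss_coord]) simp
  qed
  have pt: "ennreal ((f (snd w) - f (fst w))\<^sup>2) \<le> (\<integral>\<^sup>+t. ennreal (pi / 2 * (u t w)\<^sup>2) * indicator {0..pi/2} t \<partial>lborel)" for w
  proof -
    have "X 0 w = fst w" "X (pi/2) w = snd w" by (auto simp: X_def)
    then have "(f (snd w) - f (fst w))\<^sup>2 \<le> (pi/2 - 0) * (\<integral>t. (u t w)\<^sup>2 * indicator {0..pi/2} t \<partial>lborel)"
      using square_diff_le_integral[of 0 "pi/2" "\<lambda>t. f (X t w)" "\<lambda>t. u t w"] der cu by simp
    then have "ennreal ((f (snd w) - f (fst w))\<^sup>2) \<le> ennreal (\<integral>t. pi/2 * (u t w)\<^sup>2 * indicator {0..pi/2} t \<partial>lborel)"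
      by (simp add: ennreal_leI mult.assoc)
    also have "\<dots> = (\<integral>\<^sup>+t. ennreal (pi/2 * (u t w)\<^sup>2 * indicator {0..pi/2} t) \<partial>lborel)"
      using borel_integrable_compact[of "{0..pi/2}" "\<lambda>t. pi/2 * (u t w)\<^sup>2"] cu
      by (intro nn_integral_eq_integral[symmetric])
         (auto simp: continuous_at_imp_continuous_on mult.commute mult.left_commute indicator_def)
    also have "\<dots> = (\<integral>\<^sup>+t. ennreal (pi/2 * (u t w)\<^sup>2) * indicator {0..pi/2} t \<partial>lborel)"
      by (intro nn_integral_cong) (auto simp: indicator_def)
    finally show ?thesis .
  qed
  have uU: "u t w = U (rot {..<n} (cos t) (sin t) w)" for t w
  proof -
    have "pd l f (X t w) = pd l f (fst (rot {..<n} (cos t) (sin t) w))" if "l < n" for l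
      using that by (intro polyfun_cong_coords[OF polyfun_pd[OF f]]) (auto simp: X_def rot_def case_prod_beta)
    then show ?thesis unfolding u_def U_def by (intro sum.cong) (auto simp: Y_def rot_def case_prod_beta)
  qed
  have intE: "integrable ?G (\<lambda>x. \<Sum>l<n. (pd l f x)\<^sup>2)"
    by (rule polyfun_integrable_gauss, rule polyfun_sum, rule polyfun_power, rule polyfun_pd[OF f]) simp
  have E0: "0 \<le> E" unfolding E_def by (simp add: sum_nonneg)
  \<comment> \<open>For fixed \<open>x\<close> the velocity is a linear form in the Gaussian vector
    \<open>y\<close> with the gradient as coefficient vector, so its second moment is the squared
    length of the gradient.\<close>
  have nU: "(\<integral>\<^sup>+w. ennreal ((U w)\<^sup>2) \<partial>?GG) = ennreal E"
  proof -
    have "(\<integral>\<^sup>+w. ennreal ((U w)\<^sup>2) \<partial>?GG) = (\<integral>\<^sup>+x. \<integral>\<^sup>+y. ennreal ((\<Sum>l<n. pd l f x * y l)\<^sup>2) \<partial>?G \<partial>?G)"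
    proof -
      have "(\<integral>\<^sup>+w. ennreal ((U w)\<^sup>2) \<partial>?GG) = (\<integral>\<^sup>+x. \<integral>\<^sup>+y. ennreal ((U (x, y))\<^sup>2) \<partial>?G \<partial>?G)"
        by (rule gauss.nn_integral_fst[symmetric]) (use mU in measurable)
      then show ?thesis by (simp add: U_def)
    qed
    also have "\<dots> = (\<integral>\<^sup>+x. ennreal (\<Sum>l<n. (pd l f x)\<^sup>2) \<partial>?G)"
    proof (intro nn_integral_cong)
      fix x
      have "integrable ?G (\<lambda>y. (\<Sum>l<n. pd l f x * y l)\<^sup>2)"
        by (rule polyfun_integrable_gauss[OF polyfun_power[OF polyfun_sum_coords[of 1]]]) simp
      then have "(\<integral>\<^sup>+y. ennreal ((\<Sum>l<n. pd l f x * y l)\<^sup>2) \<partial>?G) = ennreal (\<integral>y. (\<Sum>l<n. pd l f x * y l)\<^sup>2 \<partial>?G)"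
        by (rule nn_integral_eq_integral) simp
      then show "(\<integral>\<^sup>+y. ennreal ((\<Sum>l<n. pd l f x * y l)\<^sup>2) \<partial>?G) = ennreal (\<Sum>l<n. (pd l f x)\<^sup>2)"
        by (simp add: gauss_linear_moment_2)
    qed
    also have "\<dots> = ennreal E" unfolding E_def
      by (rule nn_integral_eq_integral[OF intE]) (simp add: sum_nonneg)
    finally show ?thesis .
  qed
  have le0: "(\<integral>\<^sup>+w. ennreal ((f (snd w) - f (fst w))\<^sup>2) \<partial>?GG)
     \<le> (\<integral>\<^sup>+w. \<integral>\<^sup>+t. ennreal (pi / 2 * (u t w)\<^sup>2) * indicator {0..pi/2} t \<partial>lborel \<partial>?GG)"
    by (intro nn_integral_mono pt)
  have e1: "(\<integral>\<^sup>+w. \<integral>\<^sup>+t. ennreal (pi / 2 * (u t w)\<^sup>2) * indicator {0..pi/2} t \<partial>lborel \<partial>?GG) = (\<integral>\<^sup>+t. \<integral>\<^sup>+w. ennreal (pi / 2 * (u t w)\<^sup>2) * indicator {0..pi/2} t \<partial>?GG \<partial>lborel)"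
  proof -
    interpret pair_sigma_finite lborel ?GG ..
    have "(\<lambda>z. ennreal (pi / 2 * (u (fst z) (snd z))\<^sup>2) * indicator {0..pi/2} (fst z)) \<in> borel_measurable (lborel \<Otimes>\<^sub>M ?GG)"
    proof (rule borel_measurable_times_ennreal)
      have "(\<lambda>r. ennreal (pi / 2 * r\<^sup>2)) \<in> borel_measurable borel" by measurable
      from measurable_compose[OF mu this]
      show "(\<lambda>z. ennreal (pi / 2 * (u (fst z) (snd z))\<^sup>2)) \<in> borel_measurable (lborel \<Otimes>\<^sub>M ?GG)" .
      show "(\<lambda>z. indicator {0..pi/2} (fst z) :: ennreal) \<in> borel_measurable (lborel \<Otimes>\<^sub>M ?GG)"
        by (rule measurable_compose[OF measurable_fst]) simp
    qed
    then have "(\<lambda>(t, w). ennreal (pi / 2 * (u t w)\<^sup>2) * indicator {0..pi/2} t) \<in> borel_measurable (lborel \<Otimes>\<^sub>M ?GG)"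
      by (simp only: case_prod_beta')
    then show ?thesis by (rule Fubini'[of "\<lambda>t w. ennreal (pi / 2 * (u t w)\<^sup>2) * indicator {0..pi/2} t"])
  qed
  have e2: "(\<integral>\<^sup>+t. \<integral>\<^sup>+w. ennreal (pi / 2 * (u t w)\<^sup>2) * indicator {0..pi/2} t \<partial>?GG \<partial>lborel) = (\<integral>\<^sup>+t. ennreal (pi / 2 * E) * indicator {0..pi/2::real} t \<partial>lborel)"
  proof (intro nn_integral_cong)
    fix t :: real
    have "(\<integral>\<^sup>+w. ennreal ((u t w)\<^sup>2) \<partial>?GG) = (\<integral>\<^sup>+w. ennreal ((U w)\<^sup>2) \<partial>distr ?GG ?GG (rot {..<n} (cos t) (sin t)))"
    proof -
      have "(\<lambda>r. ennreal (r\<^sup>2)) \<in> borel_measurable borel" by measurable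
      from measurable_compose[OF mU this]
      have "(\<lambda>w. ennreal ((U w)\<^sup>2)) \<in> borel_measurable (distr ?GG ?GG (rot {..<n} (cos t) (sin t)))"
        unfolding measurable_distr_eq1 .
      from nn_integral_distr[OF measurable_rot this]
      show ?thesis by (simp only: uU)
    qed
    also have "\<dots> = ennreal E" by (simp add: distr_rot_gauss nU)
    finally have 1: "(\<integral>\<^sup>+w. ennreal ((u t w)\<^sup>2) \<partial>?GG) = ennreal E" .
    have mt: "(\<lambda>w. u t w) \<in> borel_measurable ?GG"
      unfolding uU by (rule measurable_compose[OF measurable_rot mU])
    have "(\<integral>\<^sup>+w. ennreal (pi / 2 * (u t w)\<^sup>2) * indicator {0..pi/2} t \<partial>?GG)
       = (\<integral>\<^sup>+w. (ennreal (pi / 2) * indicator {0..pi/2} t) * ennreal ((u t w)\<^sup>2) \<partial>?GG)"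
      by (intro nn_integral_cong) (simp only: ennreal_mult[of "pi / 2"] pi_half_ge_zero zero_le_power2 mult_ac)
    also have "\<dots> = (ennreal (pi / 2) * indicator {0..pi/2} t) * ennreal E"
    proof -
      have "(\<lambda>r. ennreal (r\<^sup>2)) \<in> borel_measurable borel" by measurable
      from nn_integral_cmult[OF measurable_compose[OF mt this], of "ennreal (pi / 2) * indicator {0..pi/2} t"]
      show ?thesis by (simp only: 1)
    qed
    also have "\<dots> = ennreal (pi / 2 * E) * indicator {0..pi/2} t"
      using E0 by (subst ennreal_mult) (auto simp: mult_ac)
    finally show "(\<integral>\<^sup>+w. ennreal (pi / 2 * (u t w)\<^sup>2) * indicator {0..pi/2} t \<partial>?GG) = ennreal (pi / 2 * E) * indicator {0..pi/2} t" .
  qed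
  have e3: "(\<integral>\<^sup>+t. ennreal (pi / 2 * E) * indicator {0..pi/2::real} t \<partial>lborel) = ennreal (pi / 2 * E) * ennreal (pi / 2)"
    by (subst nn_integral_cmult_indicator) auto
  have e4: "ennreal (pi / 2 * E) * ennreal (pi / 2) = ennreal (pi / 2 * E * (pi / 2))"
    using E0 by (subst ennreal_mult[symmetric]) auto
  have le: "(\<integral>\<^sup>+w. ennreal ((f (snd w) - f (fst w))\<^sup>2) \<partial>?GG) \<le> ennreal (pi / 2 * E * (pi / 2))"
    by (rule order.trans[OF le0]) (simp only: e1 e2 e3 e4 order.refl)
  have intf: "integrable ?G f" by (rule polyfun_integrable_gauss[OF f])
  have pm: "polyfun n (2 * d) (\<lambda>x. (f x - m)\<^sup>2)"
    by (intro polyfun_power polyfun_diff f polyfun_const)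
  have intV: "integrable ?G (\<lambda>x. (f x - m)\<^sup>2)" by (rule polyfun_integrable_gauss[OF pm])
  have "(\<integral>\<^sup>+w. ennreal ((f (snd w) - f (fst w))\<^sup>2) \<partial>?GG) = (\<integral>\<^sup>+x. \<integral>\<^sup>+y. ennreal ((f y - f x)\<^sup>2) \<partial>?G \<partial>?G)"
  proof -
    have "(\<lambda>w. f (fst w)) \<in> borel_measurable ?GG" "(\<lambda>w. f (snd w)) \<in> borel_measurable ?GG"
      by (rule measurable_compose[OF measurable_fst mf], rule measurable_compose[OF measurable_snd mf])
    then have "(\<lambda>w. ennreal ((f (snd w) - f (fst w))\<^sup>2)) \<in> borel_measurable ?GG" by measurable
    from gauss.nn_integral_fst[OF this, symmetric] show ?thesis by simp
  qed
  also have "\<dots> = (\<integral>\<^sup>+x. ennreal (V + (f x - m)\<^sup>2) \<partial>?G)"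
  proof (intro nn_integral_cong)
    fix x
    have eq: "(f y - f x)\<^sup>2 = (f y - m)\<^sup>2 + 2 * (m - f x) * (f y - m) + (f x - m)\<^sup>2" for y
      by (simp add: power2_eq_square algebra_simps)
    have "(\<integral>\<^sup>+y. ennreal ((f y - f x)\<^sup>2) \<partial>?G) = ennreal (\<integral>y. (f y - f x)\<^sup>2 \<partial>?G)"
      by (rule nn_integral_eq_integral)
        (intro polyfun_integrable_gauss[OF polyfun_power[OF polyfun_diff[OF f polyfun_const]]] AE_I2 zero_le_power2)+
    also have "(\<integral>y. (f y - f x)\<^sup>2 \<partial>?G) = V + (f x - m)\<^sup>2"
    proof -
      have "(\<integral>y. (f y - f x)\<^sup>2 \<partial>?G) = (\<integral>y. (f y - m)\<^sup>2 + 2 * (m - f x) * (f y - m) + (f x - m)\<^sup>2 \<partial>?G)"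
        by (simp only: eq)
      also have "\<dots> = V + 2 * (m - f x) * ((\<integral>y. f y \<partial>?G) - m) + (f x - m)\<^sup>2"
        using intV intf by (simp add: V_def gauss.prob_space)
      finally show ?thesis by (simp add: m_def)
    qed
    finally show "(\<integral>\<^sup>+y. ennreal ((f y - f x)\<^sup>2) \<partial>?G) = ennreal (V + (f x - m)\<^sup>2)" .
  qed
  also have "\<dots> = ennreal (\<integral>x. V + (f x - m)\<^sup>2 \<partial>?G)"
    using intV by (intro nn_integral_eq_integral) (auto simp: V_def)
  also have "(\<integral>x. V + (f x - m)\<^sup>2 \<partial>?G) = 2 * V"
    using intV by (simp add: V_def gauss.prob_space)
  finally have "ennreal (2 * V) \<le> ennreal (pi / 2 * E * (pi / 2))" using le by simp
  then have "2 * V \<le> pi / 2 * E * (pi / 2)" using E0 by (simp add: ennreal_le_iff)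
  also have "\<dots> = (pi / 2 * (pi / 2)) * E" by simp
  \<comment> \<open>The mean square of f y - f x is twice the variance, so the rotation argument
    yields the constant \<pi>^2 / 8, where the sharp one is 1. Rounding \<pi> up to 4 makes it
    2.\<close>
  also have "\<dots> \<le> (2 * 2) * E"
    using pi_less_4 pi_gt_zero by (intro mult_right_mono mult_mono E0) auto
  finally show ?thesis by (simp add: V_def E_def m_def)
qed

section \<open>Taylor expansion of a normalized component\<close>

lemma abs_le_mult: "\<bar>a\<bar> \<le> A \<Longrightarrow> \<bar>b\<bar> \<le> B \<Longrightarrow> \<bar>a * b\<bar> \<le> A * (B::real)"
  unfolding abs_mult by (intro mult_mono) auto

lemma abs_le_add: "\<bar>a\<bar> \<le> A \<Longrightarrow> \<bar>b\<bar> \<le> B \<Longrightarrow> \<bar>a + b\<bar> \<le> A + (B::real)"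
  by linarith

lemma abs_le_diff: "\<bar>a\<bar> \<le> A \<Longrightarrow> \<bar>b\<bar> \<le> B \<Longrightarrow> \<bar>a - b\<bar> \<le> A + (B::real)"
  by linarith

lemma abs_le_divide: "\<bar>a\<bar> \<le> A \<Longrightarrow> 0 < c \<Longrightarrow> \<bar>a / c\<bar> \<le> A / (c::real)"
  by (simp add: divide_right_mono)

lemmas abs_le_intros = abs_le_mult abs_le_add abs_le_diff abs_le_divide

text \<open>The setting is a vector divided by the length of its mean. \<open>\<mu>\<close> and
  \<open>\<mu> + l\<close> are one of its components at the mean and after the perturbation,
  \<open>\<sigma>\<close> is the length of the perturbation and \<open>t\<close> its part along the
  mean. Then \<open>1 + 2 * t + \<sigma> * \<sigma>\<close> is the squared length of the perturbed
  vector, and the last assumption says that a component is at most the length.\<close>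

context
  fixes t l \<mu> \<sigma> :: real
  assumes t: "\<bar>t\<bar> \<le> \<sigma>" and l: "\<bar>l\<bar> \<le> \<sigma>" and \<mu>: "\<bar>\<mu>\<bar> \<le> 1"
    and cs: "(\<mu> + l)\<^sup>2 \<le> 1 + 2 * t + \<sigma> * \<sigma>"
begin

lemma sigma_nonneg: "0 \<le> \<sigma>" using t by linarith

lemma sigma_powers_small:
  assumes "\<sigma> \<le> 1/4"
  shows "\<sigma> * \<sigma> * \<sigma> * \<sigma> \<le> \<sigma> * \<sigma> * \<sigma> / 4" "\<sigma> * \<sigma> * \<sigma> * \<sigma> * \<sigma> \<le> \<sigma> * \<sigma> * \<sigma> / 16"
    "\<sigma> * \<sigma> * \<sigma> * \<sigma> * \<sigma> * \<sigma> \<le> \<sigma> * \<sigma> * \<sigma> / 64" "0 \<le> \<sigma> * \<sigma> * \<sigma>"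
proof -
  have 0: "0 \<le> \<sigma>" by (rule sigma_nonneg)
  show c: "0 \<le> \<sigma> * \<sigma> * \<sigma>" using 0 by simp
  show 4: "\<sigma> * \<sigma> * \<sigma> * \<sigma> \<le> \<sigma> * \<sigma> * \<sigma> / 4" using mult_left_mono[OF assms c] by simp
  have "\<sigma> * \<sigma> * \<sigma> * \<sigma> * \<sigma> \<le> (\<sigma> * \<sigma> * \<sigma> / 4) * (1 / 4)" using 4 assms 0 c by (intro mult_mono) auto
  then show 5: "\<sigma> * \<sigma> * \<sigma> * \<sigma> * \<sigma> \<le> \<sigma> * \<sigma> * \<sigma> / 16" by simp
  have "\<sigma> * \<sigma> * \<sigma> * \<sigma> * \<sigma> * \<sigma> \<le> (\<sigma> * \<sigma> * \<sigma> / 16) * (1 / 4)" using 5 assms 0 c by (intro mult_mono) auto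
  then show "\<sigma> * \<sigma> * \<sigma> * \<sigma> * \<sigma> * \<sigma> \<le> \<sigma> * \<sigma> * \<sigma> / 64" by simp
qed

lemma sigma_powers_large:
  assumes "1/4 < \<sigma>"
  shows "1 \<le> 64 * (\<sigma> * \<sigma> * \<sigma>)" "\<sigma> \<le> 16 * (\<sigma> * \<sigma> * \<sigma>)" "\<sigma> * \<sigma> \<le> 4 * (\<sigma> * \<sigma> * \<sigma>)"
proof -
  have "\<sigma> * \<sigma> * (1/4) \<le> \<sigma> * \<sigma> * \<sigma>" using assms by (intro mult_left_mono) auto
  then show 1: "\<sigma> * \<sigma> \<le> 4 * (\<sigma> * \<sigma> * \<sigma>)" by simp
  have "\<sigma> * (1/4) \<le> \<sigma> * \<sigma>" using assms by (intro mult_left_mono) auto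
  then show 2: "\<sigma> \<le> 16 * (\<sigma> * \<sigma> * \<sigma>)" using 1 by linarith
  then show "1 \<le> 64 * (\<sigma> * \<sigma> * \<sigma>)" using assms by linarith
qed

lemma normalizer_ge:
  assumes "\<sigma> \<le> 1/4" shows "(3/4)\<^sup>2 \<le> 1 + 2 * t + \<sigma> * \<sigma>"
proof -
  have "(3/4)\<^sup>2 \<le> (1 - \<sigma>)\<^sup>2" using assms by (intro power_mono) auto
  also have "\<dots> = 1 - 2 * \<sigma> + \<sigma> * \<sigma>" by (simp add: power2_eq_square algebra_simps)
  also have "\<dots> \<le> 1 + 2 * t + \<sigma> * \<sigma>" using t by linarith
  finally show ?thesis .
qed

text \<open>For small \<open>\<sigma>\<close> the difference is a third order numerator over a
  denominator of at least 9/16. For \<open>\<sigma>\<close> above 1/4 the ratio is at most 1 and the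
  polynomial is bounded term by term; this case determines the constant: 2 + 4 \<sigma> + 10
  \<sigma>^2 is at most (128 + 64 + 40) \<sigma>^3.\<close>

lemma ratio_square_taylor:
  "\<bar>(\<mu> + l)\<^sup>2 / (1 + 2 * t + \<sigma> * \<sigma>) -
     (\<mu> * \<mu> * (1 - 2 * t - \<sigma> * \<sigma> + 4 * (t * t)) + 2 * (\<mu> * (l * (1 - 2 * t))) + l * l)\<bar> \<le> 232 * (\<sigma> * \<sigma> * \<sigma>)"
    (is "\<bar>?F - ?T\<bar> \<le> _")
proof (cases "\<sigma> \<le> 1/4")
  case True
  define A where "A = 1 + 2 * t + \<sigma> * \<sigma>"
  have A: "9/16 \<le> A" using normalizer_ge[OF True] by (simp add: A_def power2_eq_square)
  \<comment> \<open>All terms of order at most two in \<open>t\<close>, \<open>l\<close>,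
    \<open>\<sigma>\<close> cancel between the square and \<open>A * ?T\<close>; what is left has
    order at least three.\<close>
  have eq: "(\<mu> + l)\<^sup>2 - A * ?T = \<mu> * \<mu> * (4 * (t * (\<sigma> * \<sigma>)) + \<sigma> * \<sigma> * (\<sigma> * \<sigma>) - 4 * ((2 * t + \<sigma> * \<sigma>) * (t * t)))
     - 2 * (\<mu> * (l * (\<sigma> * \<sigma> - 4 * (t * t) - 2 * (t * (\<sigma> * \<sigma>))))) - l * l * (2 * t + \<sigma> * \<sigma>)"
    unfolding A_def by (simp add: power2_eq_square algebra_simps)
  have \<sigma>: "\<bar>\<sigma>\<bar> \<le> \<sigma>" using sigma_nonneg by simp
  have "\<bar>(\<mu> + l)\<^sup>2 - A * ?T\<bar> \<le> 1 * 1 * (4 * (\<sigma> * (\<sigma> * \<sigma>)) + \<sigma> * \<sigma> * (\<sigma> * \<sigma>) + 4 * ((2 * \<sigma> + \<sigma> * \<sigma>) * (\<sigma> * \<sigma>)))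
     + 2 * (1 * (\<sigma> * (\<sigma> * \<sigma> + 4 * (\<sigma> * \<sigma>) + 2 * (\<sigma> * (\<sigma> * \<sigma>))))) + \<sigma> * \<sigma> * (2 * \<sigma> + \<sigma> * \<sigma>)"
    unfolding eq by (intro abs_le_intros t l \<mu> \<sigma>) auto
  also have "\<dots> = 24 * (\<sigma> * \<sigma> * \<sigma>) + 10 * (\<sigma> * \<sigma> * \<sigma> * \<sigma>)" by (simp add: algebra_simps)
  also have "\<dots> \<le> 27 * (\<sigma> * \<sigma> * \<sigma>)" using sigma_powers_small[OF True] by linarith
  finally have n: "\<bar>(\<mu> + l)\<^sup>2 - A * ?T\<bar> \<le> 27 * (\<sigma> * \<sigma> * \<sigma>)" .
  have "?F - ?T = ((\<mu> + l)\<^sup>2 - A * ?T) / A" unfolding A_def[symmetric] using A by (simp add: field_simps)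
  then have "\<bar>?F - ?T\<bar> = \<bar>(\<mu> + l)\<^sup>2 - A * ?T\<bar> / A" using A by simp
  also have "\<dots> \<le> (27 * (\<sigma> * \<sigma> * \<sigma>)) / (9/16)"
    using A n sigma_powers_small(4)[OF True] by (intro frac_le) auto
  also have "\<dots> \<le> 232 * (\<sigma> * \<sigma> * \<sigma>)" using sigma_powers_small(4)[OF True] by simp
  finally show ?thesis .
next
  case False
  have \<sigma>: "\<bar>\<sigma>\<bar> \<le> \<sigma>" using sigma_nonneg by simp
  have T: "\<bar>?T\<bar> \<le> 1 * 1 * (1 + 2 * \<sigma> + \<sigma> * \<sigma> + 4 * (\<sigma> * \<sigma>)) + 2 * (1 * (\<sigma> * (1 + 2 * \<sigma>))) + \<sigma> * \<sigma>"
    by (intro abs_le_intros t l \<mu> \<sigma>) auto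
  have A0: "0 \<le> 1 + 2 * t + \<sigma> * \<sigma>" using cs zero_le_power2[of "\<mu> + l"] by linarith
  then have "0 \<le> ?F" by simp
  moreover have "?F \<le> 1"
  proof (cases "1 + 2 * t + \<sigma> * \<sigma> = 0")
    case True then show ?thesis by (simp only: True) simp
  next
    case False
    then have "0 < 1 + 2 * t + \<sigma> * \<sigma>" using A0 by linarith
    then show ?thesis using cs by (simp only: divide_le_eq_1_pos)
  qed
  ultimately have "\<bar>?F\<bar> \<le> 1" by linarith
  from abs_le_diff[OF this T] have "\<bar>?F - ?T\<bar> \<le> 2 + 4 * \<sigma> + 10 * (\<sigma> * \<sigma>)"
    by (rule order_trans) (simp add: algebra_simps)
  then show ?thesis using sigma_powers_large False by linarith
qed

text \<open>\<open>b\<close> is the second order expansion of 1 / sqrt A. That A b^2 - 1 has third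
  order is a polynomial identity, and (1 / sqrt A - b) times sqrt A (1 + sqrt A b) is 1 - A b^2;
  since b is positive, this factor is at least 3/4. The constant is larger than needed here, to
  agree with that for the square.\<close>

lemma ratio_taylor:
  "\<bar>(\<mu> + l) / sqrt (1 + 2 * t + \<sigma> * \<sigma>) -
     (\<mu> * (1 - t - \<sigma> * \<sigma> / 2 + 3 * (t * t) / 2) + l * (1 - t))\<bar> \<le> 232 * (\<sigma> * \<sigma> * \<sigma>)"
    (is "\<bar>?F - ?T\<bar> \<le> _")
proof (cases "\<sigma> \<le> 1/4")
  case True
  define A where "A = 1 + 2 * t + \<sigma> * \<sigma>"
  define b where "b = 1 - t - \<sigma> * \<sigma> / 2 + 3 * (t * t) / 2"
  have A: "(3/4)\<^sup>2 \<le> A" using normalizer_ge[OF True] by (simp add: A_def)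
  then have rA: "3/4 \<le> sqrt A" by (rule real_le_rsqrt)
  have A0: "0 < A" using A by (simp add: power2_eq_square)
  have \<sigma>: "\<bar>\<sigma>\<bar> \<le> \<sigma>" using sigma_nonneg by simp
  have "\<sigma> * \<sigma> \<le> 1/4 * (1/4)" using True sigma_nonneg by (intro mult_mono) auto
  then have b0: "0 < b" unfolding b_def using t True zero_le_square[of t] by linarith
  have eq: "A * (b * b) - 1 = 4 * ((2 * t + \<sigma> * \<sigma>) * (t * t)) - 4 * (t * (\<sigma> * \<sigma>)) - \<sigma> * \<sigma> * (\<sigma> * \<sigma>)
     + (1 + (2 * t + \<sigma> * \<sigma>)) * (t * (\<sigma> * \<sigma>) + \<sigma> * \<sigma> * (\<sigma> * \<sigma>) / 4 - 3 * (t * t * t) - 3 * (t * t * (\<sigma> * \<sigma>)) / 2 + 9 * (t * t * (t * t)) / 4)"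
    unfolding A_def b_def by (simp add: algebra_simps)
  have "\<bar>A * (b * b) - 1\<bar> \<le> 4 * ((2 * \<sigma> + \<sigma> * \<sigma>) * (\<sigma> * \<sigma>)) + 4 * (\<sigma> * (\<sigma> * \<sigma>)) + \<sigma> * \<sigma> * (\<sigma> * \<sigma>)
     + (1 + (2 * \<sigma> + \<sigma> * \<sigma>)) * (\<sigma> * (\<sigma> * \<sigma>) + \<sigma> * \<sigma> * (\<sigma> * \<sigma>) / 4 + 3 * (\<sigma> * \<sigma> * \<sigma>) + 3 * (\<sigma> * \<sigma> * (\<sigma> * \<sigma>)) / 2 + 9 * (\<sigma> * \<sigma> * (\<sigma> * \<sigma>)) / 4)"
    unfolding eq by (intro abs_le_intros t l \<mu> \<sigma>) auto
  also have "\<dots> = 16 * (\<sigma> * \<sigma> * \<sigma>) + 17 * (\<sigma> * \<sigma> * \<sigma> * \<sigma>) + 12 * (\<sigma> * \<sigma> * \<sigma> * \<sigma> * \<sigma>) + 4 * (\<sigma> * \<sigma> * \<sigma> * \<sigma> * \<sigma> * \<sigma>)"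
    by (simp add: algebra_simps)
  also have "\<dots> \<le> 24 * (\<sigma> * \<sigma> * \<sigma>)" using sigma_powers_small[OF True] by linarith
  finally have n: "\<bar>A * (b * b) - 1\<bar> \<le> 24 * (\<sigma> * \<sigma> * \<sigma>)" .
  have rr: "sqrt A * sqrt A = A" using A0 by simp
  have "(1 / sqrt A - b) * (sqrt A * (1 + sqrt A * b)) = 1 - A * (b * b)"
  proof -
    have "(1 / r - b) * (r * (1 + r * b)) = 1 - (r * r) * (b * b)" if "r \<noteq> 0" for r
      using that by (simp add: field_simps)
    from this[of "sqrt A"] show ?thesis using A0 rr by simp
  qed
  then have "\<bar>1 / sqrt A - b\<bar> * \<bar>sqrt A * (1 + sqrt A * b)\<bar> = \<bar>A * (b * b) - 1\<bar>"
    by (simp only: abs_mult[symmetric] abs_minus_commute[of 1])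
  moreover have "3/4 * 1 \<le> sqrt A * (1 + sqrt A * b)" using rA b0 A0 by (intro mult_mono) (simp_all add: less_imp_le)
  ultimately have "\<bar>1 / sqrt A - b\<bar> * (3/4) \<le> 24 * (\<sigma> * \<sigma> * \<sigma>)"
  proof -
    assume eq: "\<bar>1 / sqrt A - b\<bar> * \<bar>sqrt A * (1 + sqrt A * b)\<bar> = \<bar>A * (b * b) - 1\<bar>"
      and ge: "3/4 * 1 \<le> sqrt A * (1 + sqrt A * b)"
    have "\<bar>1 / sqrt A - b\<bar> * (3/4) \<le> \<bar>1 / sqrt A - b\<bar> * \<bar>sqrt A * (1 + sqrt A * b)\<bar>"
      using ge by (intro mult_left_mono) linarith+
    then show ?thesis using eq n by linarith
  qed
  then have d: "\<bar>1 / sqrt A - b\<bar> \<le> 32 * (\<sigma> * \<sigma> * \<sigma>)" by simp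
  have "?F - ?T = (\<mu> + l) * (1 / sqrt A - b) + l * (3 * (t * t) / 2 - \<sigma> * \<sigma> / 2)"
    unfolding A_def[symmetric] by (simp add: b_def algebra_simps add_divide_distrib diff_divide_distrib)
  moreover have "\<bar>(\<mu> + l) * (1 / sqrt A - b) + l * (3 * (t * t) / 2 - \<sigma> * \<sigma> / 2)\<bar>
     \<le> (1 + \<sigma>) * (32 * (\<sigma> * \<sigma> * \<sigma>)) + \<sigma> * (3 * (\<sigma> * \<sigma>) / 2 + \<sigma> * \<sigma> / 2)"
    by (intro abs_le_intros t l \<mu> \<sigma> d) auto
  moreover have "\<dots> = 34 * (\<sigma> * \<sigma> * \<sigma>) + 32 * (\<sigma> * \<sigma> * \<sigma> * \<sigma>)" by (simp add: algebra_simps)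
  ultimately show ?thesis using sigma_powers_small[OF True] by linarith
next
  case False
  have \<sigma>: "\<bar>\<sigma>\<bar> \<le> \<sigma>" using sigma_nonneg by simp
  have "\<bar>?T\<bar> \<le> 1 * (1 + \<sigma> + \<sigma> * \<sigma> / 2 + 3 * (\<sigma> * \<sigma>) / 2) + \<sigma> * (1 + \<sigma>)"
    by (intro abs_le_intros t l \<mu> \<sigma>) auto
  then have T: "\<bar>?T\<bar> \<le> 1 + 2 * \<sigma> + 3 * (\<sigma> * \<sigma>)" by (simp add: algebra_simps)
  have "\<bar>\<mu> + l\<bar> \<le> sqrt (1 + 2 * t + \<sigma> * \<sigma>)" using cs by (metis real_sqrt_abs real_sqrt_le_mono)
  then have "\<bar>?F\<bar> \<le> 1"
    by (cases "sqrt (1 + 2 * t + \<sigma> * \<sigma>) = 0") (auto simp: abs_divide divide_le_eq)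
  then have "\<bar>?F - ?T\<bar> \<le> 2 + 2 * \<sigma> + 3 * (\<sigma> * \<sigma>)" using T by linarith
  then show ?thesis using sigma_powers_large False by linarith
qed

end

text \<open>In the application \<open>\<sigma>\<close> is the square root of a polynomial, so a
  cubic remainder is not a polynomial, but its second and fourth powers are. The weight
  \<open>\<alpha>\<close> balances their means, of orders \<theta> and \<theta>^2.\<close>

lemma sigma_cube_le:
  fixes \<sigma> \<alpha> :: real
  assumes "0 \<le> \<sigma>" "0 < \<alpha>"
  shows "\<sigma> * \<sigma> * \<sigma> \<le> (\<alpha> * (\<sigma> * \<sigma>) + (\<sigma> * \<sigma>)\<^sup>2 / \<alpha>) / 2"
proof -
  have "0 \<le> (\<sigma> * \<sigma>) * (\<alpha> - \<sigma>)\<^sup>2" by simp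
  also have "(\<sigma> * \<sigma>) * (\<alpha> - \<sigma>)\<^sup>2 = \<alpha> * ((\<alpha> * (\<sigma> * \<sigma>) + (\<sigma> * \<sigma>)\<^sup>2 / \<alpha>) - 2 * (\<sigma> * \<sigma> * \<sigma>))"
    using assms by (simp add: power2_eq_square field_simps)
  finally show ?thesis using assms by (simp add: zero_le_mult_iff)
qed

text \<open>The gradient condition is pointwise and relative to the length of the family at the same
  point, and hence survives shifts and gives estimates relative to the length \<open>sqrt S\<close>
  of the mean. The bound on \<open>\<theta>\<close> is for absorbing terms.\<close>

locale concentrated_family =
  fixes n d :: nat and J :: "'j set" and V :: "'j \<Rightarrow> (nat \<Rightarrow> real) \<Rightarrow> real" and \<theta> :: real
  assumes finite_J: "finite J" and V: "\<And>j. j \<in> J \<Longrightarrow> polyfun n d (V j)"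
    and \<theta>: "0 < \<theta>" "\<theta> \<le> 1/32"
    and grad: "\<And>y. (\<Sum>l<n. \<Sum>j\<in>J. (pd l (V j) y)\<^sup>2) \<le> \<theta> * (\<Sum>j\<in>J. (V j y)\<^sup>2)"
begin

definition "m j = (\<integral>x. V j x \<partial>gauss {..<n})"
definition "S = (\<Sum>j\<in>J. (m j)\<^sup>2)"
definition "Q y = (\<Sum>j\<in>J. (V j y - m j)\<^sup>2)"

abbreviation "G \<equiv> gauss {..<n}"

lemma S_nonneg: "0 \<le> S" by (simp add: S_def sum_nonneg)
lemma Q_nonneg: "0 \<le> Q y" by (simp add: Q_def sum_nonneg)

lemma polyfun_Q: "polyfun n (2 * d) Q"
  unfolding Q_def by (intro polyfun_sum polyfun_power polyfun_diff V polyfun_const)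

lemma sum_V_le: "(\<Sum>j\<in>J. (V j y)\<^sup>2) \<le> 2 * Q y + 2 * S"
proof -
  have "(\<Sum>j\<in>J. (V j y)\<^sup>2) \<le> (\<Sum>j\<in>J. 2 * (V j y - m j)\<^sup>2 + 2 * (m j)\<^sup>2)"
  proof (rule sum_mono)
    fix j
    have "0 \<le> (V j y - 2 * m j)\<^sup>2" by simp
    then show "(V j y)\<^sup>2 \<le> 2 * (V j y - m j)\<^sup>2 + 2 * (m j)\<^sup>2"
      by (simp add: power2_eq_square algebra_simps)
  qed
  then show ?thesis by (simp add: Q_def S_def sum.distrib sum_distrib_left)
qed

lemma polyfun_grad: "polyfun n (2 * (d - 1)) (\<lambda>x. \<Sum>l<n. (pd l (V j) x)\<^sup>2)" if "j \<in> J"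
  by (rule polyfun_sum, rule polyfun_power, rule polyfun_pd[OF V[OF that]]) simp

text \<open>By the Poincare inequality the mean of \<open>Q\<close> is at most 2 \<theta> times the
  mean squared length of the family, which is itself \<open>S\<close> plus the mean of
  \<open>Q\<close>. As \<theta> is small, the latter is absorbed on the left.\<close>

lemma integral_Q: "(\<integral>y. Q y \<partial>G) \<le> 4 * \<theta> * S"
proof -
  have iV: "integrable G (V j)" "integrable G (\<lambda>x. (V j x)\<^sup>2)" "integrable G (\<lambda>x. (V j x - m j)\<^sup>2)"
      "integrable G (\<lambda>x. \<Sum>l<n. (pd l (V j) x)\<^sup>2)" if "j \<in> J" for j
    using polyfun_integrable_gauss[OF V[OF that]] polyfun_integrable_gauss[OF polyfun_power[OF V[OF that], of 2]]
      polyfun_integrable_gauss[OF polyfun_power[OF polyfun_diff[OF V[OF that] polyfun_const], of 2 "m j"]]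
      polyfun_integrable_gauss[OF polyfun_grad[OF that]] by blast+
  have iQ: "integrable G Q" by (rule polyfun_integrable_gauss[OF polyfun_Q])
  have VQ: "(\<integral>y. (\<Sum>j\<in>J. (V j y)\<^sup>2) \<partial>G) = S + (\<integral>y. Q y \<partial>G)"
  proof -
    have "(\<integral>x. (V j x)\<^sup>2 \<partial>G) = (m j)\<^sup>2 + (\<integral>x. (V j x - m j)\<^sup>2 \<partial>G)" if j: "j \<in> J" for j
    proof -
      have "(\<integral>x. (V j x - m j)\<^sup>2 \<partial>G) = (\<integral>x. (V j x)\<^sup>2 - 2 * m j * V j x + (m j)\<^sup>2 \<partial>G)"
        by (rule Bochner_Integration.integral_cong) (auto simp: power2_eq_square algebra_simps)
      also have "\<dots> = (\<integral>x. (V j x)\<^sup>2 \<partial>G) - 2 * m j * m j + (m j)\<^sup>2"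
        using iV[OF j] by (simp add: gauss.prob_space m_def)
      finally show ?thesis by (simp add: power2_eq_square)
    qed
    then have "(\<Sum>j\<in>J. \<integral>x. (V j x)\<^sup>2 \<partial>G) = (\<Sum>j\<in>J. (m j)\<^sup>2 + (\<integral>x. (V j x - m j)\<^sup>2 \<partial>G))"
      by (rule sum.cong[OF refl])
    then show ?thesis
      unfolding Q_def S_def using iV by (simp add: sum.distrib)
  qed
  have "(\<integral>y. Q y \<partial>G) = (\<Sum>j\<in>J. \<integral>x. (V j x - m j)\<^sup>2 \<partial>G)"
    unfolding Q_def using iV by (intro Bochner_Integration.integral_sum) auto
  also have "\<dots> \<le> (\<Sum>j\<in>J. 2 * (\<integral>x. (\<Sum>l<n. (pd l (V j) x)\<^sup>2) \<partial>G))"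
    unfolding m_def by (rule sum_mono, rule gauss_poincare, erule V)
  also have "\<dots> = 2 * (\<integral>x. (\<Sum>j\<in>J. \<Sum>l<n. (pd l (V j) x)\<^sup>2) \<partial>G)"
    by (subst Bochner_Integration.integral_sum, erule iV(4), simp only: sum_distrib_left)
  also have "\<dots> \<le> 2 * (\<integral>x. \<theta> * (\<Sum>j\<in>J. (V j x)\<^sup>2) \<partial>G)"
  proof (intro mult_left_mono integral_mono)
    show "integrable G (\<lambda>x. \<Sum>j\<in>J. \<Sum>l<n. (pd l (V j) x)\<^sup>2)"
      by (rule Bochner_Integration.integrable_sum, erule iV(4))
    show "integrable G (\<lambda>x. \<theta> * (\<Sum>j\<in>J. (V j x)\<^sup>2))"
      by (rule integrable_mult_right, rule Bochner_Integration.integrable_sum, erule iV(2))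
    show "(\<Sum>j\<in>J. \<Sum>l<n. (pd l (V j) x)\<^sup>2) \<le> \<theta> * (\<Sum>j\<in>J. (V j x)\<^sup>2)" for x
      using grad[of x] by (subst sum.swap)
  qed simp
  also have "\<dots> = 2 * \<theta> * (S + (\<integral>y. Q y \<partial>G))" using VQ by simp
  finally have 1: "(\<integral>y. Q y \<partial>G) \<le> 2 * \<theta> * S + 2 * \<theta> * (\<integral>y. Q y \<partial>G)" by (simp add: algebra_simps)
  have "2 * \<theta> * (\<integral>y. Q y \<partial>G) \<le> 1/2 * (\<integral>y. Q y \<partial>G)"
    using \<theta> Q_nonneg by (intro mult_right_mono) auto
  then show ?thesis using 1 by linarith
qed

text \<open>The Poincare inequality is applied to \<open>Q\<close> itself. By Cauchy-Schwarz the
  squared gradient of \<open>Q\<close> is at most 4 Q times that of the family, hence at most 8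
  \<theta> (Q^2 + S Q), so the bound again closes on itself. The constant 160 is 32 * 4 + 2 *
  16.\<close>

lemma integral_Q_square: "(\<integral>y. (Q y)\<^sup>2 \<partial>G) \<le> 160 * \<theta>\<^sup>2 * S\<^sup>2"
proof -
  define q where "q = (\<integral>y. Q y \<partial>G)"
  define E where "E = (\<integral>y. (Q y)\<^sup>2 \<partial>G)"
  have q0: "0 \<le> q" unfolding q_def using Q_nonneg by simp
  have E0: "0 \<le> E" unfolding E_def by simp
  have q1: "q \<le> 4 * \<theta> * S" unfolding q_def by (rule integral_Q)
  have iQ: "integrable G Q" by (rule polyfun_integrable_gauss[OF polyfun_Q])
  have iQ2: "integrable G (\<lambda>y. (Q y)\<^sup>2)" by (rule polyfun_integrable_gauss[OF polyfun_power[OF polyfun_Q]])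
  have pdQ: "(\<Sum>l<n. (pd l Q y)\<^sup>2) \<le> 8 * \<theta> * (Q y)\<^sup>2 + 8 * \<theta> * S * Q y" for y
  proof -
    have "(pd l Q y)\<^sup>2 \<le> 4 * Q y * (\<Sum>j\<in>J. (pd l (V j) y)\<^sup>2)" if "l < n" for l
    proof -
      have "pd l Q y = 2 * (\<Sum>j\<in>J. (V j y - m j) * pd l (V j) y)"
        unfolding Q_def using pd_sum_squares[of J n d V l m y, OF V that] by (simp add: sum_distrib_left mult.assoc left_diff_distrib right_diff_distrib)
      then have "(pd l Q y)\<^sup>2 = 4 * (\<Sum>j\<in>J. (V j y - m j) * pd l (V j) y)\<^sup>2" by (simp add: power_mult_distrib)
      also have "\<dots> \<le> 4 * (Q y * (\<Sum>j\<in>J. (pd l (V j) y)\<^sup>2))"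
        unfolding Q_def by (intro mult_left_mono Cauchy_Schwarz_ineq_sum) simp
      finally show ?thesis by simp
    qed
    then have "(\<Sum>l<n. (pd l Q y)\<^sup>2) \<le> (\<Sum>l<n. 4 * Q y * (\<Sum>j\<in>J. (pd l (V j) y)\<^sup>2))"
      by (intro sum_mono) simp
    also have "\<dots> = 4 * Q y * (\<Sum>l<n. \<Sum>j\<in>J. (pd l (V j) y)\<^sup>2)" by (simp add: sum_distrib_left)
    also have "\<dots> \<le> 4 * Q y * (\<theta> * (2 * Q y + 2 * S))"
      using Q_nonneg \<theta> by (intro mult_left_mono order_trans[OF grad] sum_V_le) auto
    finally show ?thesis by (simp add: power2_eq_square algebra_simps)
  qed
  have "(\<integral>y. (Q y - q)\<^sup>2 \<partial>G) \<le> 2 * (\<integral>y. (\<Sum>l<n. (pd l Q y)\<^sup>2) \<partial>G)"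
    unfolding q_def by (rule gauss_poincare[OF polyfun_Q])
  also have "\<dots> \<le> 2 * (\<integral>y. 8 * \<theta> * (Q y)\<^sup>2 + 8 * \<theta> * S * Q y \<partial>G)"
  proof (intro mult_left_mono integral_mono pdQ)
    show "integrable G (\<lambda>y. \<Sum>l<n. (pd l Q y)\<^sup>2)"
      by (rule polyfun_integrable_gauss, rule polyfun_sum, rule polyfun_power, rule polyfun_pd[OF polyfun_Q]) simp
    show "integrable G (\<lambda>y. 8 * \<theta> * (Q y)\<^sup>2 + 8 * \<theta> * S * Q y)" using iQ iQ2 by simp
  qed simp
  also have "\<dots> = 16 * \<theta> * E + 16 * \<theta> * S * q" using iQ iQ2 by (simp add: E_def q_def)
  finally have 1: "(\<integral>y. (Q y - q)\<^sup>2 \<partial>G) \<le> 16 * \<theta> * E + 16 * \<theta> * S * q" .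
  have "(\<integral>y. (Q y - q)\<^sup>2 \<partial>G) = (\<integral>y. (Q y)\<^sup>2 - 2 * q * Q y + q\<^sup>2 \<partial>G)"
    by (rule Bochner_Integration.integral_cong) (auto simp: power2_eq_square algebra_simps)
  also have "\<dots> = E - 2 * q * q + q\<^sup>2" using iQ iQ2 by (simp add: gauss.prob_space E_def q_def)
  also have "\<dots> = E - q\<^sup>2" by (simp add: power2_eq_square)
  finally have 2: "E \<le> 16 * \<theta> * E + 16 * \<theta> * S * q + q\<^sup>2" using 1 by simp
  \<comment> \<open>The requirement that \<theta> is at most 1/32 originates here: half of
    \<open>E\<close> must remain on the left.\<close>
  have "16 * \<theta> * E \<le> 1/2 * E" using \<theta> E0 by (intro mult_right_mono) auto
  then have 3: "E \<le> 32 * \<theta> * S * q + 2 * q\<^sup>2" using 2 by linarith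
  have "32 * \<theta> * S * q \<le> 32 * \<theta> * S * (4 * \<theta> * S)" using q1 \<theta> S_nonneg by (intro mult_left_mono) auto
  moreover have "q\<^sup>2 \<le> (4 * \<theta> * S)\<^sup>2" using q1 q0 by (rule power_mono)
  ultimately have "E \<le> 32 * \<theta> * S * (4 * \<theta> * S) + 2 * (4 * \<theta> * S)\<^sup>2" using 3 by linarith
  then show ?thesis unfolding E_def by (simp add: power2_eq_square algebra_simps)
qed

end

section \<open>Replacement of the summands\<close>

text \<open>A monomial of degree at most k involves at most k distinct coordinates, and these are
  independent, so its expectation factors into one-dimensional Gaussian moments.\<close>

lemma kwise_moments:
  assumes "prob_space M" and z: "kwise_indep_gaussian M k n z" and f: "polyfun n k f"
  shows "integrable M (\<lambda>\<omega>. f (z \<omega>))" "(\<integral>\<omega>. f (z \<omega>) \<partial>M) = (\<integral>x. f x \<partial>gauss {..<n})"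
proof -
  interpret prob_space M by fact
  have "integrable M (\<lambda>\<omega>. f (z \<omega>)) \<and> (\<integral>\<omega>. f (z \<omega>) \<partial>M) = (\<integral>x. f x \<partial>gauss {..<n})"
    using f
  proof (induction rule: polyfun.induct)
    case (monomial m c)
    define J where "J = {i\<in>{..<n}. 0 < m i}"
    have J: "finite J" "J \<subseteq> {..<n}" by (auto simp: J_def)
    have "card J = (\<Sum>i\<in>J. 1)" by simp
    also have "\<dots> \<le> (\<Sum>i\<in>J. m i)" by (rule sum_mono) (auto simp: J_def)
    also have "\<dots> \<le> (\<Sum>i<n. m i)" using J by (intro sum_mono2) auto
    finally have cJ: "card J \<le> k" using monomial by simp
    have ind: "indep_vars (\<lambda>_. borel) (\<lambda>i \<omega>. z \<omega> i) J"
      using z J cJ by (auto simp: kwise_indep_gaussian_def)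
    have ind': "indep_vars (\<lambda>_. borel) (\<lambda>i \<omega>. z \<omega> i ^ m i) J"
      by (rule indep_vars_compose2[OF ind]) auto
    have dist: "distributed M lborel (\<lambda>\<omega>. z \<omega> i) (\<lambda>t. ennreal (std_normal_density t))" if "i \<in> J" for i
      using z J that by (auto simp: kwise_indep_gaussian_def)
    have int1: "integrable M (\<lambda>\<omega>. z \<omega> i ^ m i)" if "i \<in> J" for i
      using distributed_integrable[OF dist[OF that], of "\<lambda>t. t ^ m i"] integrable_std_normal_moment[of "m i"] by simp
    have E1: "(\<integral>\<omega>. z \<omega> i ^ m i \<partial>M) = (\<integral>a. a ^ m i \<partial>gauss1)" if "i \<in> J" for i
      using distributed_integral[OF dist[OF that], of "\<lambda>t. t ^ m i"] by (simp add: integral_density)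
    have prJ: "(\<Prod>i<n. x i ^ m i) = (\<Prod>i\<in>J. x i ^ m i)" for x :: "nat \<Rightarrow> real"
      using J by (intro prod.mono_neutral_right) (auto simp: J_def)
    have "(\<integral>\<omega>. (\<Prod>i\<in>J. z \<omega> i ^ m i) \<partial>M) = (\<Prod>i\<in>J. \<integral>\<omega>. z \<omega> i ^ m i \<partial>M)"
      by (rule indep_vars_lebesgue_integral[OF J(1) ind' int1])
    also have "\<dots> = (\<Prod>i\<in>J. \<integral>a. a ^ m i \<partial>gauss1)" by (rule prod.cong) (auto simp: E1)
    also have "\<dots> = (\<Prod>i<n. \<integral>a. a ^ m i \<partial>gauss1)"
      using J by (intro prod.mono_neutral_left) (auto simp: J_def)
    also have "\<dots> = (\<integral>x. (\<Prod>i<n. x i ^ m i) \<partial>gauss {..<n})"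
      unfolding gauss_def by (rule gauss_prod.product_integral_prod[symmetric]) auto
    finally have "(\<integral>\<omega>. (\<Prod>i\<in>J. z \<omega> i ^ m i) \<partial>M) = (\<integral>x. (\<Prod>i<n. x i ^ m i) \<partial>gauss {..<n})" .
    moreover have "integrable M (\<lambda>\<omega>. \<Prod>i\<in>J. z \<omega> i ^ m i)"
      by (rule indep_vars_integrable[OF J(1) ind' int1])
    ultimately show ?case by (simp add: prJ)
  next
    case (add f g)
    then show ?case using polyfun_integrable_gauss by auto
  qed
  then show "integrable M (\<lambda>\<omega>. f (z \<omega>))" "(\<integral>\<omega>. f (z \<omega>) \<partial>M) = (\<integral>x. f x \<partial>gauss {..<n})" by auto
qed

section \<open>Bounded test functions of finitely many coordinates\<close>

lemma measurable_affine_restrict: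
  "(\<lambda>x. restrict (\<lambda>i. v i + s * x i) {..<n}) \<in> measurable (Rvec n) (Rvec n)"
proof (rule measurable_restrict)
  fix i assume "i \<in> {..<n}"
  then have xi: "(\<lambda>x. x i) \<in> borel_measurable (Rvec n)" by (rule measurable_component_singleton)
  show "(\<lambda>x. v i + s * x i) \<in> borel_measurable (Rvec n)"
    by (rule borel_measurable_add[OF borel_measurable_const borel_measurable_times[OF borel_measurable_const xi]])
qed

text \<open>The vectors that are plugged in, such as v + s x, need not be \<open>undefined\<close>
  beyond \<open>n\<close> and so are not points of \<open>Rvec n\<close>. The second assumption
  allows them to be restricted silently; measurability is needed on \<open>Rvec n\<close>
  only.\<close>

locale coord_function =
  fixes n :: nat and F :: "(nat \<Rightarrow> real) \<Rightarrow> real"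
  assumes F_measurable: "F \<in> borel_measurable (Rvec n)"
    and F_restrict: "\<And>x. F (restrict x {..<n}) = F x"
    and F_bounded: "\<And>x. \<bar>F x\<bar> \<le> 1"
begin

lemma F_affine_measurable: "(\<lambda>x. F (\<lambda>i. v i + s * x i)) \<in> borel_measurable (Rvec n)"
  using measurable_compose[OF measurable_affine_restrict F_measurable, of v s] by (simp only: F_restrict)

lemma F_compose_measurable:
  assumes "\<And>i. i < n \<Longrightarrow> (\<lambda>\<omega>. X \<omega> i) \<in> borel_measurable N"
  shows "(\<lambda>\<omega>. F (X \<omega>)) \<in> borel_measurable N"
proof -
  have "(\<lambda>\<omega>. restrict (X \<omega>) {..<n}) \<in> measurable N (Rvec n)"
    by (rule measurable_restrict) (use assms in blast)
  from measurable_compose[OF this F_measurable] show ?thesis by (simp only: F_restrict)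
qed

end

lemma (in prob_space) integrable_bounded_1:
  fixes f :: "'a \<Rightarrow> real"
  assumes "f \<in> borel_measurable M" "\<And>x. \<bar>f x\<bar> \<le> 1" shows "integrable M f"
proof (rule integrable_const_bound)
  show "AE x in M. norm (f x) \<le> 1" by (rule AE_I2) (simp only: real_norm_def assms(2))
qed fact

lemma (in prob_space) integral_le_const_abs:
  fixes f :: "'a \<Rightarrow> real"
  assumes "\<And>x. \<bar>f x\<bar> \<le> c" shows "(\<integral>x. \<bar>f x\<bar> \<partial>M) \<le> c"
proof (cases "integrable M (\<lambda>x. \<bar>f x\<bar>)")
  case True
  then have "(\<integral>x. \<bar>f x\<bar> \<partial>M) \<le> (\<integral>x. c \<partial>M)" by (rule integral_mono[OF _ integrable_const assms])
  then show ?thesis by (simp add: prob_space)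
next
  case False
  have "0 \<le> c" using assms[of undefined] by linarith
  then show ?thesis by (simp only: not_integrable_integral_eq[OF False])
qed

lemma (in prob_space) integral_diff_le:
  fixes f g :: "'a \<Rightarrow> real"
  assumes "integrable M f" "integrable M g" "\<And>x. \<bar>f x - g x\<bar> \<le> c"
  shows "\<bar>(\<integral>x. f x \<partial>M) - (\<integral>x. g x \<partial>M)\<bar> \<le> c"
proof -
  have "\<bar>(\<integral>x. f x \<partial>M) - (\<integral>x. g x \<partial>M)\<bar> = \<bar>\<integral>x. f x - g x \<partial>M\<bar>" using assms by simp
  also have "\<dots> \<le> c" by (rule order_trans[OF integral_abs_bound integral_le_const_abs[OF assms(3)]])
  finally show ?thesis .
qed

lemma sets_gauss_Rvec: "sets (gauss {..<n}) = sets (Rvec n)" by (rule sets_gauss)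

text \<open>A rotation with cosine a / c and sine b / c carries a x + b y to c times a single
  Gaussian vector; the other component of the rotated pair integrates out.\<close>

lemma coord_function_gauss_convolution:
  assumes "coord_function n F" and "a\<^sup>2 + b\<^sup>2 = c\<^sup>2" "c \<noteq> 0"
  shows "(\<integral>x. \<integral>y. F (\<lambda>i. v i + a * x i + b * y i) \<partial>gauss {..<n} \<partial>gauss {..<n}) = (\<integral>x. F (\<lambda>i. v i + c * x i) \<partial>gauss {..<n})"
proof -
  interpret coord_function n F by fact
  let ?G = "gauss {..<n}"
  let ?GG = "?G \<Otimes>\<^sub>M ?G"
  define H where "H = (\<lambda>x. F (\<lambda>i. v i + c * x i))"
  have H: "H \<in> borel_measurable ?G"
    unfolding H_def using F_affine_measurable[of v c] unfolding measurable_cong_sets[OF sets_gauss_Rvec refl] .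
  have cs: "(a / c)\<^sup>2 + (b / c)\<^sup>2 = 1"
    using assms(2,3) by (simp add: power_divide add_divide_distrib[symmetric])
  define r where "r = rot {..<n} (a / c) (b / c)"
  have r: "r \<in> measurable ?GG ?GG" unfolding r_def by (rule measurable_rot)
  have Hf: "(\<lambda>w. H (fst w)) \<in> borel_measurable ?GG" by (rule measurable_compose[OF measurable_fst H])
  have Hr: "H (fst (r w)) = F (\<lambda>i. v i + a * fst w i + b * snd w i)" for w
  proof -
    have "H (fst (r w)) = F (restrict (\<lambda>i. v i + c * fst (r w) i) {..<n})" by (simp add: H_def F_restrict)
    also have "restrict (\<lambda>i. v i + c * fst (r w) i) {..<n} = restrict (\<lambda>i. v i + a * fst w i + b * snd w i) {..<n}"
      using assms(3) by (auto simp: r_def rot_def case_prod_beta fun_eq_iff field_simps)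
    finally show ?thesis by (simp only: F_restrict)
  qed
  have Hm: "(\<lambda>w. H (fst (r w))) \<in> borel_measurable ?GG" by (rule measurable_compose[OF r Hf])
  have bd: "\<bar>H x\<bar> \<le> 1" for x by (simp add: H_def F_bounded)
  have "(\<integral>w. H (fst w) \<partial>?GG) = (\<integral>w. H (fst w) \<partial>distr ?GG ?GG r)"
    unfolding r_def by (simp only: distr_rot_gauss[OF finite_lessThan cs])
  also have "\<dots> = (\<integral>w. H (fst (r w)) \<partial>?GG)" by (rule integral_distr[OF r Hf])
  finally have 1: "(\<integral>w. H (fst w) \<partial>?GG) = (\<integral>w. H (fst (r w)) \<partial>?GG)" .
  have "(\<integral>x. \<integral>y. H (fst (x, y)) \<partial>?G \<partial>?G) = (\<integral>w. H (fst w) \<partial>?GG)"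
    by (rule gauss_pair.integral_fst', rule gauss_pair.integrable_bounded_1[OF Hf]) (rule bd)
  moreover have "(\<integral>x. \<integral>y. H (fst (r (x, y))) \<partial>?G \<partial>?G) = (\<integral>w. H (fst (r w)) \<partial>?GG)"
    by (rule gauss_pair.integral_fst', rule gauss_pair.integrable_bounded_1[OF Hm]) (rule bd)
  ultimately have "(\<integral>x. \<integral>y. H x \<partial>?G \<partial>?G) = (\<integral>x. \<integral>y. F (\<lambda>i. v i + a * x i + b * y i) \<partial>?G \<partial>?G)"
    using 1 by (simp only: Hr fst_conv snd_conv)
  then show ?thesis by (simp add: gauss.prob_space H_def)
qed

text \<open>The summand \<open>z m\<close> is independent of the sum of its predecessors, so it may
  be frozen at an independent outcome \<omega>' while the predecessors are averaged. Measurability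
  of the inner integral is recorded for the integration over \<omega>' that follows.\<close>

lemma indep_sum_integral:
  fixes m L :: nat
  assumes "prob_space M" and ind: "prob_space.indep_vars M (\<lambda>_. Rvec n) z {..<L}" and m: "m < L"
    and "coord_function n F"
  shows "(\<integral>\<omega>. F (\<lambda>i. v i + s * (\<Sum>j<m. z j \<omega> i) + s * z m \<omega> i) \<partial>M)
     = (\<integral>\<omega>'. \<integral>\<omega>. F (\<lambda>i. v i + s * (\<Sum>j<m. z j \<omega> i) + s * z m \<omega>' i) \<partial>M \<partial>M)" (is ?A)
    and "(\<lambda>\<omega>'. \<integral>\<omega>. F (\<lambda>i. v i + s * (\<Sum>j<m. z j \<omega> i) + s * z m \<omega>' i) \<partial>M) \<in> borel_measurable M" (is ?B)
proof -
  interpret M: prob_space M by fact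
  interpret coord_function n F by fact
  have zm: "z j \<in> measurable M (Rvec n)" if "j < L" for j
    using ind that by (auto simp: M.indep_vars_def)
  have zc: "(\<lambda>\<omega>. z j \<omega> i) \<in> borel_measurable M" if "j < L" "i < n" for i j
    by (rule measurable_compose[OF zm[OF that(1)] measurable_component_singleton]) (use that in simp)
  let ?P = "Pi\<^sub>M {..<m} (\<lambda>_. Rvec n)"
  define X where "X \<omega> = restrict (\<lambda>i. \<Sum>j<m. z j \<omega> i) {..<n}" for \<omega>
  have iv: "M.indep_var (Pi\<^sub>M {m} (\<lambda>_. Rvec n)) (\<lambda>\<omega>. restrict (\<lambda>i. z i \<omega>) {m}) ?P (\<lambda>\<omega>. restrict (\<lambda>i. z i \<omega>) {..<m})"
    by (rule M.indep_var_restrict[OF ind]) (use m in auto)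
  have m1: "(\<lambda>f. f m) \<in> measurable (Pi\<^sub>M {m} (\<lambda>_. Rvec n)) (Rvec n)"
    by (rule measurable_component_singleton) simp
  have m2: "(\<lambda>f. restrict (\<lambda>i. \<Sum>j<m. f j i) {..<n}) \<in> measurable ?P (Rvec n)"
  proof (intro measurable_restrict borel_measurable_sum)
    fix i j assume "i \<in> {..<n}" "j \<in> {..<m}"
    then have "(\<lambda>f. f j) \<in> measurable ?P (Rvec n)" "(\<lambda>x. x i) \<in> borel_measurable (Rvec n)"
      by - (rule measurable_component_singleton, assumption)+
    from measurable_compose[OF this] show "(\<lambda>f. f j i) \<in> borel_measurable ?P" .
  qed
  have "M.indep_var (Rvec n) ((\<lambda>f. f m) \<circ> (\<lambda>\<omega>. restrict (\<lambda>i. z i \<omega>) {m})) (Rvec n)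
     ((\<lambda>f. restrict (\<lambda>i. \<Sum>j<m. f j i) {..<n}) \<circ> (\<lambda>\<omega>. restrict (\<lambda>i. z i \<omega>) {..<m}))"
    by (rule M.indep_var_compose[OF iv m1 m2])
  moreover have "((\<lambda>f. f m) \<circ> (\<lambda>\<omega>. restrict (\<lambda>i. z i \<omega>) {m})) = z m" by (auto simp: fun_eq_iff)
  moreover have "((\<lambda>f. restrict (\<lambda>i. \<Sum>j<m. f j i) {..<n}) \<circ> (\<lambda>\<omega>. restrict (\<lambda>i. z i \<omega>) {..<m})) = X"
    by (auto simp: fun_eq_iff X_def)
  ultimately have iv: "M.indep_var (Rvec n) (z m) (Rvec n) X" by simp
  have dz: "distr M (Rvec n) (z m) \<Otimes>\<^sub>M distr M (Rvec n) X = distr M (Rvec n \<Otimes>\<^sub>M Rvec n) (\<lambda>\<omega>. (z m \<omega>, X \<omega>))"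
    and rv: "z m \<in> measurable M (Rvec n)" "X \<in> measurable M (Rvec n)"
    using iv by (auto simp: M.indep_var_distribution_eq)
  let ?Z = "distr M (Rvec n) (z m)" and ?X = "distr M (Rvec n) X"
  interpret Z: prob_space ?Z by (rule M.prob_space_distr[OF rv(1)])
  interpret X: prob_space ?X by (rule M.prob_space_distr[OF rv(2)])
  interpret ZX: pair_prob_space ?Z ?X ..
  define H where "H = (\<lambda>(y, x). F (\<lambda>i. v i + s * x i + s * y i))"
  have H: "H \<in> borel_measurable (Rvec n \<Otimes>\<^sub>M Rvec n)"
    unfolding H_def case_prod_beta
  proof (rule F_compose_measurable)
    fix i assume i: "i < n"
    have c: "(\<lambda>x. x i) \<in> borel_measurable (Rvec n)" by (rule measurable_component_singleton) (simp add: i)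
    note ms = measurable_compose[OF measurable_fst c] measurable_compose[OF measurable_snd c]
    show "(\<lambda>w. v i + s * snd w i + s * fst w i) \<in> borel_measurable (Rvec n \<Otimes>\<^sub>M Rvec n)"
      by (rule borel_measurable_add[OF borel_measurable_add[OF borel_measurable_const borel_measurable_times[OF borel_measurable_const ms(2)]]
            borel_measurable_times[OF borel_measurable_const ms(1)]])
  qed
  have H': "H \<in> borel_measurable (?Z \<Otimes>\<^sub>M ?X)"
    using H unfolding measurable_cong_sets[OF sets_pair_measure_cong[OF sets_distr sets_distr] refl] .
  have FX: "F (\<lambda>i. v i + s * (\<Sum>j<m. z j \<omega> i) + s * y i) = H (y, X \<omega>)" for \<omega> y
  proof -
    have "H (y, X \<omega>) = F (restrict (\<lambda>i. v i + s * X \<omega> i + s * y i) {..<n})" by (simp add: H_def F_restrict)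
    also have "restrict (\<lambda>i. v i + s * X \<omega> i + s * y i) {..<n} = restrict (\<lambda>i. v i + s * (\<Sum>j<m. z j \<omega> i) + s * y i) {..<n}"
      by (auto simp: X_def fun_eq_iff)
    finally show ?thesis by (simp only: F_restrict)
  qed
  have inner: "(\<lambda>y. \<integral>x. H (y, x) \<partial>?X) \<in> borel_measurable (Rvec n)"
  proof (rule X.borel_measurable_lebesgue_integral)
    show "(\<lambda>(y, x). H (y, x)) \<in> borel_measurable (Rvec n \<Otimes>\<^sub>M ?X)"
      using H unfolding measurable_cong_sets[OF sets_pair_measure_cong[OF refl sets_distr] refl] by (simp only: case_prod_eta)
  qed
  have innereq: "(\<integral>x. H (y, x) \<partial>?X) = (\<integral>\<omega>. H (y, X \<omega>) \<partial>M)" if y: "y \<in> space (Rvec n)" for y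
    by (rule integral_distr[OF rv(2)]) (rule measurable_compose[OF measurable_Pair1'[OF y] H])
  have "(\<integral>\<omega>. H (z m \<omega>, X \<omega>) \<partial>M) = (\<integral>w. H w \<partial>(?Z \<Otimes>\<^sub>M ?X))"
    unfolding dz by (rule integral_distr[OF measurable_Pair[OF rv] H, symmetric])
  also have "\<dots> = (\<integral>y. \<integral>x. H (y, x) \<partial>?X \<partial>?Z)"
    by (rule ZX.integral_fst'[symmetric], rule ZX.integrable_bounded_1[OF H']) (simp only: H_def case_prod_beta F_bounded)
  also have "\<dots> = (\<integral>\<omega>'. \<integral>x. H (z m \<omega>', x) \<partial>?X \<partial>M)"
    by (rule integral_distr[OF rv(1) inner])
  also have "\<dots> = (\<integral>\<omega>'. \<integral>\<omega>. H (z m \<omega>', X \<omega>) \<partial>M \<partial>M)"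
    by (rule Bochner_Integration.integral_cong[OF refl innereq]) (rule measurable_space[OF rv(1)])
  finally show ?A unfolding FX .
  have "(\<lambda>\<omega>'. \<integral>x. H (z m \<omega>', x) \<partial>?X) \<in> borel_measurable M"
    by (rule measurable_compose[OF rv(1) inner])
  moreover have "(\<lambda>\<omega>'. \<integral>x. H (z m \<omega>', x) \<partial>?X) \<in> borel_measurable M \<longleftrightarrow> (\<lambda>\<omega>'. \<integral>\<omega>. H (z m \<omega>', X \<omega>) \<partial>M) \<in> borel_measurable M"
    by (rule measurable_cong) (rule innereq, rule measurable_space[OF rv(1)])
  ultimately show ?B unfolding FX by blast
qed

text \<open>The already replaced Gaussian part is moved into the
  shift \<open>v\<close>, so the one-step bound is needed for every shift.\<close>

lemma telescoping:
  fixes m L :: nat and \<eta> :: real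
  assumes "prob_space M" and ind: "prob_space.indep_vars M (\<lambda>_. Rvec n) z {..<L}"
    and cf: "coord_function n F" and s: "0 < s"
    and step: "\<And>j v. j < L \<Longrightarrow> \<bar>(\<integral>\<omega>. F (\<lambda>i. v i + s * z j \<omega> i) \<partial>M) - (\<integral>y. F (\<lambda>i. v i + s * y i) \<partial>gauss {..<n})\<bar> \<le> \<eta>"
  shows "m \<le> L \<Longrightarrow> \<bar>(\<integral>\<omega>. F (\<lambda>i. v i + s * (\<Sum>j<m. z j \<omega> i)) \<partial>M)
     - (\<integral>y. F (\<lambda>i. v i + (s * sqrt m) * y i) \<partial>gauss {..<n})\<bar> \<le> m * \<eta>"
proof (induction m arbitrary: v)
  case 0
  interpret M: prob_space M by fact
  show ?case by (simp add: gauss.prob_space M.prob_space)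
next
  case (Suc m)
  interpret M: prob_space M by fact
  interpret coord_function n F by fact
  let ?G = "gauss {..<n}"
  have m: "m < L" using Suc.prems by simp
  have zm: "z j \<in> measurable M (Rvec n)" if "j < L" for j
    using ind that by (auto simp: M.indep_vars_def)
  have zc: "(\<lambda>\<omega>. z m \<omega> i) \<in> borel_measurable M" if "i < n" for i
    by (rule measurable_compose[OF zm[OF m] measurable_component_singleton]) (use that in simp)
  define c where "c = s * sqrt m"
  define f where "f = (\<lambda>\<omega>'. \<integral>\<omega>. F (\<lambda>i. v i + s * (\<Sum>j<m. z j \<omega> i) + s * z m \<omega>' i) \<partial>M)"
  define g where "g = (\<lambda>\<omega>'. \<integral>y. F (\<lambda>i. v i + c * y i + s * z m \<omega>' i) \<partial>?G)"
  interpret MG: pair_prob_space M ?G ..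
  interpret GM: pair_prob_space ?G M ..
  have k: "(\<lambda>w. F (\<lambda>i. v i + c * snd w i + s * z m (fst w) i)) \<in> borel_measurable (M \<Otimes>\<^sub>M ?G)"
  proof (rule F_compose_measurable)
    fix i assume i: "i < n"
    have c: "(\<lambda>x. x i) \<in> borel_measurable ?G" by (rule measurable_gauss_coord) (simp add: i)
    show "(\<lambda>w. v i + c * snd w i + s * z m (fst w) i) \<in> borel_measurable (M \<Otimes>\<^sub>M ?G)"
      by (rule borel_measurable_add[OF borel_measurable_add[OF borel_measurable_const
            borel_measurable_times[OF borel_measurable_const measurable_compose[OF measurable_snd c]]]
            borel_measurable_times[OF borel_measurable_const measurable_compose[OF measurable_fst zc[OF i]]]])
  qed
  have kk: "(\<lambda>w. F (\<lambda>i. v i + c * fst w i + s * snd w i)) \<in> borel_measurable (?G \<Otimes>\<^sub>M ?G)"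
  proof (rule F_compose_measurable)
    fix i assume i: "i < n"
    have c: "(\<lambda>x. x i) \<in> borel_measurable ?G" by (rule measurable_gauss_coord) (simp add: i)
    show "(\<lambda>w. v i + c * fst w i + s * snd w i) \<in> borel_measurable (?G \<Otimes>\<^sub>M ?G)"
      by (rule borel_measurable_add[OF borel_measurable_add[OF borel_measurable_const
            borel_measurable_times[OF borel_measurable_const measurable_compose[OF measurable_fst c]]]
            borel_measurable_times[OF borel_measurable_const measurable_compose[OF measurable_snd c]]])
  qed
  have ik: "integrable (M \<Otimes>\<^sub>M ?G) (\<lambda>(\<omega>, y). F (\<lambda>i. v i + c * y i + s * z m \<omega> i))"
    unfolding case_prod_beta' by (rule MG.integrable_bounded_1[OF k]) (rule F_bounded)
  have ikk: "integrable (?G \<Otimes>\<^sub>M ?G) (\<lambda>(x, y). F (\<lambda>i. v i + c * x i + s * y i))"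
    unfolding case_prod_beta' by (rule gauss_pair.integrable_bounded_1[OF kk]) (rule F_bounded)
  have fm: "f \<in> borel_measurable M" unfolding f_def by (rule indep_sum_integral(2)[OF assms(1) ind m cf])
  have f1: "\<bar>f \<omega>\<bar> \<le> 1" for \<omega>
    unfolding f_def by (rule order_trans[OF integral_abs_bound], rule M.integral_le_const_abs) (rule F_bounded)
  have g_int: "integrable M g" unfolding g_def using MG.integrable_fst'[OF ik] by (simp only: case_prod_conv)
  have f_int: "integrable M f" by (rule M.integrable_bounded_1[OF fm f1])
  have fg: "\<bar>f \<omega>' - g \<omega>'\<bar> \<le> m * \<eta>" for \<omega>'
    using Suc.IH[of "\<lambda>i. v i + s * z m \<omega>' i"] m by (simp add: f_def g_def c_def add_ac)
  have A: "\<bar>(\<integral>\<omega>. f \<omega> \<partial>M) - (\<integral>\<omega>. g \<omega> \<partial>M)\<bar> \<le> m * \<eta>"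
    using M.integral_diff_le[OF f_int g_int fg] .
  define p where "p = (\<lambda>x. \<integral>\<omega>. F (\<lambda>i. v i + c * x i + s * z m \<omega> i) \<partial>M)"
  define q where "q = (\<lambda>x. \<integral>y. F (\<lambda>i. v i + c * x i + s * y i) \<partial>?G)"
  have "(\<integral>\<omega>. g \<omega> \<partial>M) = (\<integral>x. p x \<partial>?G)"
    unfolding g_def p_def by (rule MG.Fubini_integral[OF ik, symmetric])
  moreover have "\<bar>(\<integral>x. p x \<partial>?G) - (\<integral>x. q x \<partial>?G)\<bar> \<le> \<eta>"
  proof (rule gauss.integral_diff_le)
    show "integrable ?G p" unfolding p_def using MG.integrable_snd[OF ik] by (simp only: case_prod_conv)
    show "integrable ?G q" unfolding q_def using gauss_pair.integrable_fst'[OF ikk] by (simp only: case_prod_conv)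
    show "\<bar>p x - q x\<bar> \<le> \<eta>" for x unfolding p_def q_def using step[OF m, of "\<lambda>i. v i + c * x i"] .
  qed
  \<comment> \<open>The variance s^2 m of the part replaced so far and s^2 of the new Gaussian
    vector add up to s^2 (m + 1).\<close>
  moreover have "(\<integral>x. q x \<partial>?G) = (\<integral>y. F (\<lambda>i. v i + (s * sqrt (Suc m)) * y i) \<partial>?G)"
    unfolding q_def
    by (rule coord_function_gauss_convolution[OF cf]) (use s in \<open>auto simp: c_def power_mult_distrib algebra_simps\<close>)
  moreover have "(\<integral>\<omega>. F (\<lambda>i. v i + s * (\<Sum>j<Suc m. z j \<omega> i)) \<partial>M) = (\<integral>\<omega>. f \<omega> \<partial>M)"
    unfolding f_def indep_sum_integral(1)[OF assms(1) ind m cf, symmetric] by (simp add: algebra_simps)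
  ultimately show ?case using A by (simp add: algebra_simps abs_le_iff)
qed

section \<open>One replacement step for a normalized component\<close>

lemma (in prob_space) integral_close:
  fixes f t r :: "'a \<Rightarrow> real"
  assumes "integrable M f" "integrable M t" "integrable M r" "\<And>x. \<bar>f x - t x\<bar> \<le> r x"
  shows "\<bar>(\<integral>x. f x \<partial>M) - (\<integral>x. t x \<partial>M)\<bar> \<le> (\<integral>x. r x \<partial>M)"
proof -
  have "\<bar>(\<integral>x. f x \<partial>M) - (\<integral>x. t x \<partial>M)\<bar> = \<bar>\<integral>x. f x - t x \<partial>M\<bar>" using assms by simp
  also have "\<dots> \<le> (\<integral>x. \<bar>f x - t x\<bar> \<partial>M)" by (rule integral_abs_bound)
  also have "\<dots> \<le> (\<integral>x. r x \<partial>M)" using assms by (intro integral_mono) auto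
  finally show ?thesis .
qed

context concentrated_family
begin

text \<open>If all means were zero, the bound 4 \<theta> S for the mean of \<open>Q\<close> would
  make \<open>Q\<close>, and with it the whole family, vanish almost everywhere.\<close>

lemma S_pos:
  assumes pos: "\<And>y. 0 < (\<Sum>j\<in>J. (V j y)\<^sup>2)"
  shows "0 < S"
proof (rule ccontr)
  assume "\<not> 0 < S"
  then have S: "S = 0" using S_nonneg by linarith
  then have m: "m j = 0" if "j \<in> J" for j
    using that finite_J by (simp add: S_def sum_nonneg_eq_0_iff)
  have "(\<integral>y. Q y \<partial>G) = 0"
    using integral_Q Q_nonneg by (simp add: S order_antisym)
  moreover have "integrable G Q" by (rule polyfun_integrable_gauss[OF polyfun_Q])
  ultimately have "AE y in G. Q y = 0"
    using integral_nonneg_eq_0_iff_AE[of G Q] Q_nonneg by simp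
  moreover have "Q y \<noteq> 0" for y using pos[of y] m by (simp add: Q_def)
  ultimately have "AE y in G. False" by simp
  then show False by simp
qed

text \<open>The Taylor polynomial and the majorant of the remainder are both polynomials of degree
  at most 4 d and so have the same expectation under \<open>z\<close> and under the Gaussian
  measure. The error is thus twice the Gaussian mean of the majorant, where 2 * 19024 is rounded up
  to 40000.\<close>

lemma fooled_by_taylor:
  assumes S: "0 < S" and M: "prob_space M" and z: "kwise_indep_gaussian M (4 * d) n z"
    and T: "polyfun n (2 * d) T" and FT: "\<And>y. \<bar>F y - T y\<bar> \<le> 232 * (sqrt (Q y / S) * sqrt (Q y / S) * sqrt (Q y / S))"
    and FM: "integrable M (\<lambda>\<omega>. F (z \<omega>))" and FG: "integrable G F"
  shows "\<bar>(\<integral>\<omega>. F (z \<omega>) \<partial>M) - (\<integral>y. F y \<partial>G)\<bar> \<le> 40000 * (\<theta> * sqrt \<theta>)"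
proof -
  interpret M: prob_space M by fact
  \<comment> \<open>With this weight the quadratic and the quartic part of the majorant both have a
    mean of order \<theta>^(3/2). The factor 116 is half of 232.\<close>
  define \<alpha> where "\<alpha> = sqrt \<theta>"
  have \<alpha>: "0 < \<alpha>" "\<alpha> * \<alpha> = \<theta>" using \<theta> by (auto simp: \<alpha>_def)
  define R where "R y = (116 * \<alpha> / S) * Q y + (116 / (\<alpha> * S\<^sup>2)) * (Q y)\<^sup>2" for y
  have R: "polyfun n (4 * d) R"
    unfolding R_def using polyfun_power[OF polyfun_Q, of 2]
    by (intro polyfun.add polyfun_cmult) (auto intro: polyfun_mono[OF polyfun_Q])
  have FR: "\<bar>F y - T y\<bar> \<le> R y" for y
  proof -
    have Q0: "0 \<le> Q y / S" using S Q_nonneg by simp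
    then have rr: "sqrt (Q y / S) * sqrt (Q y / S) = Q y / S" by (simp only: real_sqrt_mult_self abs_of_nonneg)
    have "sqrt (Q y / S) * sqrt (Q y / S) * sqrt (Q y / S) \<le> (\<alpha> * (Q y / S) + (Q y / S)\<^sup>2 / \<alpha>) / 2"
      using sigma_cube_le[OF real_sqrt_ge_zero[OF Q0] \<alpha>(1)] unfolding rr .
    moreover have "R y = 116 * (\<alpha> * (Q y / S) + (Q y / S)\<^sup>2 / \<alpha>)"
      by (simp add: R_def power_divide algebra_simps)
    moreover have "232 * a \<le> c" if "a \<le> b / 2" "c = 116 * b" for a b c :: real using that by simp
    ultimately have "232 * (sqrt (Q y / S) * sqrt (Q y / S) * sqrt (Q y / S)) \<le> R y" by blast
    then show ?thesis using FT[of y] by linarith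
  qed
  have iQ: "integrable G Q" by (rule polyfun_integrable_gauss[OF polyfun_Q])
  have iQ2: "integrable G (\<lambda>y. (Q y)\<^sup>2)" by (rule polyfun_integrable_gauss[OF polyfun_power[OF polyfun_Q]])
  have "(\<integral>y. R y \<partial>G) = (116 * \<alpha> / S) * (\<integral>y. Q y \<partial>G) + (116 / (\<alpha> * S\<^sup>2)) * (\<integral>y. (Q y)\<^sup>2 \<partial>G)"
    unfolding R_def using iQ iQ2 by simp
  also have "\<dots> \<le> (116 * \<alpha> / S) * (4 * \<theta> * S) + (116 / (\<alpha> * S\<^sup>2)) * (160 * \<theta>\<^sup>2 * S\<^sup>2)"
    using \<alpha> S by (intro add_mono mult_left_mono integral_Q integral_Q_square) auto
  also have "\<dots> = 464 * (\<theta> * \<alpha>) + 18560 * (\<theta> * (\<theta> / \<alpha>))"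
    using \<alpha> S by (simp add: power2_eq_square)
  also have "\<theta> / \<alpha> = \<alpha>" using \<alpha> by (simp add: divide_eq_eq)
  finally have IR: "(\<integral>y. R y \<partial>G) \<le> 19024 * (\<theta> * sqrt \<theta>)" by (simp add: \<alpha>_def)
  have T4: "polyfun n (4 * d) T" by (rule polyfun_mono[OF T]) simp
  note mT = kwise_moments[OF M z T4] and mR = kwise_moments[OF M z R]
  have "\<bar>(\<integral>\<omega>. F (z \<omega>) \<partial>M) - (\<integral>\<omega>. T (z \<omega>) \<partial>M)\<bar> \<le> (\<integral>\<omega>. R (z \<omega>) \<partial>M)"
    by (rule M.integral_close[OF FM mT(1) mR(1) FR])
  moreover have "\<bar>(\<integral>y. F y \<partial>G) - (\<integral>y. T y \<partial>G)\<bar> \<le> (\<integral>y. R y \<partial>G)"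
    by (rule gauss.integral_close[OF FG polyfun_integrable_gauss[OF T] polyfun_integrable_gauss[OF R] FR])
  moreover have "0 \<le> \<theta> * sqrt \<theta>" using \<theta> by simp
  ultimately show ?thesis using IR mT(2) mR(2) by linarith
qed

context
  fixes j0 assumes j0: "j0 \<in> J" and S: "0 < S"
begin

definition "t y = (\<Sum>j\<in>J. m j * (V j y - m j)) / S"
definition "l y = (V j0 y - m j0) / sqrt S"
definition "\<mu> = m j0 / sqrt S"

lemma sum_V_eq: "(\<Sum>j\<in>J. (V j y)\<^sup>2) = S * (1 + 2 * t y + Q y / S)"
proof -
  have "(\<Sum>j\<in>J. (V j y)\<^sup>2) = (\<Sum>j\<in>J. (m j)\<^sup>2 + 2 * (m j * (V j y - m j)) + (V j y - m j)\<^sup>2)"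
    by (rule sum.cong) (auto simp: power2_eq_square algebra_simps)
  also have "\<dots> = S + 2 * (\<Sum>j\<in>J. m j * (V j y - m j)) + Q y"
    by (simp add: sum.distrib S_def Q_def sum_distrib_left)
  finally show ?thesis using S by (simp add: t_def field_simps)
qed

lemma V_j0_eq: "V j0 y = sqrt S * (\<mu> + l y)"
  using S by (simp add: \<mu>_def l_def add_divide_distrib[symmetric])

text \<open>The bound for \<open>t\<close> is Cauchy-Schwarz for the mean against the deviation; the
  others say that one component is at most the length of its vector.\<close>

lemma taylor_bounds:
  defines "\<sigma> y \<equiv> sqrt (Q y / S)"
  shows "\<bar>t y\<bar> \<le> \<sigma> y" "\<bar>l y\<bar> \<le> \<sigma> y" "\<bar>\<mu>\<bar> \<le> 1" "(\<mu> + l y)\<^sup>2 \<le> 1 + 2 * t y + \<sigma> y * \<sigma> y" "\<sigma> y * \<sigma> y = Q y / S"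
proof -
  have Q0: "0 \<le> Q y / S" using S Q_nonneg by simp
  then show \<sigma>: "\<sigma> y * \<sigma> y = Q y / S" by (simp only: \<sigma>_def real_sqrt_mult_self abs_of_nonneg)
  have "(t y)\<^sup>2 \<le> (S * Q y) / S\<^sup>2"
    unfolding t_def power_divide by (intro divide_right_mono) (simp_all add: S_def Q_def Cauchy_Schwarz_ineq_sum)
  also have "\<dots> = Q y / S" using S by (simp add: power2_eq_square)
  finally show "\<bar>t y\<bar> \<le> \<sigma> y" unfolding \<sigma>_def by (rule real_le_rsqrt[of "\<bar>t y\<bar>", simplified])
  have "(V j0 y - m j0)\<^sup>2 \<le> Q y" unfolding Q_def using j0 finite_J by (intro member_le_sum) auto
  then have "(l y)\<^sup>2 \<le> Q y / S" using S by (simp add: l_def power_divide divide_right_mono)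
  then show "\<bar>l y\<bar> \<le> \<sigma> y" unfolding \<sigma>_def by (rule real_le_rsqrt[of "\<bar>l y\<bar>", simplified])
  have "(m j0)\<^sup>2 \<le> S" unfolding S_def using j0 finite_J by (intro member_le_sum) auto
  then have "\<mu>\<^sup>2 \<le> 1" using S by (simp add: \<mu>_def power_divide)
  then show "\<bar>\<mu>\<bar> \<le> 1" by (simp add: abs_square_le_1)
  have "(V j0 y)\<^sup>2 \<le> (\<Sum>j\<in>J. (V j y)\<^sup>2)" using j0 finite_J by (intro member_le_sum) auto
  then have "S * (\<mu> + l y)\<^sup>2 \<le> S * (1 + 2 * t y + Q y / S)"
    unfolding sum_V_eq V_j0_eq using S by (simp add: power_mult_distrib)
  then show "(\<mu> + l y)\<^sup>2 \<le> 1 + 2 * t y + \<sigma> y * \<sigma> y" using S \<sigma> by simp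
qed

lemma polyfun_t: "polyfun n d t"
proof -
  have "polyfun n d (\<lambda>y. \<Sum>j\<in>J. (m j / S) * (V j y - m j))"
    by (rule polyfun_sum, rule polyfun_cmult, rule polyfun_diff[OF V polyfun_const])
  then show ?thesis by (simp add: t_def[abs_def] sum_divide_distrib)
qed

lemma polyfun_l: "polyfun n d l"
proof -
  have "polyfun n d (\<lambda>y. (1 / sqrt S) * (V j0 y - m j0))"
    by (rule polyfun_cmult, rule polyfun_diff[OF V[OF j0] polyfun_const])
  then show ?thesis by (simp add: l_def[abs_def])
qed

lemma fooled_ratio:
  assumes "prob_space M" and z: "kwise_indep_gaussian M (4 * d) n z"
    and "integrable M (\<lambda>\<omega>. V j0 (z \<omega>) / sqrt (\<Sum>j\<in>J. (V j (z \<omega>))\<^sup>2))" "integrable G (\<lambda>y. V j0 y / sqrt (\<Sum>j\<in>J. (V j y)\<^sup>2))"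
  shows "\<bar>(\<integral>\<omega>. V j0 (z \<omega>) / sqrt (\<Sum>j\<in>J. (V j (z \<omega>))\<^sup>2) \<partial>M) - (\<integral>y. V j0 y / sqrt (\<Sum>j\<in>J. (V j y)\<^sup>2) \<partial>G)\<bar> \<le> 40000 * (\<theta> * sqrt \<theta>)"
proof (rule fooled_by_taylor[OF S assms(1) z _ _ assms(3,4)])
  have p: "polyfun n (2 * d) t" "polyfun n (2 * d) l" "polyfun n (2 * d) (\<lambda>y. t y * t y)" "polyfun n (2 * d) (\<lambda>y. l y * t y)"
    using polyfun_mult[OF polyfun_t polyfun_t] polyfun_mult[OF polyfun_l polyfun_t]
    by (auto simp: mult_2 intro: polyfun_mono[OF polyfun_t] polyfun_mono[OF polyfun_l])
  have "polyfun n (2 * d) (\<lambda>y. \<mu> * (1 - t y - (1 / (2 * S)) * Q y + (3/2) * (t y * t y)) + (l y - l y * t y))"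
    by (rule polyfun.add[OF polyfun_cmult[OF polyfun.add[OF polyfun_diff[OF polyfun_diff[OF polyfun_const p(1)]
        polyfun_cmult[OF polyfun_Q]] polyfun_cmult[OF p(3)]]] polyfun_diff[OF p(2,4)]])
  then show "polyfun n (2 * d) (\<lambda>y. \<mu> * (1 - t y - Q y / S / 2 + 3 * (t y * t y) / 2) + l y * (1 - t y))"
    by (simp add: right_diff_distrib mult.commute[of S 2])
  fix y
  show "\<bar>V j0 y / sqrt (\<Sum>j\<in>J. (V j y)\<^sup>2) - (\<mu> * (1 - t y - Q y / S / 2 + 3 * (t y * t y) / 2) + l y * (1 - t y))\<bar>
      \<le> 232 * (sqrt (Q y / S) * sqrt (Q y / S) * sqrt (Q y / S))"
    using ratio_taylor[OF taylor_bounds(1-4)] S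
    unfolding sum_V_eq V_j0_eq taylor_bounds(5) by (simp add: real_sqrt_mult)
qed

lemma fooled_ratio_square:
  assumes "prob_space M" and z: "kwise_indep_gaussian M (4 * d) n z"
    and "integrable M (\<lambda>\<omega>. (V j0 (z \<omega>))\<^sup>2 / (\<Sum>j\<in>J. (V j (z \<omega>))\<^sup>2))" "integrable G (\<lambda>y. (V j0 y)\<^sup>2 / (\<Sum>j\<in>J. (V j y)\<^sup>2))"
  shows "\<bar>(\<integral>\<omega>. (V j0 (z \<omega>))\<^sup>2 / (\<Sum>j\<in>J. (V j (z \<omega>))\<^sup>2) \<partial>M) - (\<integral>y. (V j0 y)\<^sup>2 / (\<Sum>j\<in>J. (V j y)\<^sup>2) \<partial>G)\<bar> \<le> 40000 * (\<theta> * sqrt \<theta>)"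
proof (rule fooled_by_taylor[OF S assms(1) z _ _ assms(3,4)])
  have p: "polyfun n (2 * d) t" "polyfun n (2 * d) l" "polyfun n (2 * d) (\<lambda>y. t y * t y)" "polyfun n (2 * d) (\<lambda>y. l y * t y)"
      "polyfun n (2 * d) (\<lambda>y. l y * l y)"
    using polyfun_mult[OF polyfun_t polyfun_t] polyfun_mult[OF polyfun_l polyfun_t] polyfun_mult[OF polyfun_l polyfun_l]
    by (auto simp: mult_2 intro: polyfun_mono[OF polyfun_t] polyfun_mono[OF polyfun_l])
  have "polyfun n (2 * d) (\<lambda>y. (\<mu> * \<mu>) * (1 - 2 * t y - (1 / S) * Q y + 4 * (t y * t y)) + (2 * \<mu>) * (l y - 2 * (l y * t y)) + l y * l y)"
    by (rule polyfun.add[OF polyfun.add[OF polyfun_cmult[OF polyfun.add[OF polyfun_diff[OF polyfun_diff[OF polyfun_const polyfun_cmult[OF p(1)]]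
        polyfun_cmult[OF polyfun_Q]] polyfun_cmult[OF p(3)]]] polyfun_cmult[OF polyfun_diff[OF p(2) polyfun_cmult[OF p(4)]]]] p(5)])
  then show "polyfun n (2 * d) (\<lambda>y. \<mu> * \<mu> * (1 - 2 * t y - Q y / S + 4 * (t y * t y)) + 2 * (\<mu> * (l y * (1 - 2 * t y))) + l y * l y)"
    by (simp add: right_diff_distrib mult.assoc mult.left_commute[of 2])
  fix y
  show "\<bar>(V j0 y)\<^sup>2 / (\<Sum>j\<in>J. (V j y)\<^sup>2) - (\<mu> * \<mu> * (1 - 2 * t y - Q y / S + 4 * (t y * t y)) + 2 * (\<mu> * (l y * (1 - 2 * t y))) + l y * l y)\<bar>
      \<le> 232 * (sqrt (Q y / S) * sqrt (Q y / S) * sqrt (Q y / S))"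
    using ratio_square_taylor[OF taylor_bounds(1-4)] S
    unfolding sum_V_eq V_j0_eq taylor_bounds(5) by (simp add: power_mult_distrib)
qed

end

end

section \<open>The certainty of a polynomial\<close>

text \<open>Words instead of multi-indices: the squares of all derivatives over words of a fixed
  length add up to the squared Euclidean norm of the derivative tensor without multinomial factors,
  and prepending a letter is injective.\<close>

definition words :: "nat \<Rightarrow> nat \<Rightarrow> nat list set" where
  "words n d = {w. set w \<subseteq> {..<n} \<and> length w \<le> d}"

lemma finite_words: "finite (words n d)"
  unfolding words_def by (rule finite_lists_length_le) simp

primrec pdw :: "nat list \<Rightarrow> ((nat \<Rightarrow> real) \<Rightarrow> real) \<Rightarrow> (nat \<Rightarrow> real) \<Rightarrow> real" where
  "pdw [] f = f"
| "pdw (l # w) f = pd l (pdw w f)"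

lemma polyfun_pdw:
  assumes "polyfun n d f" "set w \<subseteq> {..<n}" shows "polyfun n (d - length w) (pdw w f)"
  using assms(2)
proof (induction w)
  case (Cons l w)
  then show ?case using polyfun_pd[of n "d - length w" "pdw w f" l] by simp
qed (simp add: assms(1))

lemma pdw_append: "pdw (v @ w) f = pdw v (pdw w f)"
  by (induction v) auto

text \<open>By induction on the degree all partial derivatives vanish identically, so
  \<open>f\<close> is constant along the segment from x to y. This is what keeps the denominator of
  the certainty away from zero at every point.\<close>

lemma polyfun_eq_0:
  assumes "polyfun n d f" "\<And>w. w \<in> words n d \<Longrightarrow> pdw w f x = 0"
  shows "f y = 0"
  using assms
proof (induction d arbitrary: f y)
  case (0 f)
  have D0: "pd l f = (\<lambda>x. 0)" if "l < n" for l using pd_degree_0[OF 0(1) that] by simp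
  then have "((\<lambda>t. f (\<lambda>i. x i + t * (y i - x i))) has_real_derivative 0) (at t)" for t
  proof -
    have "((\<lambda>t. x i + t * (y i - x i)) has_real_derivative y i - x i) (at t)" for i
      by (auto intro!: derivative_eq_intros)
    from polyfun_chain[OF 0(1) this] show ?thesis using D0 by simp
  qed
  from DERIV_isconst_all[of "\<lambda>t. f (\<lambda>i. x i + t * (y i - x i))" 1 0] this
  have "f y = f x" by simp
  then show ?case using 0(2)[of "[]"] by (simp add: words_def)
next
  case (Suc d f)
  have D0: "pd l f z = 0" if l: "l < n" for l z
  proof (rule Suc.IH[of "pd l f" z])
    show "polyfun n d (pd l f)" using polyfun_pd[OF Suc.prems(1) l] by simp
    fix w assume "w \<in> words n d"
    \<comment> \<open>\<open>pd l\<close> is applied before the derivatives of \<open>w\<close>, so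
      the new letter comes last.\<close>
    then have "w @ [l] \<in> words n (Suc d)" using l by (auto simp: words_def)
    from Suc.prems(2)[OF this] show "pdw w (pd l f) x = 0" by (simp add: pdw_append)
  qed
  then have "((\<lambda>t. f (\<lambda>i. x i + t * (y i - x i))) has_real_derivative 0) (at t)" for t
  proof -
    have "((\<lambda>t. x i + t * (y i - x i)) has_real_derivative y i - x i) (at t)" for i
      by (auto intro!: derivative_eq_intros)
    from polyfun_chain[OF Suc.prems(1) this] show ?thesis using D0 by simp
  qed
  from DERIV_isconst_all[of "\<lambda>t. f (\<lambda>i. x i + t * (y i - x i))" 1 0] this
  have "f y = f x" by simp
  then show ?case using Suc.prems(2)[of "[]"] by (simp add: words_def)
qed

text \<open>The weights are those of the reproducing kernel \<open>exp (\<tau> \<langle>u, v\<rangle>)\<close>: with them the gradient acts on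
  the jet as a number operator, whose eigenvalues on polynomials of degree \<open>d\<close> are at most \<open>d / \<tau>\<close>.\<close>

definition jet :: "real \<Rightarrow> nat list \<Rightarrow> ((nat \<Rightarrow> real) \<Rightarrow> real) \<Rightarrow> (nat \<Rightarrow> real) \<Rightarrow> real" where
  "jet \<tau> w f x = sqrt (\<tau> ^ length w / fact (length w)) * pdw w f x"

definition jet_norm2 :: "nat \<Rightarrow> nat \<Rightarrow> real \<Rightarrow> ((nat \<Rightarrow> real) \<Rightarrow> real) \<Rightarrow> (nat \<Rightarrow> real) \<Rightarrow> real" where
  "jet_norm2 n d \<tau> f x = (\<Sum>w\<in>words n d. (jet \<tau> w f x)\<^sup>2)"

definition certainty :: "nat \<Rightarrow> nat \<Rightarrow> real \<Rightarrow> ((nat \<Rightarrow> real) \<Rightarrow> real) \<Rightarrow> (nat \<Rightarrow> real) \<Rightarrow> real" where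
  "certainty n d \<tau> f x = f x / sqrt (jet_norm2 n d \<tau> f x)"

context
  fixes n d :: nat and f :: "(nat \<Rightarrow> real) \<Rightarrow> real" and \<tau> :: real
  assumes f: "polyfun n d f" and \<tau>: "0 < \<tau>"
begin

lemma polyfun_jet:
  assumes "w \<in> words n d" shows "polyfun n d (jet \<tau> w f)"
proof -
  have "polyfun n (d - length w) (pdw w f)" using polyfun_pdw[OF f] assms by (simp add: words_def)
  from polyfun_cmult[OF polyfun_mono[OF this, of d]] show ?thesis by (simp add: jet_def[abs_def])
qed

lemma jet_square: "(jet \<tau> w f x)\<^sup>2 = \<tau> ^ length w / fact (length w) * (pdw w f x)\<^sup>2"
  using \<tau> by (simp add: jet_def power_mult_distrib)

lemma polyfun_jet_norm2: "polyfun n (2 * d) (jet_norm2 n d \<tau> f)"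
  unfolding jet_norm2_def[abs_def] by (intro polyfun_sum polyfun_power polyfun_jet)

lemma square_le_jet_norm2: "(f x)\<^sup>2 \<le> jet_norm2 n d \<tau> f x"
proof -
  have "(jet \<tau> [] f x)\<^sup>2 \<le> jet_norm2 n d \<tau> f x"
    unfolding jet_norm2_def using finite_words by (intro member_le_sum) (auto simp: words_def)
  then show ?thesis by (simp add: jet_def)
qed

lemma jet_norm2_pos:
  assumes "f y \<noteq> 0" shows "0 < jet_norm2 n d \<tau> f x"
proof (rule ccontr)
  assume "\<not> ?thesis"
  moreover have "0 \<le> jet_norm2 n d \<tau> f x" by (simp add: jet_norm2_def sum_nonneg)
  ultimately have "jet_norm2 n d \<tau> f x = 0" by linarith
  then have "jet \<tau> w f x = 0" if "w \<in> words n d" for w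
    using that finite_words by (simp add: jet_norm2_def sum_nonneg_eq_0_iff)
  then have "pdw w f x = 0" if "w \<in> words n d" for w
    using that \<tau> by (simp add: jet_def)
  then show False using polyfun_eq_0[OF f] assms by blast
qed

text \<open>Differentiating the component of \<open>w\<close> in direction \<open>l\<close> gives
  the component of \<open>l # w\<close> times sqrt ((length w + 1) / \<tau>). Words of length d are
  annihilated, so the squared factor is at most d / \<tau>, and different pairs (l, w) give
  different words.\<close>

lemma jet_gradient: "(\<Sum>l<n. \<Sum>w\<in>words n d. (pd l (jet \<tau> w f) x)\<^sup>2) \<le> d / \<tau> * jet_norm2 n d \<tau> f x"
proof -
  let ?W = "{w \<in> words n d. length w < d}"
  have "(\<Sum>l<n. \<Sum>w\<in>words n d. (pd l (jet \<tau> w f) x)\<^sup>2) = (\<Sum>(l, w)\<in>{..<n} \<times> words n d. (pd l (jet \<tau> w f) x)\<^sup>2)"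
    by (rule sum.cartesian_product)
  also have "\<dots> = (\<Sum>(l, w)\<in>{..<n} \<times> ?W. (pd l (jet \<tau> w f) x)\<^sup>2)"
  proof (rule sum.mono_neutral_right)
    show "\<forall>i\<in>{..<n} \<times> words n d - {..<n} \<times> ?W. (case i of (l, w) \<Rightarrow> (pd l (jet \<tau> w f) x)\<^sup>2) = 0"
    proof
      fix i assume i: "i \<in> {..<n} \<times> words n d - {..<n} \<times> ?W"
      obtain l w where lw: "i = (l, w)" by (cases i)
      have l: "l < n" and w: "w \<in> words n d" and "\<not> length w < d" using i lw by auto
      then have "length w = d" by (auto simp: words_def)
      then have "polyfun n 0 (pdw w f)" using polyfun_pdw[OF f, of w] w by (simp add: words_def)
      then have "polyfun n 0 (jet \<tau> w f)" unfolding jet_def[abs_def] by (rule polyfun_cmult)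
      from pd_degree_0[OF this l] show "(case i of (l, w) \<Rightarrow> (pd l (jet \<tau> w f) x)\<^sup>2) = 0" by (simp add: lw)
    qed
  qed (auto simp: finite_words)
  also have "\<dots> \<le> (\<Sum>(l, w)\<in>{..<n} \<times> ?W. d / \<tau> * (jet \<tau> (l # w) f x)\<^sup>2)"
  proof (rule sum_mono)
    fix i assume i: "i \<in> {..<n} \<times> ?W"
    obtain l w where lw: "i = (l, w)" by (cases i)
    have l: "l < n" and w: "w \<in> words n d" "length w < d" using i lw by auto
    have "polyfun n (d - length w) (pdw w f)" using polyfun_pdw[OF f] w by (simp add: words_def)
    from pd_cmult[OF this l] have "pd l (jet \<tau> w f) x = sqrt (\<tau> ^ length w / fact (length w)) * pdw (l # w) f x"
      by (simp add: jet_def[abs_def])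
    then have eq: "(pd l (jet \<tau> w f) x)\<^sup>2 = \<tau> ^ length w / fact (length w) * (pdw (l # w) f x)\<^sup>2"
      using \<tau> by (simp add: power_mult_distrib)
    have "a / F = k / \<tau> * (\<tau> * a / (k * F))" if "k \<noteq> 0" "F \<noteq> 0" for a F k
      using that \<tau> by simp
    from this[of "real (Suc (length w))" "fact (length w)" "\<tau> ^ length w"]
    have "\<tau> ^ length w / fact (length w) = (Suc (length w)) / \<tau> * (\<tau> ^ length (l # w) / fact (length (l # w)))"
      by simp
    also have "\<dots> \<le> d / \<tau> * (\<tau> ^ length (l # w) / fact (length (l # w)))"
      using w(2) \<tau> by (intro mult_right_mono divide_right_mono) auto
    finally have "\<tau> ^ length w / fact (length w) \<le> d / \<tau> * (\<tau> ^ length (l # w) / fact (length (l # w)))" .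
    then have "\<tau> ^ length w / fact (length w) * (pdw (l # w) f x)\<^sup>2
        \<le> d / \<tau> * (\<tau> ^ length (l # w) / fact (length (l # w))) * (pdw (l # w) f x)\<^sup>2"
      by (rule mult_right_mono) simp
    with eq have "(pd l (jet \<tau> w f) x)\<^sup>2
        \<le> d / \<tau> * (\<tau> ^ length (l # w) / fact (length (l # w))) * (pdw (l # w) f x)\<^sup>2" by simp
    also have "\<dots> = d / \<tau> * (jet \<tau> (l # w) f x)\<^sup>2" unfolding jet_square by (simp add: mult.assoc)
    finally show "(case i of (l, w) \<Rightarrow> (pd l (jet \<tau> w f) x)\<^sup>2) \<le> (case i of (l, w) \<Rightarrow> d / \<tau> * (jet \<tau> (l # w) f x)\<^sup>2)"
      by (simp add: lw)
  qed
  also have "\<dots> = (\<Sum>v\<in>(\<lambda>(l, w). l # w) ` ({..<n} \<times> ?W). d / \<tau> * (jet \<tau> v f x)\<^sup>2)"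
    by (subst sum.reindex) (auto simp: inj_on_def case_prod_beta')
  also have "\<dots> \<le> (\<Sum>v\<in>words n d. d / \<tau> * (jet \<tau> v f x)\<^sup>2)"
    using \<tau> by (intro sum_mono2 finite_words) (auto simp: words_def)
  also have "\<dots> = d / \<tau> * jet_norm2 n d \<tau> f x" by (simp add: jet_norm2_def sum_distrib_left)
  finally show ?thesis .
qed

text \<open>Where the denominator vanishes, division by zero makes the certainty 0.\<close>

lemma certainty_square_le_1: "(certainty n d \<tau> f x)\<^sup>2 \<le> 1"
proof (cases "jet_norm2 n d \<tau> f x = 0")
  case False
  then have "0 < jet_norm2 n d \<tau> f x"
    using square_le_jet_norm2[of x] zero_le_power2[of "f x"] by linarith
  then show ?thesis using square_le_jet_norm2[of x] by (simp add: certainty_def power_divide)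
qed (simp add: certainty_def)

lemma coord_function_certainty:
  "coord_function n (certainty n d \<tau> f)" "coord_function n (\<lambda>x. (certainty n d \<tau> f x)\<^sup>2)"
proof -
  have c: "(\<lambda>x. x i) \<in> borel_measurable (Rvec n)" if "i < n" for i
    by (rule measurable_component_singleton) (simp add: that)
  have mf: "f \<in> borel_measurable (Rvec n)" by (rule polyfun_measurable[OF f c])
  have mA: "jet_norm2 n d \<tau> f \<in> borel_measurable (Rvec n)" by (rule polyfun_measurable[OF polyfun_jet_norm2 c])
  have m: "certainty n d \<tau> f \<in> borel_measurable (Rvec n)"
    unfolding certainty_def[abs_def] by (rule borel_measurable_divide[OF mf measurable_compose[OF mA borel_measurable_sqrt]])
  have r: "certainty n d \<tau> f (restrict x {..<n}) = certainty n d \<tau> f x" for x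
  proof -
    have "f (restrict x {..<n}) = f x" by (rule polyfun_cong_coords[OF f]) simp
    moreover have "jet_norm2 n d \<tau> f (restrict x {..<n}) = jet_norm2 n d \<tau> f x"
      by (rule polyfun_cong_coords[OF polyfun_jet_norm2]) simp
    ultimately show ?thesis by (simp add: certainty_def)
  qed
  have b: "\<bar>certainty n d \<tau> f x\<bar> \<le> 1" for x using certainty_square_le_1[of x] by (simp add: abs_square_le_1)
  show "coord_function n (certainty n d \<tau> f)" by unfold_locales (rule m, rule r, rule b)
  show "coord_function n (\<lambda>x. (certainty n d \<tau> f x)\<^sup>2)"
    by unfold_locales (rule borel_measurable_power[OF m], simp only: r, simp add: certainty_square_le_1)
qed

text \<open>Composition with y \<mapsto> v + s y multiplies gradients by s, which turns the constant
  d / \<tau> of the jet into \<theta>. The bound for the jet holds at every point, so the result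
  does not depend on the shift v.\<close>

lemma certainty_one_step:
  fixes s \<theta> :: real
  assumes nz: "f y \<noteq> 0" and d: "1 \<le> d" and s: "0 < s" and \<theta>: "\<theta> = s\<^sup>2 * d / \<tau>" "\<theta> \<le> 1/32"
    and M: "prob_space M" and z: "kwise_indep_gaussian M (4 * d) n z"
  shows "\<bar>(\<integral>\<omega>. certainty n d \<tau> f (\<lambda>i. v i + s * z \<omega> i) \<partial>M) - (\<integral>y. certainty n d \<tau> f (\<lambda>i. v i + s * y i) \<partial>gauss {..<n})\<bar>
      \<le> 40000 * (\<theta> * sqrt \<theta>)" (is ?A)
    and "\<bar>(\<integral>\<omega>. (certainty n d \<tau> f (\<lambda>i. v i + s * z \<omega> i))\<^sup>2 \<partial>M) - (\<integral>y. (certainty n d \<tau> f (\<lambda>i. v i + s * y i))\<^sup>2 \<partial>gauss {..<n})\<bar>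
      \<le> 40000 * (\<theta> * sqrt \<theta>)" (is ?B)
proof -
  define V where "V w y = jet \<tau> w f (\<lambda>i. v i + s * y i)" for w and y :: "nat \<Rightarrow> real"
  interpret M: prob_space M by fact
  interpret R1: coord_function n "certainty n d \<tau> f" by (rule coord_function_certainty)
  interpret R2: coord_function n "\<lambda>x. (certainty n d \<tau> f x)\<^sup>2" by (rule coord_function_certainty)
  have pV: "polyfun n d (V w)" if "w \<in> words n d" for w
      unfolding V_def[abs_def] by (rule polyfun_affine[OF polyfun_jet[OF that]])
  have \<theta>0: "0 < \<theta>" using s d \<tau> by (simp add: \<theta>(1))
  have grad: "(\<Sum>l<n. \<Sum>w\<in>words n d. (pd l (V w) y)\<^sup>2) \<le> \<theta> * (\<Sum>w\<in>words n d. (V w y)\<^sup>2)" for y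
  proof -
    have "(\<Sum>l<n. \<Sum>w\<in>words n d. (pd l (V w) y)\<^sup>2) = (\<Sum>l<n. \<Sum>w\<in>words n d. s\<^sup>2 * (pd l (jet \<tau> w f) (\<lambda>i. v i + s * y i))\<^sup>2)"
      unfolding V_def[abs_def]
      by (intro sum.cong refl) (simp add: pd_affine[OF polyfun_jet] power_mult_distrib)
    also have "\<dots> = s\<^sup>2 * (\<Sum>l<n. \<Sum>w\<in>words n d. (pd l (jet \<tau> w f) (\<lambda>i. v i + s * y i))\<^sup>2)"
      by (simp add: sum_distrib_left)
    also have "\<dots> \<le> s\<^sup>2 * (d / \<tau> * jet_norm2 n d \<tau> f (\<lambda>i. v i + s * y i))"
      by (intro mult_left_mono jet_gradient) simp
    finally show ?thesis by (simp add: \<theta>(1) jet_norm2_def V_def)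
  qed
  interpret concentrated_family n d "words n d" V \<theta>
    by unfold_locales (fact finite_words, erule pV, fact \<theta>0, fact \<theta>(2), fact grad)
  have S: "0 < S"
    by (rule S_pos) (use jet_norm2_pos[OF nz] in \<open>simp add: jet_norm2_def V_def\<close>)
  have nil: "[] \<in> words n d" by (simp add: words_def)
  have c: "V [] y / sqrt (\<Sum>w\<in>words n d. (V w y)\<^sup>2) = certainty n d \<tau> f (\<lambda>i. v i + s * y i)" for y
    by (simp add: V_def certainty_def jet_norm2_def) (simp add: jet_def)
  have c2: "(V [] y)\<^sup>2 / (\<Sum>w\<in>words n d. (V w y)\<^sup>2) = (certainty n d \<tau> f (\<lambda>i. v i + s * y i))\<^sup>2" for y
    unfolding c[symmetric] power_divide by (simp add: sum_nonneg)
  have zm: "z \<in> measurable M (Rvec n)" using z by (simp add: kwise_indep_gaussian_def)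
  have iM: "integrable M (\<lambda>\<omega>. certainty n d \<tau> f (\<lambda>i. v i + s * z \<omega> i))"
      "integrable M (\<lambda>\<omega>. (certainty n d \<tau> f (\<lambda>i. v i + s * z \<omega> i))\<^sup>2)"
    by (rule M.integrable_bounded_1[OF measurable_compose[OF zm R1.F_affine_measurable] R1.F_bounded],
        rule M.integrable_bounded_1[OF measurable_compose[OF zm R2.F_affine_measurable] R2.F_bounded])
  have gm: "h \<in> borel_measurable G" if "h \<in> borel_measurable (Rvec n)" for h
    using that unfolding measurable_cong_sets[OF sets_gauss_Rvec refl] .
  have iG: "integrable G (\<lambda>y. certainty n d \<tau> f (\<lambda>i. v i + s * y i))"
      "integrable G (\<lambda>y. (certainty n d \<tau> f (\<lambda>i. v i + s * y i))\<^sup>2)"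
    by (rule gauss.integrable_bounded_1[OF gm[OF R1.F_affine_measurable] R1.F_bounded],
        rule gauss.integrable_bounded_1[OF gm[OF R2.F_affine_measurable] R2.F_bounded])
  show ?A using fooled_ratio[OF nil S M z, unfolded c, OF iM(1) iG(1)] .
  show ?B using fooled_ratio_square[OF nil S M z, unfolded c2, OF iM(2) iG(2)] .
qed

end

section \<open>Logarithmic derivatives on random circles\<close>

text \<open>The logarithmic derivative is the sum of 1 / (z - r) over the roots r with multiplicity,
  and each term has modulus at most 1 / \<delta>. The induction splits off one root at a
  time.\<close>

lemma norm_poly_pderiv_le:
  fixes p :: "complex poly"
  assumes "p \<noteq> 0" "0 < \<delta>" "\<And>r. poly p r = 0 \<Longrightarrow> \<delta> \<le> cmod (z - r)"
  shows "cmod (poly (pderiv p) z) \<le> degree p / \<delta> * cmod (poly p z)"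
  using assms
proof (induction "degree p" arbitrary: p)
  case 0
  then obtain c where "p = [:c:]" by (metis degree_eq_zeroE)
  then show ?case by simp
next
  case (Suc k)
  then have "\<not> constant (poly p)" by (simp add: constant_degree)
  then obtain r where r: "poly p r = 0" using fundamental_theorem_of_algebra by blast
  then obtain q where q: "p = [:-r, 1:] * q" by (auto simp: poly_eq_0_iff_dvd dvd_def)
  have q0: "q \<noteq> 0" using q Suc.prems(1) by auto
  have dq: "degree p = Suc (degree q)" unfolding q using q0 by (subst degree_mult_eq) auto
  have IH: "cmod (poly (pderiv q) z) \<le> degree q / \<delta> * cmod (poly q z)"
    using Suc.hyps(2) dq Suc.prems by (intro Suc.hyps(1)) (auto simp: q q0)
  have d: "\<delta> \<le> cmod (z - r)" using Suc.prems(3)[OF r] .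
  have "poly (pderiv p) z = poly q z + (z - r) * poly (pderiv q) z"
    unfolding q pderiv_mult by (simp add: pderiv_pCons algebra_simps)
  then have "cmod (poly (pderiv p) z) \<le> cmod (poly q z) + cmod (z - r) * cmod (poly (pderiv q) z)"
    by (metis norm_mult norm_triangle_ineq)
  also have "\<dots> \<le> cmod (z - r) / \<delta> * cmod (poly q z) + cmod (z - r) * (degree q / \<delta> * cmod (poly q z))"
  proof (intro add_mono mult_left_mono IH)
    have "1 \<le> cmod (z - r) / \<delta>" using d Suc.prems(2) by simp
    then show "cmod (poly q z) \<le> cmod (z - r) / \<delta> * cmod (poly q z)"
      using mult_right_mono[of 1 "cmod (z - r) / \<delta>" "cmod (poly q z)"] by simp
  qed simp
  also have "\<dots> = degree p / \<delta> * (cmod (z - r) * cmod (poly q z))"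
    using Suc.prems(2) by (simp add: dq field_simps)
  also have "cmod (z - r) * cmod (poly q z) = cmod (poly p z)"
    unfolding q by (simp add: norm_mult[symmetric] algebra_simps)
  finally show ?case .
qed

text \<open>Restricted to a circle, a polynomial function of degree \<open>d\<close> becomes a trigonometric polynomial,
  that is \<open>cis (- d t)\<close> times a polynomial of degree \<open>2 d\<close> in \<open>cis t\<close>.\<close>

lemma polyfun_circle:
  assumes "polyfun n d f"
  shows "\<exists>p :: complex poly. degree p \<le> 2 * d \<and>
    (\<forall>t. of_real (f (\<lambda>i. cos t * x i + sin t * y i)) * cis t ^ d = poly p (cis t))"
  using assms
proof (induction rule: polyfun_induct)
  case (const d c)
  have "degree (monom (of_real c :: complex) d) \<le> 2 * d" by (rule order_trans[OF degree_monom_le]) simp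
  then show ?case by (intro exI[of _ "monom (of_real c) d"]) (simp add: poly_monom)
next
  case (mult d f j)
  then obtain p where p: "degree p \<le> 2 * d"
    "\<And>t. of_real (f (\<lambda>i. cos t * x i + sin t * y i)) * cis t ^ d = poly p (cis t)" by auto
  \<comment> \<open>By Euler's formulas \<open>q\<close> evaluated at \<open>cis t\<close> is cos t
    x_j + sin t y_j times \<open>cis t\<close>: each new coordinate factor costs one power of
    \<open>cis t\<close> and two degrees.\<close>
  define q :: "complex poly" where "q = [:(of_real (x j) + \<i> * of_real (y j)) / 2, 0, (of_real (x j) - \<i> * of_real (y j)) / 2:]"
  have "degree (q * p) \<le> 2 * Suc d"
    by (rule order_trans[OF degree_mult_le]) (use p(1) in \<open>auto simp: q_def\<close>)
  moreover have hq: "of_real (cos t * x j + sin t * y j) * cis t = poly q (cis t)" for t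
  proof -
    have cs: "cos t * cos t + sin t * sin t = 1" using sin_cos_squared_add2[of t] by (simp add: power2_eq_square add.commute)
    have cs2: "cos t * (cos t * a) + sin t * (sin t * a) = a" for a
    proof -
      have "(cos t * cos t + sin t * sin t) * a = a" by (simp only: cs mult_1)
      then show ?thesis by (simp only: distrib_right mult.assoc)
    qed
    show ?thesis
      unfolding complex_eq_iff q_def by (auto simp: field_simps cs2)
  qed
  moreover have "of_real ((cos t * x j + sin t * y j) * f (\<lambda>i. cos t * x i + sin t * y i)) * cis t ^ Suc d = poly (q * p) (cis t)" for t
    by (simp only: poly_mult p(2)[symmetric] hq[symmetric] of_real_mult power_Suc mult_ac)
  ultimately show ?case by (intro exI[of _ "q * p"]) blast
next
  case (add d f g)
  then obtain p q where "degree p \<le> 2 * d" "degree q \<le> 2 * d"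
    "\<And>t. of_real (f (\<lambda>i. cos t * x i + sin t * y i)) * cis t ^ d = poly p (cis t)"
    "\<And>t. of_real (g (\<lambda>i. cos t * x i + sin t * y i)) * cis t ^ d = poly q (cis t)" by auto
  then show ?case by (intro exI[of _ "p + q"]) (auto simp: degree_add_le algebra_simps)
qed

text \<open>Both sides of the representation by \<open>p\<close> are differentiated in t, and
  \<open>cis t\<close> has modulus 1. The summand d stems from the factor \<open>cis t ^ d\<close>,
  the summand 2 d / \<delta> from the logarithmic derivative of \<open>p\<close>.\<close>

lemma trig_log_derivative:
  fixes g :: "real \<Rightarrow> real" and p :: "complex poly"
  assumes p: "p \<noteq> 0" "degree p \<le> 2 * d" and g: "\<And>t. of_real (g t) * cis t ^ d = poly p (cis t)"
    and der: "(g has_real_derivative g') (at t)" and \<delta>: "0 < \<delta>" "\<And>r. poly p r = 0 \<Longrightarrow> \<delta> \<le> cmod (cis t - r)"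
  shows "\<bar>g'\<bar> \<le> (d + 2 * d / \<delta>) * \<bar>g t\<bar>"
proof -
  have cis': "(cis has_vector_derivative (\<i> * cis t)) (at t)"
  proof -
    have "((\<lambda>t. Complex (cos t) (sin t)) has_vector_derivative Complex (- sin t) (cos t)) (at t)"
      by (auto intro!: derivative_eq_intros has_vector_derivative_complex_iff[THEN iffD2]
          simp: has_real_derivative_iff_has_vector_derivative[symmetric] has_vector_derivative_complex_iff)
    then show ?thesis by (simp add: cis.code complex_eq_iff cis_conv_exp[symmetric] Complex_eq algebra_simps
      fun_eq_iff cis.ctr[abs_def])
  qed
  have "((\<lambda>t. of_real (g t) * cis t ^ d) has_vector_derivative
      of_real g' * cis t ^ d + of_real (g t) * (\<i> * cis t * (of_nat d * cis t ^ (d - 1)))) (at t)"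
  proof -
    have g1: "((\<lambda>t. complex_of_real (g t)) has_vector_derivative of_real g') (at t)"
      using der by (simp add: has_vector_derivative_of_real has_real_derivative_iff_has_vector_derivative)
    have "((\<lambda>z. z ^ d) has_field_derivative of_nat d * cis t ^ (d - 1)) (at (cis t))"
      by (auto intro!: derivative_eq_intros)
    from field_vector_diff_chain_at[OF cis' this]
    have c1: "((\<lambda>t. cis t ^ d) has_vector_derivative \<i> * cis t * (of_nat d * cis t ^ (d - 1))) (at t)"
      by (simp add: o_def)
    from has_vector_derivative_mult[OF g1 c1] show ?thesis by (simp add: add.commute)
  qed
  moreover have "((\<lambda>t. poly p (cis t)) has_vector_derivative \<i> * cis t * poly (pderiv p) (cis t)) (at t)"
    using field_vector_diff_chain_at[OF cis' poly_DERIV] by (simp add: o_def)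
  ultimately have eq: "of_real g' * cis t ^ d + of_real (g t) * (\<i> * cis t * (of_nat d * cis t ^ (d - 1)))
      = \<i> * cis t * poly (pderiv p) (cis t)"
    unfolding g by (rule vector_derivative_unique_at)
  have "\<bar>g'\<bar> = cmod (of_real g' * cis t ^ d)" by (simp add: norm_mult norm_power)
  also have "\<dots> = cmod (\<i> * cis t * poly (pderiv p) (cis t) - of_real (g t) * (\<i> * cis t * (of_nat d * cis t ^ (d - 1))))"
    using eq by (metis add_diff_cancel_right')
  also have "\<dots> \<le> cmod (\<i> * cis t * poly (pderiv p) (cis t)) + cmod (of_real (g t) * (\<i> * cis t * (of_nat d * cis t ^ (d - 1))))"
    by (rule norm_triangle_ineq4)
  also have "\<dots> = cmod (poly (pderiv p) (cis t)) + d * \<bar>g t\<bar>" by (simp add: norm_mult norm_power)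
  also have "cmod (poly (pderiv p) (cis t)) \<le> degree p / \<delta> * cmod (poly p (cis t))"
    by (rule norm_poly_pderiv_le[OF p(1) \<delta>])
  also have "cmod (poly p (cis t)) = \<bar>g t\<bar>" unfolding g[symmetric] by (simp add: norm_mult norm_power)
  also have "degree p / \<delta> * \<bar>g t\<bar> \<le> 2 * d / \<delta> * \<bar>g t\<bar>"
    using p(2) \<delta>(1) by (intro mult_right_mono divide_right_mono) auto
  finally show ?thesis by (simp add: algebra_simps)
qed

text \<open>On [0, 1] the sine has slope at least cos (\<pi> / 3) = 1/2, so the imaginary part alone
  bounds the distance of parameters by twice that of the points. Two points near \<open>r\<close>
  are at most 2 \<delta> apart, which gives 4 \<delta>. This is the reason for working on [0, 1] and
  not on the full circle.\<close>

lemma cis_near_interval: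
  "\<exists>a. {t\<in>{0..1}. cmod (cis t - r) < \<delta>} \<subseteq> {a - 4 * \<delta>..a + 4 * \<delta> :: real}"
proof (cases "\<exists>a\<in>{0..1}. cmod (cis a - r) < \<delta>")
  case True
  then obtain a where a: "a \<in> {0..1}" "cmod (cis a - r) < \<delta>" by blast
  have "\<bar>t - a\<bar> \<le> 4 * \<delta>" if t: "t \<in> {0..1}" "cmod (cis t - r) < \<delta>" for t
  proof -
    have "cmod (cis t - cis a) \<le> cmod (cis t - r) + cmod (cis a - r)"
      by (metis dist_norm dist_triangle2)
    then have d: "cmod (cis t - cis a) \<le> 2 * \<delta>" using a t by simp
    have sin_le: "(v - u) / 2 \<le> sin v - sin u" if uv: "0 \<le> u" "u < v" "v \<le> 1" for u v :: real
    proof -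
      obtain w where w: "u < w" "w < v" "sin v - sin u = (v - u) * cos w"
        using MVT2[of u v sin cos] uv by (auto intro: DERIV_sin)
      have "w \<le> pi / 3" using w that pi_gt3 by linarith
      then have "cos (pi / 3) \<le> cos w" using w that pi_gt_zero by (intro cos_monotone_0_pi_le) auto
      then have "1/2 \<le> cos w" by (simp add: cos_60)
      then have "(v - u) * (1/2) \<le> (v - u) * cos w" using that by (intro mult_left_mono) auto
      then show ?thesis using w by simp
    qed
    have "\<bar>sin t - sin a\<bar> \<le> 2 * \<delta>"
      using abs_Im_le_cmod[of "cis t - cis a"] d by simp
    then show ?thesis
      using sin_le[of a t] sin_le[of t a] a(1) t(1) by (cases t a rule: linorder_cases) auto
  qed
  then have "t \<in> {a - 4 * \<delta>..a + 4 * \<delta>}" if "t \<in> {0..1}" "cmod (cis t - r) < \<delta>" for t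
    using that by (force simp: abs_le_iff)
  then show ?thesis by blast
qed auto

lemma measurable_rot_joint:
  "(\<lambda>z. rot I (cos (fst z)) (sin (fst z)) (snd z)) \<in> measurable (lborel \<Otimes>\<^sub>M (gauss I \<Otimes>\<^sub>M gauss I)) (gauss I \<Otimes>\<^sub>M gauss I)"
proof -
  let ?N = "lborel \<Otimes>\<^sub>M (gauss I \<Otimes>\<^sub>M gauss I)"
  have "(cos :: real \<Rightarrow> real) \<in> borel_measurable borel" "(sin :: real \<Rightarrow> real) \<in> borel_measurable borel"
    by (intro borel_measurable_continuous_onI continuous_on_cos[OF continuous_on_id] continuous_on_sin[OF continuous_on_id])+
  then have t: "(\<lambda>z. cos (fst z :: real)) \<in> borel_measurable ?N" "(\<lambda>z. sin (fst z :: real)) \<in> borel_measurable ?N"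
    by (auto intro!: measurable_compose[OF measurable_fst])
  have c: "(\<lambda>z. fst (snd z) i) \<in> borel_measurable ?N" "(\<lambda>z. snd (snd z) i) \<in> borel_measurable ?N" if "i \<in> I" for i
    using that by (auto intro!: measurable_compose[OF _ measurable_gauss_coord])
  have r: "(\<lambda>z. \<lambda>i\<in>I. cos (fst z) * fst (snd z) i + sin (fst z) * snd (snd z) i) \<in> measurable ?N (gauss I)"
    "(\<lambda>z. \<lambda>i\<in>I. cos (fst z) * snd (snd z) i - sin (fst z) * fst (snd z) i) \<in> measurable ?N (gauss I)"
    unfolding measurable_cong_sets[OF refl sets_gauss]
    by (rule measurable_restrict, rule borel_measurable_add borel_measurable_diff, rule borel_measurable_times,
        rule t, erule c, rule borel_measurable_times, rule t, erule c)+
  show ?thesis unfolding rot_def case_prod_beta by (rule measurable_Pair[OF r])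
qed

text \<open>A bad time t has \<open>cis t\<close> near one of at most 2 d roots, and each root
  accounts for an interval of length 8 \<delta>; the product 2 d * 8 \<delta> is 64 d^2 / T. If T is
  below 2 d, the claimed bound exceeds the length of [0, 1].\<close>

lemma trig_ratio_measure:
  fixes x y :: "nat \<Rightarrow> real"
  assumes f: "polyfun n d f" and d: "1 \<le> d" and T: "0 < T"
  defines "g t \<equiv> f (\<lambda>i. cos t * x i + sin t * y i)"
    and "g' t \<equiv> (\<Sum>l<n. pd l f (\<lambda>i. cos t * x i + sin t * y i) * (cos t * y l - sin t * x l))"
  shows "(\<integral>\<^sup>+t. indicator {0..1} t * indicator {t. T * \<bar>g t\<bar> < \<bar>g' t\<bar>} t \<partial>lborel) \<le> ennreal (64 * (real d)\<^sup>2 / T)"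
proof (cases "2 * d \<le> T")
  case False
  have "(\<integral>\<^sup>+t. indicator {0..1} t * indicator {t. T * \<bar>g t\<bar> < \<bar>g' t\<bar>} t \<partial>lborel) \<le> (\<integral>\<^sup>+t. indicator {0..1::real} t \<partial>lborel)"
    by (rule nn_integral_mono) (simp add: indicator_def)
  also have "\<dots> = 1" by simp
  also have "\<dots> \<le> ennreal (64 * (real d)\<^sup>2 / T)"
  proof -
    have "T \<le> 2 * real d" using False by simp
    also have "\<dots> \<le> 64 * (real d)\<^sup>2" using d by (simp add: power2_eq_square)
    finally show ?thesis using T by (simp add: le_divide_eq)
  qed
  finally show ?thesis .
next
  case True
  \<comment> \<open>Chosen so that 2 d / \<delta> is T / 2; with d at most T / 2 the logarithmic
    derivative away from the roots is at most T.\<close>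
  define \<delta> where "\<delta> = 4 * d / T"
  have \<delta>: "0 < \<delta>" using d T by (simp add: \<delta>_def)
  obtain p :: "complex poly" where p: "degree p \<le> 2 * d" "\<And>t. of_real (g t) * cis t ^ d = poly p (cis t)"
    using polyfun_circle[OF f] unfolding g_def by blast
  have der: "(g has_real_derivative g' t) (at t)" for t
    unfolding g_def g'_def by (rule polyfun_chain[OF f]) (auto intro!: derivative_eq_intros)
  show ?thesis
  proof (cases "p = 0")
    case True
    then have "g t = 0" for t using p(2)[of t] by simp
    then have "g = (\<lambda>_. 0)" by auto
    then have "g' t = 0" for t using der[of t] DERIV_const DERIV_unique by metis
    then have "{t. T * \<bar>g t\<bar> < \<bar>g' t\<bar>} = {}" using T by (auto simp: not_less)
    then show ?thesis by simp
  next
    case p0: False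
    define Rt where "Rt = {r. poly p r = 0}"
    have fin: "finite Rt" unfolding Rt_def by (rule poly_roots_finite[OF p0])
    have cR: "card Rt \<le> 2 * d" unfolding Rt_def using card_poly_roots_bound[OF p0] p(1) by linarith
    have "\<forall>r. \<exists>a. {t\<in>{0..1}. cmod (cis t - r) < \<delta>} \<subseteq> {a - 4 * \<delta>..a + 4 * \<delta> :: real}"
      by (rule allI, rule cis_near_interval)
    from choice[OF this] obtain a where a: "\<forall>r. {t\<in>{0..1}. cmod (cis t - r) < \<delta>} \<subseteq> {a r - 4 * \<delta>..a r + 4 * \<delta> :: real}"
      by (elim exE)
    have "\<exists>r\<in>Rt. cmod (cis t - r) < \<delta>" if t: "T * \<bar>g t\<bar> < \<bar>g' t\<bar>" for t
    proof (rule ccontr)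
      assume "\<not> ?thesis"
      then have "\<bar>g' t\<bar> \<le> (d + 2 * d / \<delta>) * \<bar>g t\<bar>"
        using trig_log_derivative[OF p0 p(1) p(2) der \<delta>, of t] by (auto simp: Rt_def not_less)
      also have "d + 2 * d / \<delta> \<le> T" using True d T by (simp add: \<delta>_def field_simps)
      then have "(d + 2 * d / \<delta>) * \<bar>g t\<bar> \<le> T * \<bar>g t\<bar>" by (rule mult_right_mono) simp
      finally show False using t by linarith
    qed
    then have sub: "indicator {0..1} t * indicator {t. T * \<bar>g t\<bar> < \<bar>g' t\<bar>} t \<le> (indicator (\<Union>r\<in>Rt. {a r - 4 * \<delta>..a r + 4 * \<delta>}) t :: ennreal)" for t
      using a by (fastforce simp: indicator_def)
    have "(\<integral>\<^sup>+t. indicator {0..1} t * indicator {t. T * \<bar>g t\<bar> < \<bar>g' t\<bar>} t \<partial>lborel)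
       \<le> (\<integral>\<^sup>+t. indicator (\<Union>r\<in>Rt. {a r - 4 * \<delta>..a r + 4 * \<delta>}) t \<partial>lborel)"
      by (rule nn_integral_mono) (rule sub)
    also have "\<dots> = emeasure lborel (\<Union>r\<in>Rt. {a r - 4 * \<delta>..a r + 4 * \<delta>})"
      using fin by (intro nn_integral_indicator) auto
    also have "\<dots> \<le> (\<Sum>r\<in>Rt. emeasure lborel {a r - 4 * \<delta>..a r + 4 * \<delta>})"
      using fin by (intro emeasure_subadditive_finite) auto
    also have "\<dots> = (\<Sum>r\<in>Rt. ennreal (8 * \<delta>))"
      using \<delta> by (intro sum.cong) (auto simp: algebra_simps)
    also have "\<dots> = ennreal (card Rt * (8 * \<delta>))"
      using \<delta> by (simp add: ennreal_of_nat_eq_real_of_nat ennreal_mult)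
    also have "\<dots> \<le> ennreal (64 * (real d)\<^sup>2 / T)"
    proof (rule ennreal_leI)
      have "card Rt * (8 * \<delta>) \<le> (2 * real d) * (8 * \<delta>)" using cR \<delta> by (intro mult_right_mono) auto
      also have "\<dots> = 64 * (real d)\<^sup>2 / T" by (simp add: \<delta>_def power2_eq_square)
      finally show "card Rt * (8 * \<delta>) \<le> 64 * (real d)\<^sup>2 / T" .
    qed
    finally show ?thesis .
  qed
qed

text \<open>For independent Gaussian \<open>x, y\<close> the directional derivative of \<open>f\<close> at \<open>x\<close> along \<open>y\<close> is distributed
  like the logarithmic derivative at a uniformly random point of the circle through \<open>x\<close> and \<open>y\<close>.\<close>

lemma directional_ratio:
  assumes f: "polyfun n d f" and d: "1 \<le> d" and T: "0 < T"
  shows "(\<integral>\<^sup>+w. indicator {w. T * \<bar>f (fst w)\<bar> < \<bar>\<Sum>l<n. pd l f (fst w) * snd w l\<bar>} w \<partial>(gauss {..<n} \<Otimes>\<^sub>M gauss {..<n}))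
    \<le> ennreal (64 * (real d)\<^sup>2 / T)"
proof -
  let ?G = "gauss {..<n}"
  let ?GG = "?G \<Otimes>\<^sub>M ?G"
  define U where "U w = (\<Sum>l<n. pd l f (fst w) * snd w l)" for w :: "(nat \<Rightarrow> real) \<times> (nat \<Rightarrow> real)"
  define B where "B = {w \<in> space ?GG. T * \<bar>f (fst w)\<bar> < \<bar>U w\<bar>}"
  define h where "h = (\<lambda>w. indicator B w :: ennreal)"
  let ?R = "\<lambda>t. rot {..<n} (cos t) (sin t)"
  have mf: "f \<in> borel_measurable ?G" by (rule polyfun_measurable[OF f]) auto
  have mp: "pd l f \<in> borel_measurable ?G" if "l < n" for l
    using that by (intro polyfun_measurable[OF polyfun_pd[OF f]]) auto
  have mU: "U \<in> borel_measurable ?GG"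
    unfolding U_def
  proof (intro borel_measurable_sum borel_measurable_times)
    fix l assume "l \<in> {..<n}"
    then have l: "l < n" by simp
    show "(\<lambda>w. pd l f (fst w)) \<in> borel_measurable ?GG"
      by (rule measurable_compose[OF measurable_fst mp[OF l]])
    show "(\<lambda>w. snd w l) \<in> borel_measurable ?GG"
      using l by (intro measurable_compose[OF measurable_snd measurable_gauss_coord]) simp
  qed
  have mff: "(\<lambda>w. f (fst w)) \<in> borel_measurable ?GG" by (rule measurable_compose[OF measurable_fst mf])
  have B: "B \<in> sets ?GG" unfolding B_def
    by (rule borel_measurable_less[OF borel_measurable_times[OF borel_measurable_const borel_measurable_abs[OF mff]] borel_measurable_abs[OF mU]])
  have h: "h \<in> borel_measurable ?GG" unfolding h_def by (rule borel_measurable_indicator[OF B])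
  \<comment> \<open>The event has the same probability at every angle, hence this probability is its
    average over the angles in [0, 1], and that average is estimated for each fixed pair of
    vectors.\<close>
  have rotB: "(\<integral>\<^sup>+w. h (?R t w) \<partial>?GG) = (\<integral>\<^sup>+w. h w \<partial>?GG)" for t
  proof -
    have "h \<in> borel_measurable (distr ?GG ?GG (?R t))" using h unfolding measurable_distr_eq1 .
    from nn_integral_distr[OF measurable_rot this]
    show ?thesis by (simp add: distr_rot_gauss)
  qed
  have hm: "(\<lambda>z. h (?R (fst z) (snd z))) \<in> borel_measurable (lborel \<Otimes>\<^sub>M ?GG)"
    by (rule measurable_compose[OF measurable_rot_joint h])
  have im: "(\<lambda>z. indicator {0..1} (fst z :: real) :: ennreal) \<in> borel_measurable (lborel \<Otimes>\<^sub>M ?GG)"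
    by (rule measurable_compose[OF measurable_fst]) simp
  have "(\<integral>\<^sup>+w. h w \<partial>?GG) = (\<integral>\<^sup>+t. (\<integral>\<^sup>+w. h w \<partial>?GG) * indicator {0..1::real} t \<partial>lborel)"
    by (subst nn_integral_cmult_indicator) auto
  also have "\<dots> = (\<integral>\<^sup>+t. \<integral>\<^sup>+w. indicator {0..1} t * h (?R t w) \<partial>?GG \<partial>lborel)"
  proof (rule nn_integral_cong)
    fix t :: real
    have "(\<lambda>w. h (?R t w)) \<in> borel_measurable ?GG" by (rule measurable_compose[OF measurable_rot h])
    from nn_integral_cmult[OF this, of "indicator {0..1} t"]
    show "(\<integral>\<^sup>+w. h w \<partial>?GG) * indicator {0..1} t = (\<integral>\<^sup>+w. indicator {0..1} t * h (?R t w) \<partial>?GG)"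
      by (simp add: rotB mult.commute)
  qed
  also have "\<dots> = (\<integral>\<^sup>+w. \<integral>\<^sup>+t. indicator {0..1} t * h (?R t w) \<partial>lborel \<partial>?GG)"
  proof -
    interpret pair_sigma_finite lborel ?GG ..
    have "(\<lambda>(t, w). indicator {0..1} t * h (?R t w)) \<in> borel_measurable (lborel \<Otimes>\<^sub>M ?GG)"
      unfolding case_prod_beta' by (rule borel_measurable_times_ennreal[OF im hm])
    from Fubini'[OF this] show ?thesis by (rule sym)
  qed
  also have "\<dots> \<le> (\<integral>\<^sup>+w. ennreal (64 * (real d)\<^sup>2 / T) \<partial>?GG)"
  proof (rule nn_integral_mono)
    fix w :: "(nat \<Rightarrow> real) \<times> (nat \<Rightarrow> real)"
    let ?X = "\<lambda>t i. cos t * fst w i + sin t * snd w i"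
    have "h (?R t w) \<le> indicator {t. T * \<bar>f (?X t)\<bar> < \<bar>\<Sum>l<n. pd l f (?X t) * (cos t * snd w l - sin t * fst w l)\<bar>} t" for t
    proof -
      have "pd l f (fst (?R t w)) = pd l f (?X t)" if "l < n" for l
        using that by (intro polyfun_cong_coords[OF polyfun_pd[OF f]]) (auto simp: rot_def case_prod_beta)
      then have "U (?R t w) = (\<Sum>l<n. pd l f (?X t) * (cos t * snd w l - sin t * fst w l))"
        unfolding U_def by (intro sum.cong) (auto simp: rot_def case_prod_beta)
      moreover have "f (fst (?R t w)) = f (?X t)"
        by (intro polyfun_cong_coords[OF f]) (auto simp: rot_def case_prod_beta)
      ultimately show ?thesis by (auto simp: h_def B_def indicator_def)
    qed
    then have "(\<integral>\<^sup>+t. indicator {0..1} t * h (?R t w) \<partial>lborel)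
       \<le> (\<integral>\<^sup>+t. indicator {0..1} t * indicator {t. T * \<bar>f (?X t)\<bar> < \<bar>\<Sum>l<n. pd l f (?X t) * (cos t * snd w l - sin t * fst w l)\<bar>} t \<partial>lborel)"
      by (intro nn_integral_mono mult_left_mono) auto
    also have "\<dots> \<le> ennreal (64 * (real d)\<^sup>2 / T)" by (rule trig_ratio_measure[OF f d T])
    finally show "(\<integral>\<^sup>+t. indicator {0..1} t * h (?R t w) \<partial>lborel) \<le> ennreal (64 * (real d)\<^sup>2 / T)" .
  qed
  also have "\<dots> = ennreal (64 * (real d)\<^sup>2 / T)" by (simp add: gauss_pair.emeasure_space_1)
  finally have "(\<integral>\<^sup>+w. h w \<partial>?GG) \<le> ennreal (64 * (real d)\<^sup>2 / T)" .
  moreover have "(\<integral>\<^sup>+w. h w \<partial>?GG) = (\<integral>\<^sup>+w. indicator {w. T * \<bar>f (fst w)\<bar> < \<bar>\<Sum>l<n. pd l f (fst w) * snd w l\<bar>} w \<partial>?GG)"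
    by (rule nn_integral_cong) (auto simp: h_def B_def U_def indicator_def)
  ultimately show ?thesis by simp
qed

text \<open>For the second moment of \<open>q\<close>, Cauchy-Schwarz is weighted by the variances
  \<open>b j\<close> of the forms: the fourth moment of a form divided by its variance is 3
  \<open>b j\<close>, and these add up to 3 a. The bound does not depend on the number of
  forms.\<close>

lemma gauss_family_moments:
  fixes c :: "nat \<Rightarrow> nat \<Rightarrow> real" and m n :: nat
  defines "a \<equiv> \<Sum>j<m. \<Sum>l<n. (c j l)\<^sup>2" and "q y \<equiv> \<Sum>j<m. (\<Sum>l<n. c j l * y l)\<^sup>2"
  shows "(\<integral>y. q y \<partial>gauss {..<n}) = a" "(\<integral>y. (q y)\<^sup>2 \<partial>gauss {..<n}) \<le> 3 * a\<^sup>2"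
    and "polyfun n 2 q"
proof -
  let ?G = "gauss {..<n}"
  have p: "polyfun n 1 (\<lambda>y. \<Sum>l<n. c j l * y l)" for j by (rule polyfun_sum_coords) simp
  have p2: "polyfun n 2 (\<lambda>y. (\<Sum>l<n. c j l * y l)\<^sup>2)" for j using polyfun_power[OF p, of 2 j] by simp
  show pq: "polyfun n 2 q" unfolding q_def[abs_def] by (rule polyfun_sum) (rule p2)
  have i2: "integrable ?G (\<lambda>y. (\<Sum>l<n. c j l * y l)\<^sup>2)" for j by (rule polyfun_integrable_gauss[OF p2])
  have i4: "integrable ?G (\<lambda>y. (\<Sum>l<n. c j l * y l)^4)" for j by (rule polyfun_integrable_gauss[OF polyfun_power[OF p]])
  show "(\<integral>y. q y \<partial>?G) = a"
    unfolding q_def[abs_def] a_def using i2 by (simp add: gauss_linear_moment_2)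
  define b where "b j = (\<Sum>l<n. (c j l)\<^sup>2)" for j
  have b0: "0 \<le> b j" for j by (simp add: b_def sum_nonneg)
  have "(q y)\<^sup>2 \<le> a * (\<Sum>j<m. (\<Sum>l<n. c j l * y l)^4 / b j)" for y
  proof -
    \<comment> \<open>A form of variance zero vanishes identically, in agreement with the value 0 of
      the division by zero on the right.\<close>
    have "(\<Sum>l<n. c j l * y l)\<^sup>2 = sqrt (b j) * ((\<Sum>l<n. c j l * y l)\<^sup>2 / sqrt (b j))" for j
    proof (cases "b j = 0")
      case True
      then have "c j l = 0" if "l < n" for l using that by (simp add: b_def sum_nonneg_eq_0_iff)
      then show ?thesis using True by simp
    qed simp
    then have "q y = (\<Sum>j<m. sqrt (b j) * ((\<Sum>l<n. c j l * y l)\<^sup>2 / sqrt (b j)))"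
      unfolding q_def by (rule sum.cong[OF refl])
    then have "(q y)\<^sup>2 \<le> (\<Sum>j<m. (sqrt (b j))\<^sup>2) * (\<Sum>j<m. ((\<Sum>l<n. c j l * y l)\<^sup>2 / sqrt (b j))\<^sup>2)"
      by (simp only: Cauchy_Schwarz_ineq_sum)
    also have "(\<Sum>j<m. (sqrt (b j))\<^sup>2) = a" unfolding a_def b_def[symmetric] using b0 by simp
    also have "(\<Sum>j<m. ((\<Sum>l<n. c j l * y l)\<^sup>2 / sqrt (b j))\<^sup>2) = (\<Sum>j<m. (\<Sum>l<n. c j l * y l)^4 / b j)"
      using b0 by (intro sum.cong) (simp_all add: power_divide power_mult[symmetric])
    finally show ?thesis .
  qed
  then have "(\<integral>y. (q y)\<^sup>2 \<partial>?G) \<le> (\<integral>y. a * (\<Sum>j<m. (\<Sum>l<n. c j l * y l)^4 / b j) \<partial>?G)"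
  proof (rule integral_mono[rotated 2])
    show "integrable ?G (\<lambda>y. (q y)\<^sup>2)" by (rule polyfun_integrable_gauss[OF polyfun_power[OF pq]])
    show "integrable ?G (\<lambda>y. a * (\<Sum>j<m. (\<Sum>l<n. c j l * y l)^4 / b j))"
      by (rule integrable_mult_right, rule Bochner_Integration.integrable_sum, rule integrable_divide, rule i4)
  qed
  also have "\<dots> = a * (\<Sum>j<m. (\<integral>y. (\<Sum>l<n. c j l * y l)^4 \<partial>?G) / b j)"
    using i4 by simp
  also have "\<dots> = a * (\<Sum>j<m. 3 * b j)"
  proof -
    have "3 * (b j)\<^sup>2 / b j = 3 * b j" for j by (simp add: power2_eq_square)
    then show ?thesis by (simp add: gauss_linear_moment_4 b_def[symmetric])
  qed
  also have "\<dots> = 3 * a\<^sup>2"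
  proof -
    have "a = (\<Sum>j<m. b j)" by (simp add: a_def b_def)
    then show ?thesis by (simp add: sum_distrib_left[symmetric] power2_eq_square)
  qed
  finally show "(\<integral>y. (q y)\<^sup>2 \<partial>?G) \<le> 3 * a\<^sup>2" .
qed

text \<open>A second moment argument: \<open>4 \<sigma> (X\<^sup>2 - T\<^sup>2 D\<^sup>2 / 4 - \<sigma> X\<^sup>4)\<close> is a lower bound for the indicator
  of the event \<open>T \<bar>D\<bar> / 2 < \<bar>X\<bar>\<close>, for every \<open>\<sigma>\<close>.\<close>

lemma projection_lower_bound:
  fixes c :: "nat \<Rightarrow> nat \<Rightarrow> real" and v :: "nat \<Rightarrow> real"
  assumes T: "0 < T" and gt: "T\<^sup>2 * (\<Sum>j<m. (v j)\<^sup>2) < (\<Sum>j<m. \<Sum>l<n. (c j l)\<^sup>2)"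
  shows "ennreal (1/16) \<le> (\<integral>\<^sup>+y. \<integral>\<^sup>+u. indicator {u. T / 2 * \<bar>\<Sum>j<m. u j * v j\<bar> < \<bar>\<Sum>j<m. u j * (\<Sum>l<n. c j l * y l)\<bar>} u
     \<partial>gauss {..<m} \<partial>gauss {..<n})"
proof -
  let ?M = "gauss {..<m}" and ?G = "gauss {..<n}"
  define a where "a = (\<Sum>j<m. \<Sum>l<n. (c j l)\<^sup>2)"
  define N where "N = (\<Sum>j<m. (v j)\<^sup>2)"
  define q where "q y = (\<Sum>j<m. (\<Sum>l<n. c j l * y l)\<^sup>2)" for y
  have N0: "0 \<le> N" by (simp add: N_def sum_nonneg)
  have aN: "T\<^sup>2 * N < a" using gt by (simp add: a_def N_def)
  then have a0: "0 < a" using N0 by (meson le_less_trans mult_nonneg_nonneg zero_le_power2)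
  \<comment> \<open>The final lower bound is 3 \<sigma> a - 36 \<sigma>^2 a^2, which is largest at
    \<sigma> a = 1/24 with value 1/16.\<close>
  define \<sigma> where "\<sigma> = 1 / (24 * a)"
  have \<sigma>: "0 < \<sigma>" using a0 by (simp add: \<sigma>_def)
  \<comment> \<open>This is the mean over \<open>u\<close> of the minorant: given \<open>y\<close>,
    X is a Gaussian form with variance \<open>q y\<close> and fourth moment 3 (q y)^2, and D has
    variance \<open>N\<close>.\<close>
  define h where "h y = 4 * \<sigma> * q y - \<sigma> * T\<^sup>2 * N - 12 * \<sigma>\<^sup>2 * (q y)\<^sup>2" for y
  have pt: "4 * \<sigma> * X\<^sup>2 - \<sigma> * T\<^sup>2 * D\<^sup>2 - 4 * \<sigma>\<^sup>2 * X^4 \<le> (if T / 2 * \<bar>D\<bar> < \<bar>X\<bar> then 1 else 0)" for X D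
  proof (cases "T / 2 * \<bar>D\<bar> < \<bar>X\<bar>")
    case True
    have "0 \<le> (1 - 2 * \<sigma> * X\<^sup>2)\<^sup>2" by simp
    also have "\<dots> = 1 - (4 * \<sigma> * X\<^sup>2 - 4 * \<sigma>\<^sup>2 * X^4)" by (simp add: power2_eq_square power4_eq_xxxx algebra_simps)
    finally have "4 * \<sigma> * X\<^sup>2 - 4 * \<sigma>\<^sup>2 * X^4 \<le> 1" by simp
    moreover have "0 \<le> \<sigma> * T\<^sup>2 * D\<^sup>2" using \<sigma> by simp
    ultimately show ?thesis using True by simp
  next
    case False
    then have "\<bar>X\<bar>\<^sup>2 \<le> (T / 2 * \<bar>D\<bar>)\<^sup>2" by (intro power_mono) auto
    then have "X\<^sup>2 \<le> T\<^sup>2 * D\<^sup>2 / 4" by (simp add: power_mult_distrib power_divide)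
    then have "4 * \<sigma> * X\<^sup>2 \<le> 4 * \<sigma> * (T\<^sup>2 * D\<^sup>2 / 4)" using \<sigma> by (intro mult_left_mono) auto
    then have "4 * \<sigma> * X\<^sup>2 \<le> \<sigma> * T\<^sup>2 * D\<^sup>2" by (simp add: mult.assoc)
    moreover have "0 \<le> 4 * \<sigma>\<^sup>2 * X^4" by simp
    ultimately have "4 * \<sigma> * X\<^sup>2 - \<sigma> * T\<^sup>2 * D\<^sup>2 - 4 * \<sigma>\<^sup>2 * X^4 \<le> 0" by linarith
    then show ?thesis using False by (simp only: if_False)
  qed
  have inner: "ennreal (h y) \<le> (\<integral>\<^sup>+u. indicator {u. T / 2 * \<bar>\<Sum>j<m. u j * v j\<bar> < \<bar>\<Sum>j<m. u j * (\<Sum>l<n. c j l * y l)\<bar>} u \<partial>?M)" for y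
  proof -
    define D where "D u = (\<Sum>j<m. v j * u j)" for u
    define X where "X u = (\<Sum>j<m. (\<Sum>l<n. c j l * y l) * u j)" for u
    have pD: "polyfun m 1 D" "polyfun m 1 X" unfolding D_def[abs_def] X_def[abs_def] by (rule polyfun_sum_coords; simp)+
    have i: "integrable ?M (\<lambda>u. (D u)\<^sup>2)" "integrable ?M (\<lambda>u. (X u)\<^sup>2)" "integrable ?M (\<lambda>u. (X u)^4)"
      by (rule polyfun_integrable_gauss[OF polyfun_power[OF pD(1)]], rule polyfun_integrable_gauss[OF polyfun_power[OF pD(2)]],
        rule polyfun_integrable_gauss[OF polyfun_power[OF pD(2)]])
    define A where "A = {u \<in> space ?M. T / 2 * \<bar>D u\<bar> < \<bar>X u\<bar>}"
    have mD: "D \<in> borel_measurable ?M" "X \<in> borel_measurable ?M"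
      by (rule polyfun_measurable[OF pD(1)], rule measurable_gauss_coord, simp)
         (rule polyfun_measurable[OF pD(2)], rule measurable_gauss_coord, simp)
    have A: "A \<in> sets ?M" unfolding A_def
      by (rule borel_measurable_less[OF borel_measurable_times[OF borel_measurable_const borel_measurable_abs[OF mD(1)]] borel_measurable_abs[OF mD(2)]])
    have "h y = (\<integral>u. 4 * \<sigma> * (X u)\<^sup>2 - \<sigma> * T\<^sup>2 * (D u)\<^sup>2 - 4 * \<sigma>\<^sup>2 * (X u)^4 \<partial>?M)"
      using i by (simp add: D_def X_def gauss_linear_moment_2 gauss_linear_moment_4 h_def q_def N_def)
    also have "\<dots> \<le> (\<integral>u. indicator A u \<partial>?M)"
    proof (rule integral_mono)
      show "integrable ?M (\<lambda>u. 4 * \<sigma> * (X u)\<^sup>2 - \<sigma> * T\<^sup>2 * (D u)\<^sup>2 - 4 * \<sigma>\<^sup>2 * (X u)^4)" using i by simp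
      show "integrable ?M (indicator A :: _ \<Rightarrow> real)" using A by (intro integrable_real_indicator) (auto simp: gauss.emeasure_eq_measure)
      fix u assume "u \<in> space ?M"
      then have "indicator A u = (if T / 2 * \<bar>D u\<bar> < \<bar>X u\<bar> then 1 else 0 :: real)"
        by (simp add: A_def indicator_def)
      then show "4 * \<sigma> * (X u)\<^sup>2 - \<sigma> * T\<^sup>2 * (D u)\<^sup>2 - 4 * \<sigma>\<^sup>2 * (X u)^4 \<le> indicator A u"
        using pt[of "X u" "D u"] by (simp only:)
    qed
    also have "(\<integral>u. indicator A u \<partial>?M) = measure ?M A"
      using A by simp
    finally have "ennreal (h y) \<le> emeasure ?M A" by (simp add: gauss.emeasure_eq_measure ennreal_leI)
    also have "\<dots> = (\<integral>\<^sup>+u. indicator A u \<partial>?M)" using A by simp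
    also have "\<dots> \<le> (\<integral>\<^sup>+u. indicator {u. T / 2 * \<bar>\<Sum>j<m. u j * v j\<bar> < \<bar>\<Sum>j<m. u j * (\<Sum>l<n. c j l * y l)\<bar>} u \<partial>?M)"
      by (rule nn_integral_mono) (auto simp: A_def D_def X_def indicator_def mult.commute)
    finally show ?thesis .
  qed
  have pq: "polyfun n 2 q" unfolding q_def[abs_def] by (rule gauss_family_moments(3))
  have iq: "integrable ?G q" "integrable ?G (\<lambda>y. (q y)\<^sup>2)"
    by (rule polyfun_integrable_gauss[OF pq], rule polyfun_integrable_gauss[OF polyfun_power[OF pq]])
  have ih: "integrable ?G h" unfolding h_def[abs_def] using iq by simp
  have "1/16 \<le> 4 * \<sigma> * a - \<sigma> * T\<^sup>2 * N - 12 * \<sigma>\<^sup>2 * (3 * a\<^sup>2)"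
  proof -
    have "\<sigma> * (T\<^sup>2 * N) \<le> \<sigma> * a" using aN \<sigma> by (intro mult_left_mono) auto
    moreover have "\<sigma> * a = 1/24" using a0 by (simp add: \<sigma>_def)
    moreover have "\<sigma>\<^sup>2 * a\<^sup>2 = (1/24)\<^sup>2" using calculation(2) by (simp add: power_mult_distrib[symmetric])
    ultimately show ?thesis by (simp add: power2_eq_square)
  qed
  also have "\<dots> \<le> 4 * \<sigma> * (\<integral>y. q y \<partial>?G) - \<sigma> * T\<^sup>2 * N - 12 * \<sigma>\<^sup>2 * (\<integral>y. (q y)\<^sup>2 \<partial>?G)"
    using gauss_family_moments(1,2)[where c=c and m=m and n=n] \<sigma>
    unfolding q_def[symmetric] a_def[symmetric] by (simp add: mult_left_mono)
  also have "\<dots> = (\<integral>y. h y \<partial>?G)" unfolding h_def[abs_def] using iq by (simp add: gauss.prob_space)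
  finally have "1/16 \<le> (\<integral>y. h y \<partial>?G)" .
  also have "\<dots> \<le> (\<integral>y. max 0 (h y) \<partial>?G)"
    using ih by (intro integral_mono) auto
  finally have "ennreal (1/16) \<le> ennreal (\<integral>y. max 0 (h y) \<partial>?G)" by (rule ennreal_leI)
  also have "\<dots> = (\<integral>\<^sup>+y. ennreal (max 0 (h y)) \<partial>?G)"
    using ih by (intro nn_integral_eq_integral[symmetric]) auto
  also have "\<dots> = (\<integral>\<^sup>+y. ennreal (h y) \<partial>?G)" by (intro nn_integral_cong) (simp add: ennreal_neg max_def)
  also have "\<dots> \<le> (\<integral>\<^sup>+y. \<integral>\<^sup>+u. indicator {u. T / 2 * \<bar>\<Sum>j<m. u j * v j\<bar> < \<bar>\<Sum>j<m. u j * (\<Sum>l<n. c j l * y l)\<bar>} u \<partial>?M \<partial>?G)"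
    by (intro nn_integral_mono inner)
  finally show ?thesis .
qed

text \<open>The family is reduced to a single polynomial by a Gaussian random combination with
  coefficients \<open>u\<close>, and the gradient to a derivative in the random direction
  \<open>y\<close>. Where the family has a large gradient, the combination has a large directional
  derivative with probability at least 1/16 over \<open>u\<close> and \<open>y\<close>; over
  \<open>x\<close> and \<open>y\<close> this has probability at most 128 d^2 / T for every
  \<open>u\<close>. The quotient is 2048 d^2 / T, whatever the size of the family.\<close>

lemma gradient_ratio_family:
  fixes P :: "nat \<Rightarrow> (nat \<Rightarrow> real) \<Rightarrow> real"
  assumes P: "\<And>j. j < m \<Longrightarrow> polyfun n d (P j)" and d: "1 \<le> d" and T: "0 < T"
  shows "emeasure (gauss {..<n}) {x \<in> space (gauss {..<n}). T\<^sup>2 * (\<Sum>j<m. (P j x)\<^sup>2) < (\<Sum>j<m. \<Sum>l<n. (pd l (P j) x)\<^sup>2)}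
     \<le> ennreal (2048 * (real d)\<^sup>2 / T)"
proof -
  let ?M = "gauss {..<m}" and ?G = "gauss {..<n}"
  let ?GG = "?G \<Otimes>\<^sub>M ?G"
  define B where "B = {x \<in> space ?G. T\<^sup>2 * (\<Sum>j<m. (P j x)\<^sup>2) < (\<Sum>j<m. \<Sum>l<n. (pd l (P j) x)\<^sup>2)}"
  define D where "D u x = (\<Sum>j<m. u j * P j x)" for u x
  define X where "X u x y = (\<Sum>j<m. u j * (\<Sum>l<n. pd l (P j) x * y l))" for u x and y :: "nat \<Rightarrow> real"
  define K where "K u w = (of_bool (T / 2 * \<bar>D u (fst w)\<bar> < \<bar>X u (fst w) (snd w)\<bar>) :: ennreal)" for u w
  have mP: "P j \<in> borel_measurable ?G" if "j < m" for j
    by (rule polyfun_measurable[OF P[OF that]]) (rule measurable_gauss_coord, simp)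
  have mpd: "pd l (P j) \<in> borel_measurable ?G" if "j < m" "l < n" for j l
    by (rule polyfun_measurable[OF polyfun_pd[OF P[OF that(1)] that(2)]]) (rule measurable_gauss_coord, simp)
  have B: "B \<in> sets ?G"
  proof -
    have s1: "(\<lambda>x. \<Sum>j<m. (P j x)\<^sup>2) \<in> borel_measurable ?G"
      by (rule borel_measurable_sum, rule borel_measurable_power, rule mP, simp)
    have s2: "(\<lambda>x. \<Sum>j<m. \<Sum>l<n. (pd l (P j) x)\<^sup>2) \<in> borel_measurable ?G"
      by (rule borel_measurable_sum, rule borel_measurable_sum, rule borel_measurable_power, rule mpd, simp_all only: lessThan_iff)
    show ?thesis unfolding B_def
      by (rule borel_measurable_less[OF borel_measurable_times[OF borel_measurable_const s1] s2])
  qed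
  have mD: "(\<lambda>z. D (fst z) (fst (snd z))) \<in> borel_measurable (?M \<Otimes>\<^sub>M ?GG)"
    unfolding D_def
  proof (intro borel_measurable_sum borel_measurable_times)
    fix j assume "j \<in> {..<m}"
    then show "(\<lambda>z. fst z j) \<in> borel_measurable (?M \<Otimes>\<^sub>M ?GG)" "(\<lambda>z. P j (fst (snd z))) \<in> borel_measurable (?M \<Otimes>\<^sub>M ?GG)"
      by - (rule measurable_compose[OF measurable_fst measurable_gauss_coord], assumption,
          rule measurable_compose[OF measurable_snd measurable_compose[OF measurable_fst mP]], simp)
  qed
  have mX: "(\<lambda>z. X (fst z) (fst (snd z)) (snd (snd z))) \<in> borel_measurable (?M \<Otimes>\<^sub>M ?GG)"
    unfolding X_def
  proof (intro borel_measurable_sum borel_measurable_times)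
    fix j l assume j: "j \<in> {..<m}" and l: "l \<in> {..<n}"
    show "(\<lambda>z. pd l (P j) (fst (snd z))) \<in> borel_measurable (?M \<Otimes>\<^sub>M ?GG)"
      by (rule measurable_compose[OF measurable_snd measurable_compose[OF measurable_fst mpd]]) (use j l in auto)
    show "(\<lambda>z. snd (snd z) l) \<in> borel_measurable (?M \<Otimes>\<^sub>M ?GG)"
      by (rule measurable_compose[OF measurable_snd measurable_compose[OF measurable_snd measurable_gauss_coord]]) (rule l)
  next
    fix j assume "j \<in> {..<m}"
    then show "(\<lambda>z. fst z j) \<in> borel_measurable (?M \<Otimes>\<^sub>M ?GG)"
      by - (rule measurable_compose[OF measurable_fst measurable_gauss_coord], assumption)
  qed
  have mK: "(\<lambda>z. K (fst z) (snd z)) \<in> borel_measurable (?M \<Otimes>\<^sub>M ?GG)"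
  proof -
    define C where "C = {z \<in> space (?M \<Otimes>\<^sub>M ?GG). T / 2 * \<bar>D (fst z) (fst (snd z))\<bar> < \<bar>X (fst z) (fst (snd z)) (snd (snd z))\<bar>}"
    have "C \<in> sets (?M \<Otimes>\<^sub>M ?GG)" unfolding C_def
      by (rule borel_measurable_less[OF borel_measurable_times[OF borel_measurable_const borel_measurable_abs[OF mD]] borel_measurable_abs[OF mX]])
    then have "(indicator C :: _ \<Rightarrow> ennreal) \<in> borel_measurable (?M \<Otimes>\<^sub>M ?GG)" by (rule borel_measurable_indicator)
    moreover have "(\<lambda>z. K (fst z) (snd z)) \<in> borel_measurable (?M \<Otimes>\<^sub>M ?GG) \<longleftrightarrow> (indicator C :: _ \<Rightarrow> ennreal) \<in> borel_measurable (?M \<Otimes>\<^sub>M ?GG)"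
      by (rule measurable_cong) (simp add: K_def C_def indicator_def)
    ultimately show ?thesis by blast
  qed
  have up: "(\<integral>\<^sup>+w. K u w \<partial>?GG) \<le> ennreal (128 * (real d)\<^sup>2 / T)" for u
  proof -
    have pu: "polyfun n d (\<lambda>x. D u x)" unfolding D_def by (intro polyfun_sum polyfun_cmult P) simp
    have "(\<Sum>l<n. pd l (D u) x * y l) = X u x y" for x y
    proof -
      have "(\<Sum>l<n. pd l (D u) x * y l) = (\<Sum>l<n. \<Sum>j<m. u j * (pd l (P j) x * y l))"
      proof (rule sum.cong[OF refl])
        fix l assume "l \<in> {..<n}"
        then have "pd l (D u) x = (\<Sum>j<m. u j * pd l (P j) x)"
          unfolding D_def[abs_def] by (intro pd_sum[of "{..<m}" n d]) (auto intro: P)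
        then show "pd l (D u) x * y l = (\<Sum>j<m. u j * (pd l (P j) x * y l))"
          by (simp add: sum_distrib_right mult.assoc)
      qed
      also have "\<dots> = X u x y" unfolding X_def by (subst sum.swap) (simp add: sum_distrib_left)
      finally show ?thesis .
    qed
    then have "K u w = indicator {w. T / 2 * \<bar>D u (fst w)\<bar> < \<bar>\<Sum>l<n. pd l (D u) (fst w) * snd w l\<bar>} w" for w
      by (simp add: K_def indicator_def)
    then have "(\<integral>\<^sup>+w. K u w \<partial>?GG) \<le> ennreal (64 * (real d)\<^sup>2 / (T / 2))"
      using directional_ratio[OF pu d, of "T / 2"] T by simp
    then show ?thesis by simp
  qed
  have low: "ennreal (1/16) * indicator B x \<le> (\<integral>\<^sup>+y. \<integral>\<^sup>+u. K u (x, y) \<partial>?M \<partial>?G)" for x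
  proof (cases "x \<in> B")
    case True
    then have "T\<^sup>2 * (\<Sum>j<m. (P j x)\<^sup>2) < (\<Sum>j<m. \<Sum>l<n. (pd l (P j) x)\<^sup>2)" by (simp add: B_def)
    from projection_lower_bound[OF T this] show ?thesis
      using True by (simp add: K_def D_def X_def indicator_def)
  qed simp
  have "ennreal (1/16) * emeasure ?G B = (\<integral>\<^sup>+x. ennreal (1/16) * indicator B x \<partial>?G)"
    using B by (simp add: nn_integral_cmult_indicator)
  also have "\<dots> \<le> (\<integral>\<^sup>+x. \<integral>\<^sup>+y. \<integral>\<^sup>+u. K u (x, y) \<partial>?M \<partial>?G \<partial>?G)"
    by (intro nn_integral_mono low)
  also have "\<dots> = (\<integral>\<^sup>+w. \<integral>\<^sup>+u. K u w \<partial>?M \<partial>?GG)"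
  proof (rule gauss.nn_integral_fst)
    interpret MG: pair_sigma_finite ?M ?GG ..
    interpret GM: pair_sigma_finite ?GG ?M ..
    have "(\<lambda>(w, u). K u w) \<in> borel_measurable (?GG \<Otimes>\<^sub>M ?M)"
      using measurable_compose[OF measurable_pair_swap' mK] by (simp add: case_prod_beta')
    from gauss.borel_measurable_nn_integral[OF this]
    show "(\<lambda>w. \<integral>\<^sup>+u. K u w \<partial>?M) \<in> borel_measurable ?GG" .
  qed
  also have "\<dots> = (\<integral>\<^sup>+u. \<integral>\<^sup>+w. K u w \<partial>?GG \<partial>?M)"
  proof -
    interpret MG: pair_sigma_finite ?M ?GG ..
    have "(\<lambda>(u, w). K u w) \<in> borel_measurable (?M \<Otimes>\<^sub>M ?GG)" unfolding case_prod_beta' by (rule mK)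
    from MG.Fubini'[OF this] show ?thesis .
  qed
  also have "\<dots> \<le> (\<integral>\<^sup>+u. ennreal (128 * (real d)\<^sup>2 / T) \<partial>?M)" by (intro nn_integral_mono up)
  also have "\<dots> = ennreal (128 * (real d)\<^sup>2 / T)" by (simp add: gauss.emeasure_space_1)
  finally have le: "ennreal (1/16) * emeasure ?G B \<le> ennreal (128 * (real d)\<^sup>2 / T)" .
  have "emeasure ?G B = ennreal (measure ?G B)" by (rule gauss.emeasure_eq_measure)
  moreover have "ennreal (1/16 * measure ?G B) = ennreal (1/16) * ennreal (measure ?G B)"
    by (rule ennreal_mult) simp_all
  ultimately have "ennreal (1/16 * measure ?G B) \<le> ennreal (128 * (real d)\<^sup>2 / T)" using le by (simp only:)
  then have "1/16 * measure ?G B \<le> 128 * (real d)\<^sup>2 / T" using T by (simp add: ennreal_le_iff)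
  then have "measure ?G B \<le> 2048 * (real d)\<^sup>2 / T" by simp
  then show ?thesis unfolding B_def[symmetric] by (simp add: gauss.emeasure_eq_measure ennreal_leI)
qed

section \<open>Four moments and halfspaces\<close>

lemma indep_vars_gauss_coords:
  assumes "finite I" "I \<noteq> {}"
  shows "prob_space.indep_vars (gauss I) (\<lambda>_. borel) (\<lambda>i x. x i) I"
proof -
  have rv: "(\<lambda>x. x i) \<in> borel_measurable (gauss I)" for i
  proof (cases "i \<in> I")
    case True then show ?thesis by (rule measurable_gauss_coord)
  next
    \<comment> \<open>Measurability is passed on for every index. Outside \<open>I\<close> a
      coordinate is the constant \<open>undefined\<close> on the space.\<close>
    case False
    have "(\<lambda>x. x i) \<in> borel_measurable (gauss I) \<longleftrightarrow> (\<lambda>x. undefined :: real) \<in> borel_measurable (gauss I)"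
      by (rule measurable_cong) (use False in \<open>auto simp: space_gauss extensional_def\<close>)
    then show ?thesis by (simp only: borel_measurable_const)
  qed
  have "distr (gauss I) (Pi\<^sub>M I (\<lambda>_. borel)) (\<lambda>x. \<lambda>i\<in>I. x i) = distr (gauss I) (gauss I) (\<lambda>x. x)"
  proof (rule distr_cong[OF refl sets_gauss[symmetric]])
    show "restrict x I = x" if "x \<in> space (gauss I)" for x :: "'a \<Rightarrow> real"
      using that unfolding space_gauss by (rule extensional_restrict)
  qed
  also have "\<dots> = gauss I" by (simp add: distr_id)
  also have "\<dots> = Pi\<^sub>M I (\<lambda>i. distr (gauss I) borel (\<lambda>x. x i))"
    unfolding gauss_def
  proof (rule PiM_cong[OF refl])
    fix i assume i: "i \<in> I"
    have "distr (Pi\<^sub>M I (\<lambda>_. gauss1)) gauss1 (\<lambda>x. x i) = gauss1"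
      by (rule distr_PiM_component[OF gauss1.prob_space_axioms i])
    moreover have "distr (Pi\<^sub>M I (\<lambda>_. gauss1)) borel (\<lambda>x. x i) = distr (Pi\<^sub>M I (\<lambda>_. gauss1)) gauss1 (\<lambda>x. x i)"
      by (rule distr_cong) auto
    ultimately show "gauss1 = distr (Pi\<^sub>M I (\<lambda>_. gauss1)) borel (\<lambda>x. x i)" by simp
  qed
  finally show ?thesis by (subst gauss.indep_vars_iff_distr_eq_PiM[OF assms(2) rv])
qed

text \<open>Indices with coefficient zero are removed beforehand, because the multiple 0 of a normal
  variable has no density.\<close>

lemma distributed_gauss_linear:
  fixes a :: "nat \<Rightarrow> real"
  assumes a: "(\<Sum>i<n. (a i)\<^sup>2) = 1"
  shows "distributed (gauss {..<n}) lborel (\<lambda>x. \<Sum>i<n. a i * x i) (\<lambda>t. ennreal (std_normal_density t))"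
proof -
  define I where "I = {i\<in>{..<n}. a i \<noteq> 0}"
  have I: "finite I" "I \<subseteq> {..<n}" by (auto simp: I_def)
  have sI: "(\<Sum>i\<in>I. (a i)\<^sup>2) = 1" unfolding a[symmetric] by (rule sum.mono_neutral_left) (auto simp: I_def)
  then have ne: "I \<noteq> {}" by auto
  then have ne': "{..<n} \<noteq> {}" using I by auto
  have ind: "prob_space.indep_vars (gauss {..<n}) (\<lambda>_. borel) (\<lambda>i x. a i * x i) I"
    by (rule gauss.indep_vars_compose2[OF gauss.indep_vars_subset[OF indep_vars_gauss_coords[OF finite_lessThan ne'] I(2)]]) simp
  have dist: "distributed (gauss {..<n}) lborel (\<lambda>x. a i * x i) (normal_density 0 \<bar>a i\<bar>)" if i: "i \<in> I" for i
  proof -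
    have "distributed (gauss {..<n}) lborel (\<lambda>x. x i) (normal_density 0 1)"
    proof -
      have "distr (gauss {..<n}) lborel (\<lambda>x. x i) = distr (gauss {..<n}) gauss1 (\<lambda>x. x i)"
        by (rule distr_cong) auto
      also have "\<dots> = gauss1"
        unfolding gauss_def by (rule distr_PiM_component[OF gauss1.prob_space_axioms]) (use i I in auto)
      finally have "distr (gauss {..<n}) lborel (\<lambda>x. x i) = gauss1" .
      moreover have "(\<lambda>x. x i) \<in> measurable (gauss {..<n}) lborel"
      proof -
        have "i \<in> {..<n}" using i I by blast
        from measurable_gauss_coord[OF this] show ?thesis by (simp only: measurable_lborel1)
      qed
      moreover have "(\<lambda>t. ennreal (std_normal_density t)) \<in> borel_measurable lborel"
        by (rule measurable_compose[OF _ measurable_ennreal]) (simp only: measurable_lborel2 borel_measurable_normal_density)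
      ultimately show ?thesis unfolding distributed_def by blast
    qed
    have "a i \<noteq> 0" using i by (simp add: I_def)
    from gauss.normal_density_affine[OF \<open>distributed (gauss {..<n}) lborel (\<lambda>x. x i) (normal_density 0 1)\<close> zero_less_one this, of 0]
    show ?thesis by (simp only: add_0 mult_zero_right mult_1_right)
  qed
  have "distributed (gauss {..<n}) lborel (\<lambda>x. \<Sum>i\<in>I. a i * x i) (normal_density (\<Sum>i\<in>I. 0) (sqrt (\<Sum>i\<in>I. \<bar>a i\<bar>\<^sup>2)))"
    by (rule gauss.sum_indep_normal[OF I(1) ne ind _ dist]) (auto simp: I_def)
  moreover have "(\<Sum>i\<in>I. a i * x i) = (\<Sum>i<n. a i * x i)" for x
    by (rule sum.mono_neutral_left) (auto simp: I_def)
  ultimately show ?thesis using sI by simp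
qed

lemma gauss_linear_moment_1: "(\<integral>x. (\<Sum>i<n. c i * x i) \<partial>gauss {..<n}) = 0" for n :: nat
proof -
  have "integrable (gauss {..<n}) (\<lambda>x. x i)" "(\<integral>x. x i \<partial>gauss {..<n}) = 0" if i: "i < n" for i
  proof -
    show int: "integrable (gauss {..<n}) (\<lambda>x. x i)" by (rule polyfun_integrable_gauss[OF polyfun_coord[OF i order.refl]])
    have "(\<integral>x. (\<Prod>k<n. (if k = i then x k else 1)) \<partial>gauss {..<n}) = (\<Prod>k<n. \<integral>a. (if k = i then a else 1) \<partial>gauss1)"
      unfolding gauss_def
    proof (rule gauss_prod.product_integral_prod)
      show "integrable gauss1 (\<lambda>a. if k = i then a else 1)" for k by (cases "k = i") auto
    qed simp
    also have "\<dots> = 0" using i by (intro prod_zero) (auto simp: integral_gauss1_moments intro!: bexI[of _ i])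
    finally show "(\<integral>x. x i \<partial>gauss {..<n}) = 0" using i by (simp add: prod.delta)
  qed
  then show ?thesis by simp
qed

lemma gauss_linear_moment_3: "(\<integral>x. (\<Sum>i<n. c i * x i)^3 \<partial>gauss {..<n}) = 0" for n :: nat
proof (induction n)
  case (Suc n)
  let ?S = "\<lambda>x :: nat \<Rightarrow> real. \<Sum>i<n. c i * x i"
  have upd: "(\<Sum>i<n. c i * (x(n := a)) i) = ?S x" for x a by (rule sum.cong) auto
  have pS: "polyfun m 1 (\<lambda>x. \<Sum>i<m. c i * x i)" for m by (rule polyfun_sum_coords) simp
  have int: "integrable (gauss {..<n}) (\<lambda>x. ?S x ^ k)" for k
    using polyfun_power[OF pS, of n k] by (rule polyfun_integrable_gauss)
  have "(\<integral>x. (\<Sum>i<Suc n. c i * x i)^3 \<partial>gauss {..<Suc n}) = (\<integral>x. \<integral>a. (?S x + c n * a)^3 \<partial>gauss1 \<partial>gauss {..<n})"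
    using integral_gauss_Suc[OF polyfun_power[OF pS], of n 3] by (simp add: upd)
  also have "\<dots> = (\<integral>x. ?S x ^ 3 + 3 * (c n)^2 * ?S x ^ 1 \<partial>gauss {..<n})"
  proof (rule Bochner_Integration.integral_cong[OF refl])
    fix x
    have "(\<integral>a. (?S x + c n * a)^3 \<partial>gauss1) = (\<integral>a. ?S x ^ 3 + (3 * c n * ?S x ^ 2) * a
        + (3 * (c n)^2 * ?S x) * a^2 + (c n)^3 * a^3 \<partial>gauss1)"
      by (rule Bochner_Integration.integral_cong) (auto simp: power2_eq_square power3_eq_cube algebra_simps)
    then show "(\<integral>a. (?S x + c n * a)^3 \<partial>gauss1) = ?S x ^ 3 + 3 * (c n)^2 * ?S x ^ 1"
      by (simp add: integral_gauss1_moments gauss1.prob_space)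
  qed
  also have "\<dots> = (\<integral>x. ?S x ^ 3 \<partial>gauss {..<n}) + 3 * (c n)^2 * (\<integral>x. ?S x ^ 1 \<partial>gauss {..<n})"
    using int[of 3] int[of 1] by simp
  finally show ?case using Suc.IH gauss_linear_moment_1[where c=c and n=n] by simp
qed simp

section \<open>Explicit bounds for the one-dimensional normal distribution\<close>

lemma std_normal_density_le: "std_normal_density x \<le> 2/5"
proof -
  have "(5/2)\<^sup>2 \<le> 2 * pi" using pi_approx(1) by (simp add: power2_eq_square)
  then have s: "5/2 \<le> sqrt (2 * pi)" by (rule real_le_rsqrt)
  have "std_normal_density x = exp (- x\<^sup>2 / 2) / sqrt (2 * pi)" by (simp add: std_normal_density_def)
  also have "\<dots> \<le> 1 / (5/2)" using s by (intro frac_le) auto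
  finally show ?thesis by simp
qed

lemma std_normal_density_ge:
  assumes "\<bar>x\<bar> \<le> 1/5" shows "1/5 \<le> std_normal_density x"
proof -
  have "2 * pi \<le> (10/3)\<^sup>2" using pi_approx(2) by (simp add: power2_eq_square)
  then have s: "sqrt (2 * pi) \<le> 10/3" by (rule real_le_lsqrt[rotated]) simp
  have "x\<^sup>2 \<le> (1/5)\<^sup>2" using power_mono[OF assms, of 2] by simp
  then have "49/50 \<le> 1 + (- x\<^sup>2 / 2)" by (simp add: power2_eq_square)
  also have "\<dots> \<le> exp (- x\<^sup>2 / 2)" by (rule exp_ge_add_one_self)
  finally have e: "49/50 \<le> exp (- x\<^sup>2 / 2)" .
  have "1/5 \<le> (49/50) / (10/3 :: real)" by simp
  also have "\<dots> \<le> exp (- x\<^sup>2 / 2) / sqrt (2 * pi)" using s e by (intro frac_le) auto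
  finally show ?thesis by (simp add: std_normal_density_def)
qed

lemma measure_gauss1_le:
  assumes "a \<le> b" shows "measure gauss1 {a..b} \<le> 2/5 * (b - a)"
proof -
  have "emeasure gauss1 {a..b} = (\<integral>\<^sup>+x. ennreal (std_normal_density x) * indicator {a..b} x \<partial>lborel)"
    by (rule emeasure_density) auto
  also have "\<dots> \<le> (\<integral>\<^sup>+x. ennreal (2/5) * indicator {a..b} x \<partial>lborel)"
    by (intro nn_integral_mono mult_right_mono ennreal_leI std_normal_density_le) auto
  also have "\<dots> = ennreal (2/5) * ennreal (b - a)" using assms by (subst nn_integral_cmult_indicator) auto
  also have "\<dots> = ennreal (2/5 * (b - a))" using assms by (subst ennreal_mult) auto
  finally show ?thesis using assms by (simp add: gauss1.emeasure_eq_measure)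
qed

lemma measure_gauss1_ge:
  assumes "{a..<b} \<subseteq> {-(1/5)..1/5}" "a \<le> b" shows "1/5 * (b - a) \<le> measure gauss1 {a..<b}"
proof -
  have "ennreal (1/5 * (b - a)) = ennreal (1/5) * ennreal (b - a)" using assms by (subst ennreal_mult) auto
  also have "\<dots> = (\<integral>\<^sup>+x. ennreal (1/5) * indicator {a..<b} x \<partial>lborel)" using assms by (subst nn_integral_cmult_indicator) auto
  also have "\<dots> \<le> (\<integral>\<^sup>+x. ennreal (std_normal_density x) * indicator {a..<b} x \<partial>lborel)"
  proof (intro nn_integral_mono)
    fix x show "ennreal (1/5) * indicator {a..<b} x \<le> ennreal (std_normal_density x) * indicator {a..<b} x"
    proof (cases "x \<in> {a..<b}")
      case True
      then have "\<bar>x\<bar> \<le> 1/5" using assms(1) by (auto simp: abs_le_iff subset_iff)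
      then show ?thesis using std_normal_density_ge by (intro mult_right_mono ennreal_leI) auto
    qed simp
  qed
  also have "\<dots> = emeasure gauss1 {a..<b}" by (rule emeasure_density[symmetric]) auto
  finally show ?thesis by (simp add: gauss1.emeasure_eq_measure)
qed

lemma measure_gauss1_point: "measure gauss1 {x} = 0"
  using measure_gauss1_le[of x x] by (simp add: antisym)

lemma measure_gauss1_halves: "measure gauss1 {..<0} = 1/2" "measure gauss1 {0..} = 1/2"
proof -
  have "emeasure gauss1 {..0} = (\<integral>\<^sup>+x. ennreal (std_normal_density x) * indicator {..0} x \<partial>lborel)"
    by (rule emeasure_density) auto
  also have "\<dots> = (\<integral>\<^sup>+x. ennreal (std_normal_density (0 + (-1) * x)) * indicator {..0} (0 + (-1) * x) \<partial>lborel)"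
    by (subst nn_integral_real_affine[where c="-1" and t=0]) auto
  also have "\<dots> = (\<integral>\<^sup>+x. ennreal (std_normal_density x) * indicator {0..} x \<partial>lborel)"
    by (intro nn_integral_cong) (auto simp: std_normal_density_def indicator_def)
  also have "\<dots> = emeasure gauss1 {0..}" by (rule emeasure_density[symmetric]) auto
  finally have eq: "measure gauss1 {..0} = measure gauss1 {0..}" by (simp add: measure_def)
  have "measure gauss1 ({..<0} \<union> {0}) = measure gauss1 {..<0} + measure gauss1 {0}"
    by (rule gauss1.finite_measure_Union) auto
  moreover have "{..<0} \<union> {0} = {..0 :: real}" by auto
  ultimately have eq2: "measure gauss1 {..0} = measure gauss1 {..<0}" by (simp add: measure_gauss1_point)
  have "measure gauss1 ({..<0} \<union> {0..}) = measure gauss1 {..<0} + measure gauss1 {0..}"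
    by (rule gauss1.finite_measure_Union) auto
  moreover have "{..<0} \<union> {0..} = (UNIV :: real set)" by auto
  ultimately have "measure gauss1 {..<0} + measure gauss1 {0..} = 1" by simp
  then show "measure gauss1 {..<0} = 1/2" "measure gauss1 {0..} = 1/2" using eq eq2 by linarith+
qed

text \<open>The density is at most 2/5 everywhere and at least 1/5 on [-1/5, 1/5], and 27/50 is 1/2
  + 1/25. Closed and open half-lines both occur, since an affine function is tested for being
  nonnegative or for being negative according to the sign of its constant term.\<close>

lemma gauss1_tail_bounds:
  assumes "0 \<le> t"
  shows "1/2 \<le> measure gauss1 {-t..}" "measure gauss1 {-t..} \<le> 1/2 + 2/5 * t" "1/5 \<le> t \<Longrightarrow> 27/50 \<le> measure gauss1 {-t..}"
    and "1/2 \<le> measure gauss1 {..<t}" "measure gauss1 {..<t} \<le> 1/2 + 2/5 * t" "1/5 \<le> t \<Longrightarrow> 27/50 \<le> measure gauss1 {..<t}"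
proof -
  show "1/2 \<le> measure gauss1 {-t..}"
    unfolding measure_gauss1_halves(2)[symmetric] using assms by (intro gauss1.finite_measure_mono) auto
  show "1/2 \<le> measure gauss1 {..<t}"
    unfolding measure_gauss1_halves(1)[symmetric] using assms by (intro gauss1.finite_measure_mono) auto
  have "measure gauss1 {-t..} \<le> measure gauss1 ({-t..0} \<union> {0..})" by (intro gauss1.finite_measure_mono) auto
  also have "\<dots> \<le> measure gauss1 {-t..0} + measure gauss1 {0..}" by (rule measure_Un_le) auto
  also have "\<dots> \<le> 1/2 + 2/5 * t" using measure_gauss1_le[of "-t" 0] assms by (simp add: measure_gauss1_halves)
  finally show "measure gauss1 {-t..} \<le> 1/2 + 2/5 * t" .
  have "measure gauss1 {..<t} \<le> measure gauss1 ({0..t} \<union> {..<0})" by (intro gauss1.finite_measure_mono) auto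
  also have "\<dots> \<le> measure gauss1 {0..t} + measure gauss1 {..<0}" by (rule measure_Un_le) auto
  also have "\<dots> \<le> 1/2 + 2/5 * t" using measure_gauss1_le[of 0 t] assms by (simp add: measure_gauss1_halves)
  finally show "measure gauss1 {..<t} \<le> 1/2 + 2/5 * t" .
  show "27/50 \<le> measure gauss1 {-t..}" if "1/5 \<le> t"
  proof -
    have "1/5 * (0 - (-(1/5))) + 1/2 \<le> measure gauss1 {-(1/5)..<0} + measure gauss1 {0..}"
      unfolding measure_gauss1_halves(2) by (intro add_mono measure_gauss1_ge) auto
    also have "\<dots> = measure gauss1 ({-(1/5)..<0} \<union> {0..})" by (rule gauss1.finite_measure_Union[symmetric]) auto
    also have "\<dots> \<le> measure gauss1 {-t..}" using that by (intro gauss1.finite_measure_mono) auto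
    finally show ?thesis by simp
  qed
  show "27/50 \<le> measure gauss1 {..<t}" if "1/5 \<le> t"
  proof -
    have "1/5 * (1/5 - 0) + 1/2 \<le> measure gauss1 {0..<1/5} + measure gauss1 {..<0}"
      unfolding measure_gauss1_halves(1) by (intro add_mono measure_gauss1_ge) auto
    also have "\<dots> = measure gauss1 ({0..<1/5} \<union> {..<0})" by (rule gauss1.finite_measure_Union[symmetric]) auto
    also have "\<dots> \<le> measure gauss1 {..<t}" using that by (intro gauss1.finite_measure_mono) auto
    finally show ?thesis by simp
  qed
qed

text \<open>The quartic minorant touches \<open>\<bar>y\<bar>\<close> at \<open>y = \<plusminus>7/4\<close>, close to \<open>\<plusminus>sqrt 3\<close>, the optimal point for
  a centred variable with the first four moments of the standard Gaussian.\<close>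

lemma abs_ge_quartic: "6/7 * y\<^sup>2 - 32/343 * y^4 \<le> \<bar>y :: real\<bar>"
proof -
  define u where "u = \<bar>y\<bar> * (4/7)"
  have u0: "0 \<le> u" by (simp add: u_def)
  have y: "\<bar>y\<bar> = 7/4 * u" by (simp add: u_def)
  have "0 \<le> u * (u - 1)\<^sup>2 * (u + 2) * (7/8)" using u0 by simp
  also have "\<dots> = \<bar>y\<bar> - (6/7 * \<bar>y\<bar>\<^sup>2 - 32/343 * \<bar>y\<bar>^4)"
    unfolding y by (simp add: power2_eq_square power4_eq_xxxx algebra_simps)
  finally show ?thesis by simp
qed

text \<open>For positive y this is the nonnegativity of (1 - s y)^2 together with y + \<bar>y\<bar>
  = 2 y. Replacing \<bar>y\<bar> by its quartic minorant leaves an expression that moments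
  determine. In contrast to the quadratic bound below it still has a positive mean for centred y and
  small positive s.\<close>

lemma positive_part_indicator_ge:
  fixes y s :: real
  assumes "0 \<le> s"
  shows "s * (y + (6/7 * y\<^sup>2 - 32/343 * y^4)) - s\<^sup>2 * y\<^sup>2 \<le> (if 0 < y then 1 else 0)"
proof -
  have "s * (y + (6/7 * y\<^sup>2 - 32/343 * y^4)) \<le> s * (y + \<bar>y\<bar>)"
    using assms abs_ge_quartic[of y] by (intro mult_left_mono) auto
  moreover have "s * (y + \<bar>y\<bar>) - s\<^sup>2 * y\<^sup>2 \<le> (if 0 < y then 1 else 0)"
  proof (cases "0 < y")
    case True
    have "0 \<le> (1 - s * y)\<^sup>2" by simp
    then show ?thesis using True by (simp add: power2_eq_square algebra_simps)
  qed simp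
  ultimately show ?thesis by linarith
qed

text \<open>Taking means for mean t and variance 1, the best s is t / (1 + t^2) and gives Cantelli's
  t^2 / (1 + t^2).\<close>

lemma cantelli_indicator_ge:
  fixes y s :: real
  assumes "0 \<le> s" shows "2 * s * y - s\<^sup>2 * y\<^sup>2 \<le> (if 0 < y then 1 else 0)"
proof (cases "0 < y")
  case True
  have "0 \<le> (1 - s * y)\<^sup>2" by simp
  then show ?thesis using True by (simp add: power2_eq_square algebra_simps)
next
  case False
  then have "s * y \<le> 0" using assms by (simp add: mult_nonneg_nonpos)
  moreover have "0 \<le> s\<^sup>2 * y\<^sup>2" by simp
  moreover have "2 * s * y = 2 * (s * y)" by simp
  ultimately have "2 * s * y - s\<^sup>2 * y\<^sup>2 \<le> 0" by linarith
  then show ?thesis using False by (simp only: if_False)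
qed

text \<open>The constancy of functions of degree 0 has to accompany the induction, since a product
  with a coordinate is affine only if the other factor is constant.\<close>

lemma polyfun_affine_form:
  assumes "polyfun n d f" "d \<le> 1"
  shows "\<exists>b a. \<forall>x. f x = b + (\<Sum>i<n. a i * x i)"
proof -
  have "(d = 0 \<longrightarrow> (\<exists>c. \<forall>x. f x = c)) \<and> (d \<le> 1 \<longrightarrow> (\<exists>b a. \<forall>x. f x = b + (\<Sum>i<n. a i * x i)))"
    using assms(1)
  proof (induction rule: polyfun_induct)
    case (const d c)
    show ?case by (auto intro!: exI[of _ c] exI[of _ "\<lambda>_. 0"])
  next
    case (mult d f j)
    have "\<exists>b a. \<forall>x. x j * f x = b + (\<Sum>i<n. a i * x i)" if "Suc d \<le> 1"
    proof -
      have "d = 0" using that by simp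
      then have "\<exists>c. \<forall>x. f x = c" using mult.IH by blast
      then obtain c where c: "\<And>x. f x = c" by blast
      have "x j * f x = 0 + (\<Sum>i<n. (if i = j then c else 0) * x i)" for x
      proof -
        have "(\<Sum>i<n. (if i = j then c else 0) * x i) = (\<Sum>i<n. if i = j then c * x i else 0)"
          by (rule sum.cong) auto
        then show ?thesis using mult(1) by (simp add: c mult.commute)
      qed
      then show ?thesis by (intro exI[of _ 0] exI[of _ "\<lambda>i. if i = j then c else 0"] allI)
    qed
    then show ?case by simp
  next
    case (add d f g)
    have 1: "\<exists>b a. \<forall>x. f x + g x = b + (\<Sum>i<n. a i * x i)" if le: "d \<le> 1"
    proof -
      have "\<exists>b a. \<forall>x. f x = b + (\<Sum>i<n. a i * x i)" "\<exists>b a. \<forall>x. g x = b + (\<Sum>i<n. a i * x i)"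
        using add.IH le by simp_all
      then obtain b a b' a' where "\<And>x. f x = b + (\<Sum>i<n. a i * x i)" "\<And>x. g x = b' + (\<Sum>i<n. a' i * x i)"
        by (elim exE) blast
      then have "f x + g x = (b + b') + (\<Sum>i<n. (a i + a' i) * x i)" for x
        by (simp add: algebra_simps sum.distrib)
      then show ?thesis by (intro exI[of _ "b + b'"] exI[of _ "\<lambda>i. a i + a' i"] allI)
    qed
    have 2: "\<exists>c. \<forall>x. f x + g x = c" if 0: "d = 0"
    proof -
      have "\<exists>c. \<forall>x. f x = c" "\<exists>c. \<forall>x. g x = c" using add.IH 0 by blast+
      then obtain c c' where "\<And>x. f x = c" "\<And>x. g x = c'" by (elim exE) blast
      then show ?thesis by simp
    qed
    from 1 2 show ?case by blast
  qed
  then show ?thesis using assms(2) by blast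
qed

lemma (in prob_space) positive_part_prob_ge:
  fixes X :: "'a \<Rightarrow> real"
  assumes int: "integrable M X" "integrable M (\<lambda>\<omega>. (X \<omega>)\<^sup>2)" "integrable M (\<lambda>\<omega>. (X \<omega>)^4)"
    and mom: "expectation X = t" "expectation (\<lambda>\<omega>. (X \<omega>)\<^sup>2) = 1 + t\<^sup>2" "expectation (\<lambda>\<omega>. (X \<omega>)^4) = 3 + 6 * t\<^sup>2 + t^4"
    and s: "0 \<le> s"
  shows "s * (t + (6/7 * (1 + t\<^sup>2) - 32/343 * (3 + 6 * t\<^sup>2 + t^4))) - s\<^sup>2 * (1 + t\<^sup>2) \<le> prob {\<omega> \<in> space M. 0 < X \<omega>}"
    and "2 * s * t - s\<^sup>2 * (1 + t\<^sup>2) \<le> prob {\<omega> \<in> space M. 0 < X \<omega>}"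
proof -
  define A where "A = {\<omega> \<in> space M. 0 < X \<omega>}"
  have A: "A \<in> sets M" unfolding A_def
    by (rule borel_measurable_less[OF borel_measurable_const borel_measurable_integrable[OF int(1)]])
  have iA: "integrable M (indicator A :: 'a \<Rightarrow> real)"
    using A by (intro integrable_real_indicator) (auto simp: emeasure_eq_measure)
  have ind: "indicator A \<omega> = (if 0 < X \<omega> then 1 else 0 :: real)" if "\<omega> \<in> space M" for \<omega>
    using that by (simp add: A_def indicator_def)
  have EA: "expectation (indicator A) = prob A" using A by simp
  have "s * (t + (6/7 * (1 + t\<^sup>2) - 32/343 * (3 + 6 * t\<^sup>2 + t^4))) - s\<^sup>2 * (1 + t\<^sup>2)
     = expectation (\<lambda>\<omega>. s * (X \<omega> + (6/7 * (X \<omega>)\<^sup>2 - 32/343 * (X \<omega>)^4)) - s\<^sup>2 * (X \<omega>)\<^sup>2)"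
    using int by (simp add: mom)
  also have "\<dots> \<le> expectation (indicator A)"
  proof (rule integral_mono[OF _ iA])
    show "integrable M (\<lambda>\<omega>. s * (X \<omega> + (6/7 * (X \<omega>)\<^sup>2 - 32/343 * (X \<omega>)^4)) - s\<^sup>2 * (X \<omega>)\<^sup>2)" using int by simp
    fix \<omega> assume "\<omega> \<in> space M"
    from ind[OF this] positive_part_indicator_ge[OF s, of "X \<omega>"]
    show "s * (X \<omega> + (6/7 * (X \<omega>)\<^sup>2 - 32/343 * (X \<omega>)^4)) - s\<^sup>2 * (X \<omega>)\<^sup>2 \<le> indicator A \<omega>" by (simp only:)
  qed
  finally show "s * (t + (6/7 * (1 + t\<^sup>2) - 32/343 * (3 + 6 * t\<^sup>2 + t^4))) - s\<^sup>2 * (1 + t\<^sup>2) \<le> prob {\<omega> \<in> space M. 0 < X \<omega>}"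
    unfolding EA unfolding A_def .
  have "2 * s * t - s\<^sup>2 * (1 + t\<^sup>2) = expectation (\<lambda>\<omega>. 2 * s * X \<omega> - s\<^sup>2 * (X \<omega>)\<^sup>2)"
    using int by (simp add: mom)
  also have "\<dots> \<le> expectation (indicator A)"
  proof (rule integral_mono[OF _ iA])
    show "integrable M (\<lambda>\<omega>. 2 * s * X \<omega> - s\<^sup>2 * (X \<omega>)\<^sup>2)" using int by simp
    fix \<omega> assume "\<omega> \<in> space M"
    from ind[OF this] cantelli_indicator_ge[OF s, of "X \<omega>"]
    show "2 * s * X \<omega> - s\<^sup>2 * (X \<omega>)\<^sup>2 \<le> indicator A \<omega>" by (simp only:)
  qed
  finally show "2 * s * t - s\<^sup>2 * (1 + t\<^sup>2) \<le> prob {\<omega> \<in> space M. 0 < X \<omega>}"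
    unfolding EA unfolding A_def .
qed

text \<open>\<open>p\<close> lies between \<open>P\<close> and \<open>1 - N\<close>, so there are
  two one-sided gaps to \<open>q\<close>. Expectations of signs differ by twice the difference of
  probabilities, so 99/200 here is 99/100 in the end. The quartic bound serves small t, Cantelli's
  bound large t.\<close>

lemma four_moments_gap:
  fixes t p P N q :: real
  assumes t: "0 \<le> t" and p: "P \<le> p" "p + N \<le> 1"
    and P1: "\<And>s. 0 \<le> s \<Longrightarrow> s * (t + (6/7 * (1 + t\<^sup>2) - 32/343 * (3 + 6 * t\<^sup>2 + t^4))) - s\<^sup>2 * (1 + t\<^sup>2) \<le> P"
    and P2: "\<And>s. 0 \<le> s \<Longrightarrow> 2 * s * t - s\<^sup>2 * (1 + t\<^sup>2) \<le> P"
    and N1: "\<And>s. 0 \<le> s \<Longrightarrow> s * (- t + (6/7 * (1 + t\<^sup>2) - 32/343 * (3 + 6 * t\<^sup>2 + t^4))) - s\<^sup>2 * (1 + t\<^sup>2) \<le> N"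
    and N0: "0 \<le> N"
    and q: "1/2 \<le> q" "q \<le> 1/2 + 2/5 * t" "1/5 \<le> t \<Longrightarrow> 27/50 \<le> q" "q \<le> 1"
  shows "\<bar>p - q\<bar> \<le> 99/200"
proof -
  have "q - P \<le> 99/200"
  proof -
    consider "t \<le> 9/10" | "9/10 \<le> t" "t \<le> 11/10" | "11/10 \<le> t" by linarith
    then show ?thesis
    proof cases
      case 1
      have "t\<^sup>2 \<le> (9/10)\<^sup>2" "t^4 \<le> (9/10)^4" using t 1 by (auto intro: power_mono)
      then have "t\<^sup>2 \<le> 81/100" "t^4 \<le> 6561/10000" by (simp_all add: power2_eq_square power4_eq_xxxx)
      moreover have c: "(2/5 :: real)\<^sup>2 = 4/25" by (simp add: power2_eq_square)
      \<comment> \<open>With s = 2/5 the linear term in t cancels against the slope of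
        \<open>q \<le> 1/2 + 2/5 * t\<close>. A margin of 608/8575 remains, which the higher powers
        do not exhaust on this range.\<close>
      have "0 \<le> (2/5 :: real)" by simp
      from P1[OF this, unfolded c]
      have "2/5 * (t + (6/7 * (1 + t\<^sup>2) - 32/343 * (3 + 6 * t\<^sup>2 + t^4))) - 4/25 * (1 + t\<^sup>2) \<le> P" .
      moreover have "2/5 * (t + (6/7 * (1 + t\<^sup>2) - 32/343 * (3 + 6 * t\<^sup>2 + t^4))) - 4/25 * (1 + t\<^sup>2)
          = 608/8575 + 2/5 * t - 352/8575 * t\<^sup>2 - 64/1715 * t^4" by (simp add: field_simps)
      ultimately show ?thesis using q(2) by linarith
    next
      case 2
      \<comment> \<open>1/2 is the optimal value t / (1 + t^2) at t = 1, the middle of this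
        range.\<close>
      have "2 * (1/2) * t - (1/2)\<^sup>2 * (1 + t\<^sup>2) \<le> P" by (rule P2) simp
      then have a: "t - 1/4 - t\<^sup>2 / 4 \<le> P" by (simp add: power2_eq_square algebra_simps add_divide_distrib)
      have "(t - 9/10) * (t - 11/10) \<le> 0" using 2 by (intro mult_nonneg_nonpos) auto
      then have "t\<^sup>2 \<le> 2 * t - 99/100" by (simp add: power2_eq_square algebra_simps)
      then show ?thesis using a q(2) 2 by linarith
    next
      case 3
      \<comment> \<open>The optimal s in Cantelli's bound. Here t^2 / (1 + t^2) is already large
        enough for the trivial estimate of \<open>q\<close> by 1.\<close>
      define s where "s = t / (1 + t\<^sup>2)"
      have pos: "0 < 1 + t\<^sup>2" by (simp add: add_pos_nonneg)
      have "(11/10)\<^sup>2 \<le> t\<^sup>2" using 3 by (intro power_mono) auto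
      then have t2: "121/100 \<le> t\<^sup>2" by (simp add: power2_eq_square)
      have ss: "s * (1 + t\<^sup>2) = t" using pos by (simp add: s_def)
      have "2 * s * t - s\<^sup>2 * (1 + t\<^sup>2) = s * t"
      proof -
        have "s\<^sup>2 * (1 + t\<^sup>2) = s * (s * (1 + t\<^sup>2))" by (simp add: power2_eq_square)
        then show ?thesis by (simp add: ss)
      qed
      moreover have "0 \<le> s" using t pos by (simp add: s_def)
      ultimately have "s * t \<le> P" using P2[of s] by simp
      moreover have "s * t = 1 - 1 / (1 + t\<^sup>2)" using pos by (simp add: s_def field_simps power2_eq_square)
      moreover have "1 / (1 + t\<^sup>2) \<le> 1 / (221/100)" using t2 by (intro divide_left_mono) auto
      ultimately show ?thesis using q(4) by simp
    qed
  qed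
  moreover have "1 - N - q \<le> 99/200"
  proof (cases "1/5 \<le> t")
    case True
    then show ?thesis using q(3) N0 by simp
  next
    case False
    then have "t\<^sup>2 \<le> (1/5)\<^sup>2" "t^4 \<le> (1/5)^4" using t by (auto intro: power_mono)
    then have "t\<^sup>2 \<le> 1/25" "t^4 \<le> 1/625" by (simp_all add: power2_eq_square power4_eq_xxxx)
    moreover have c: "(1/4 :: real)\<^sup>2 = 1/16" by (simp add: power2_eq_square)
    \<comment> \<open>For t below 1/5 the value of \<open>q\<close> may be close to 1/2, so the gain
      has to come from \<open>N\<close>. With s = 1/4 its lower bound is still above 3/100 at t =
      1/5.\<close>
    have "0 \<le> (1/4 :: real)" by simp
    from N1[OF this, unfolded c]
    have "1/4 * (- t + (6/7 * (1 + t\<^sup>2) - 32/343 * (3 + 6 * t\<^sup>2 + t^4))) - 1/16 * (1 + t\<^sup>2) \<le> N" .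
    moreover have "1/4 * (- t + (6/7 * (1 + t\<^sup>2) - 32/343 * (3 + 6 * t\<^sup>2 + t^4))) - 1/16 * (1 + t\<^sup>2)
        = 449/5488 - 1/4 * t + 65/5488 * t\<^sup>2 - 8/343 * t^4" by (simp add: field_simps)
    moreover have "0 \<le> t\<^sup>2" by simp
    ultimately show ?thesis using q(1) False by linarith
  qed
  ultimately show ?thesis using p by linarith
qed

lemma (in prob_space) expectation_pm_sign:
  fixes h :: "'a \<Rightarrow> real"
  assumes "h \<in> borel_measurable M"
  shows "expectation (\<lambda>\<omega>. pm_sign (h \<omega>)) = 2 * prob {\<omega> \<in> space M. 0 \<le> h \<omega>} - 1"
    and "expectation (\<lambda>\<omega>. pm_sign (h \<omega>)) = 1 - 2 * prob {\<omega> \<in> space M. h \<omega> < 0}"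
proof -
  have A: "{\<omega> \<in> space M. 0 \<le> h \<omega>} \<in> sets M" "{\<omega> \<in> space M. h \<omega> < 0} \<in> sets M"
    by (rule borel_measurable_le[OF borel_measurable_const assms], rule borel_measurable_less[OF assms borel_measurable_const])
  define B where "B = {\<omega> \<in> space M. 0 \<le> h \<omega>}"
  have B: "B \<in> sets M" unfolding B_def by (rule A)
  have iB: "integrable M (indicator B :: 'a \<Rightarrow> real)"
    using B by (intro integrable_real_indicator) (auto simp: emeasure_eq_measure)
  have "expectation (\<lambda>\<omega>. pm_sign (h \<omega>)) = expectation (\<lambda>\<omega>. 2 * indicator B \<omega> - 1)"
    by (rule Bochner_Integration.integral_cong[OF refl]) (simp add: pm_sign_def B_def)
  also have "\<dots> = 2 * prob B - 1" using iB B by (simp add: prob_space)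
  finally show 1: "expectation (\<lambda>\<omega>. pm_sign (h \<omega>)) = 2 * prob {\<omega> \<in> space M. 0 \<le> h \<omega>} - 1"
    by (simp only: B_def)
  have "prob {\<omega> \<in> space M. 0 \<le> h \<omega>} = 1 - prob {\<omega> \<in> space M. h \<omega> < 0}"
  proof -
    have "{\<omega> \<in> space M. 0 \<le> h \<omega>} = space M - {\<omega> \<in> space M. h \<omega> < 0}" by auto
    then show ?thesis by (simp only: prob_compl[OF A(2)])
  qed
  then show "expectation (\<lambda>\<omega>. pm_sign (h \<omega>)) = 1 - 2 * prob {\<omega> \<in> space M. h \<omega> < 0}" using 1 by linarith
qed

section \<open>The main estimate\<close>

lemma gradient_ratio_finite_family:
  fixes P :: "'j \<Rightarrow> (nat \<Rightarrow> real) \<Rightarrow> real"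
  assumes J: "finite J" and P: "\<And>j. j \<in> J \<Longrightarrow> polyfun n d (P j)" and d: "1 \<le> d" and T: "0 < T"
  shows "measure (gauss {..<n}) {x \<in> space (gauss {..<n}). T\<^sup>2 * (\<Sum>j\<in>J. (P j x)\<^sup>2) < (\<Sum>j\<in>J. \<Sum>l<n. (pd l (P j) x)\<^sup>2)}
     \<le> 2048 * (real d)\<^sup>2 / T" (is "measure ?G ?B \<le> _")
    and "{x \<in> space (gauss {..<n}). T\<^sup>2 * (\<Sum>j\<in>J. (P j x)\<^sup>2) < (\<Sum>j\<in>J. \<Sum>l<n. (pd l (P j) x)\<^sup>2)} \<in> sets (gauss {..<n})"
proof -
  from ex_bij_betw_nat_finite[OF J] obtain h where h: "bij_betw h {0..<card J} J" by blast
  then have h': "bij_betw h {..<card J} J" by (simp add: lessThan_atLeast0)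
  have hJ: "h j \<in> J" if "j < card J" for j using bij_betwE[OF h'] that by auto
  have e: "(\<Sum>j\<in>J. f j) = (\<Sum>j<card J. f (h j))" for f :: "'j \<Rightarrow> real"
    by (rule sum.reindex_bij_betw[OF h', symmetric])
  have "emeasure ?G ?B \<le> ennreal (2048 * (real d)\<^sup>2 / T)"
    unfolding e by (rule gradient_ratio_family[OF _ d T]) (rule P, rule hJ)
  then show "measure ?G ?B \<le> 2048 * (real d)\<^sup>2 / T"
    using T by (simp add: gauss.emeasure_eq_measure)
  have p1: "polyfun n (2 * d) (\<lambda>x. \<Sum>j\<in>J. (P j x)\<^sup>2)" by (rule polyfun_sum, rule polyfun_power, erule P)
  have p2: "polyfun n (2 * (d - 1)) (\<lambda>x. \<Sum>j\<in>J. \<Sum>l<n. (pd l (P j) x)\<^sup>2)"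
    by (rule polyfun_sum, rule polyfun_sum, rule polyfun_power, rule polyfun_pd, erule P) simp
  have c: "(\<lambda>x. x i) \<in> borel_measurable ?G" if "i < n" for i
    by (rule measurable_gauss_coord) (simp add: that)
  show "?B \<in> sets ?G"
    by (rule borel_measurable_less[OF borel_measurable_times[OF borel_measurable_const polyfun_measurable[OF p1 c]] polyfun_measurable[OF p2 c]])
qed

section \<open>Concentration of the certainty near its extreme values\<close>

definition level :: "nat \<Rightarrow> nat \<Rightarrow> nat list set" where
  "level n i = {w. set w \<subseteq> {..<n} \<and> length w = i}"

lemma finite_level: "finite (level n i)"
  unfolding level_def by (rule finite_lists_length_eq) simp

lemma sum_level_Suc: "(\<Sum>w\<in>level n (Suc i). h w) = (\<Sum>w\<in>level n i. \<Sum>l<n. h (l # w))" for h :: "nat list \<Rightarrow> real"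
proof -
  have im: "level n (Suc i) = (\<lambda>(w, l). l # w) ` (level n i \<times> {..<n})"
  proof (intro set_eqI iffI)
    fix v assume "v \<in> level n (Suc i)"
    then obtain l w where "v = l # w" "w \<in> level n i" "l < n" by (cases v) (auto simp: level_def)
    then show "v \<in> (\<lambda>(w, l). l # w) ` (level n i \<times> {..<n})" by (intro image_eqI[of _ _ "(w, l)"]) auto
  qed (auto simp: level_def)
  have "(\<Sum>w\<in>level n (Suc i). h w) = (\<Sum>(w, l)\<in>level n i \<times> {..<n}. h (l # w))"
    unfolding im by (subst sum.reindex) (auto simp: inj_on_def case_prod_beta')
  then show ?thesis by (simp add: sum.cartesian_product)
qed

text \<open>Apart from d exceptional events, one for each pair of consecutive levels, the squared
  derivatives grow by a factor of at most T^2 per level. As \<tau> T^2 = \<eta>, the factorials in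
  the weights turn the squared length of the jet into a partial sum of exp \<eta> times f^2. The
  union bound over the levels raises d^2 to d^3.\<close>

lemma certainty_concentrated:
  assumes f: "polyfun n d f" and nz: "f y \<noteq> 0" and d: "1 \<le> d" and T: "0 < T" and \<tau>: "0 < \<tau>" and \<eta>: "\<tau> * T\<^sup>2 = \<eta>" "\<eta> \<le> 1"
  shows "1 - (\<integral>x. (certainty n d \<tau> f x)\<^sup>2 \<partial>gauss {..<n}) \<le> 2 * \<eta> + 2048 * (real d)^3 / T"
proof -
  let ?G = "gauss {..<n}"
  define DS where "DS i x = (\<Sum>w\<in>level n i. (pdw w f x)\<^sup>2)" for i x
  define B where "B i = {x \<in> space ?G. T\<^sup>2 * DS i x < DS (Suc i) x}" for i
  have pw: "polyfun n d (pdw w f)" if "w \<in> level n i" for w i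
    by (rule polyfun_mono[OF polyfun_pdw[OF f]]) (use that in \<open>auto simp: level_def\<close>)
  have DS_Suc: "DS (Suc i) x = (\<Sum>w\<in>level n i. \<Sum>l<n. (pd l (pdw w f) x)\<^sup>2)" for i x
    unfolding DS_def sum_level_Suc by simp
  have B: "B i \<in> sets ?G" "measure ?G (B i) \<le> 2048 * (real d)\<^sup>2 / T" for i
    unfolding B_def DS_Suc unfolding DS_def
    by (rule gradient_ratio_finite_family[OF finite_level pw d T], assumption)+
  have \<eta>0: "0 < \<eta>" using T \<tau> \<eta>(1) by auto
  have norm: "jet_norm2 n d \<tau> f x = (\<Sum>i\<le>d. \<tau> ^ i / fact i * DS i x)" for x
  proof -
    have "jet_norm2 n d \<tau> f x = (\<Sum>w\<in>words n d. \<tau> ^ length w / fact (length w) * (pdw w f x)\<^sup>2)"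
      unfolding jet_norm2_def by (simp add: jet_square[OF f \<tau>])
    also have "\<dots> = (\<Sum>i\<le>d. \<Sum>w\<in>{w \<in> words n d. length w = i}. \<tau> ^ length w / fact (length w) * (pdw w f x)\<^sup>2)"
      by (rule sum.group[symmetric, OF finite_words]) (auto simp: words_def)
    also have "\<dots> = (\<Sum>i\<le>d. \<Sum>w\<in>level n i. \<tau> ^ i / fact i * (pdw w f x)\<^sup>2)"
      by (intro sum.cong refl) (auto simp: words_def level_def)
    finally show ?thesis by (simp add: DS_def sum_distrib_left)
  qed
  have good: "1 - (certainty n d \<tau> f x)\<^sup>2 \<le> 2 * \<eta>" if g: "\<And>i. i < d \<Longrightarrow> DS (Suc i) x \<le> T\<^sup>2 * DS i x" for x
  proof -
    have le: "DS i x \<le> T\<^sup>2 ^ i * (f x)\<^sup>2" if "i \<le> d" for i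
      using that
    proof (induction i)
      case 0
      have "level n 0 = {[]}" by (auto simp: level_def)
      then show ?case by (simp add: DS_def)
    next
      case (Suc i)
      have "DS (Suc i) x \<le> T\<^sup>2 * DS i x" using g Suc.prems by simp
      also have "\<dots> \<le> T\<^sup>2 * (T\<^sup>2 ^ i * (f x)\<^sup>2)" using Suc by (intro mult_left_mono) auto
      finally show ?case by (simp add: mult.assoc)
    qed
    have "jet_norm2 n d \<tau> f x \<le> (\<Sum>i\<le>d. \<tau> ^ i / fact i * (T\<^sup>2 ^ i * (f x)\<^sup>2))"
      unfolding norm using \<tau> by (intro sum_mono mult_left_mono le) auto
    also have "\<dots> = (\<Sum>i\<le>d. \<eta> ^ i / fact i) * (f x)\<^sup>2"
      unfolding \<eta>(1)[symmetric] by (simp add: sum_distrib_right power_mult_distrib mult.assoc)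
    also have "\<dots> \<le> (1 + 2 * \<eta>) * (f x)\<^sup>2"
    proof (rule mult_right_mono)
      have "(\<Sum>i\<le>d. \<eta> ^ i / fact i) \<le> exp \<eta>"
        unfolding exp_def using \<eta>0 summable_exp_generic[of \<eta>]
        by (simp add: divide_inverse scaleR_conv_of_real mult.commute) (intro sum_le_suminf, auto simp: mult.commute)
      also have "\<dots> \<le> 1 + \<eta> + \<eta>\<^sup>2" using \<eta>0 \<eta>(2) by (intro exp_bound) auto
      also have "\<eta>\<^sup>2 \<le> \<eta>" using \<eta>0 \<eta>(2) by (simp add: power2_eq_square mult_left_le)
      finally show "(\<Sum>i\<le>d. \<eta> ^ i / fact i) \<le> 1 + 2 * \<eta>" by simp
    qed simp
    finally have A: "jet_norm2 n d \<tau> f x \<le> (1 + 2 * \<eta>) * (f x)\<^sup>2" .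
    have A0: "0 < jet_norm2 n d \<tau> f x" by (rule jet_norm2_pos[OF f \<tau> nz])
    have "(certainty n d \<tau> f x)\<^sup>2 = (f x)\<^sup>2 / jet_norm2 n d \<tau> f x"
      using A0 by (simp add: certainty_def power_divide)
    \<comment> \<open>This is 1 / (1 + 2 \<eta>) \<ge> 1 - 2 \<eta> with denominators
      cleared.\<close>
    moreover have "(1 - 2 * \<eta>) * jet_norm2 n d \<tau> f x \<le> (f x)\<^sup>2"
    proof (cases "1 - 2 * \<eta> \<le> 0")
      case True
      then have "(1 - 2 * \<eta>) * jet_norm2 n d \<tau> f x \<le> 0" using A0 by (simp add: mult_nonpos_nonneg)
      then show ?thesis using zero_le_power2[of "f x"] by linarith
    next
      case False
      then have "(1 - 2 * \<eta>) * jet_norm2 n d \<tau> f x \<le> (1 - 2 * \<eta>) * ((1 + 2 * \<eta>) * (f x)\<^sup>2)"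
        using A by (intro mult_left_mono) auto
      also have "\<dots> = (1 - 4 * \<eta>\<^sup>2) * (f x)\<^sup>2" by (simp add: power2_eq_square algebra_simps)
      also have "\<dots> \<le> 1 * (f x)\<^sup>2" by (intro mult_right_mono) auto
      finally show ?thesis by simp
    qed
    ultimately have "1 - 2 * \<eta> \<le> (certainty n d \<tau> f x)\<^sup>2" using A0 by (simp add: pos_le_divide_eq)
    then show ?thesis by linarith
  qed
  have pt: "1 - (certainty n d \<tau> f x)\<^sup>2 \<le> 2 * \<eta> + (\<Sum>i<d. indicator (B i) x)" if x: "x \<in> space ?G" for x
  proof (cases "\<exists>i<d. x \<in> B i")
    case True
    then obtain i where i: "i < d" "x \<in> B i" by blast
    have "1 = (indicator (B i) x :: real)" using i by simp
    also have "\<dots> \<le> (\<Sum>i<d. indicator (B i) x)" using i by (intro member_le_sum) auto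
    finally show ?thesis using \<eta>0 zero_le_power2[of "certainty n d \<tau> f x"] by linarith
  next
    case False
    have "DS (Suc i) x \<le> T\<^sup>2 * DS i x" if "i < d" for i
    proof -
      have "x \<notin> B i" using False that by blast
      then show ?thesis using x by (simp add: B_def not_less)
    qed
    from good[OF this] have "1 - (certainty n d \<tau> f x)\<^sup>2 \<le> 2 * \<eta>" .
    moreover have "0 \<le> (\<Sum>i<d. indicator (B i) x :: real)" by (rule sum_nonneg) simp
    ultimately show ?thesis by linarith
  qed
  interpret R2: coord_function n "\<lambda>x. (certainty n d \<tau> f x)\<^sup>2" by (rule coord_function_certainty[OF f \<tau>])
  have m: "(\<lambda>x. (certainty n d \<tau> f x)\<^sup>2) \<in> borel_measurable ?G"
    using R2.F_measurable unfolding measurable_cong_sets[OF sets_gauss_Rvec refl] .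
  have iR: "integrable ?G (\<lambda>x. (certainty n d \<tau> f x)\<^sup>2)"
    by (rule gauss.integrable_bounded_1[OF m R2.F_bounded])
  have iB: "integrable ?G (\<lambda>x. indicator (B i) x :: real)" for i
    using B(1) by (intro integrable_real_indicator) (auto simp: gauss.emeasure_eq_measure)
  have "1 - (\<integral>x. (certainty n d \<tau> f x)\<^sup>2 \<partial>?G) = (\<integral>x. 1 - (certainty n d \<tau> f x)\<^sup>2 \<partial>?G)"
    using iR by (simp add: gauss.prob_space)
  also have "\<dots> \<le> (\<integral>x. 2 * \<eta> + (\<Sum>i<d. indicator (B i) x) \<partial>?G)"
    using iR iB pt by (intro integral_mono) auto
  also have "\<dots> = 2 * \<eta> + (\<Sum>i<d. measure ?G (B i))"
    using iB B(1) by (simp add: gauss.prob_space)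
  also have "\<dots> \<le> 2 * \<eta> + (\<Sum>i<d. 2048 * (real d)\<^sup>2 / T)" by (intro add_left_mono sum_mono B)
  also have "\<dots> = 2 * \<eta> + 2048 * (real d)^3 / T" by (simp add: power2_eq_square power3_eq_cube)
  finally show ?thesis .
qed

text \<open>The certainty r has the sign of \<open>f\<close> and modulus at most 1, so its distance
  to the sign is 1 - \<bar>r\<bar>, at most 1 - r^2. Where \<open>f\<close> is zero, both sides are
  1.\<close>

lemma pm_sign_certainty:
  assumes f: "polyfun n d f" and \<tau>: "0 < \<tau>"
  shows "\<bar>pm_sign (f x) - certainty n d \<tau> f x\<bar> \<le> 1 - (certainty n d \<tau> f x)\<^sup>2"
proof -
  define r where "r = certainty n d \<tau> f x"
  have r2: "r\<^sup>2 \<le> 1" unfolding r_def by (rule certainty_square_le_1[OF f \<tau>])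
  then have r1: "\<bar>r\<bar> \<le> 1" by (simp add: abs_square_le_1)
  have s: "0 \<le> f x \<Longrightarrow> 0 \<le> r" "f x < 0 \<Longrightarrow> r \<le> 0"
    unfolding r_def certainty_def jet_norm2_def by (auto simp: sum_nonneg divide_nonpos_nonneg)
  have "\<bar>r\<bar> * \<bar>r\<bar> \<le> \<bar>r\<bar> * 1" using r1 by (intro mult_left_mono) auto
  then have r3: "r\<^sup>2 \<le> \<bar>r\<bar>" by (simp add: power2_eq_square)
  show ?thesis unfolding r_def[symmetric]
  proof (cases "0 \<le> f x")
    case True
    then show "\<bar>pm_sign (f x) - r\<bar> \<le> 1 - r\<^sup>2" using s(1) r1 r3 unfolding pm_sign_def by simp
  next
    case False
    then show "\<bar>pm_sign (f x) - r\<bar> \<le> 1 - r\<^sup>2" using s(2) r1 r3 unfolding pm_sign_def by simp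
  qed
qed

text \<open>Under \<open>Z\<close> the certainty r is known to be extreme only by comparison: 1 - E
  r(Z)^2 exceeds 1 - E r(x)^2 by at most L e. Together with the same bound under x and the error L e
  for r itself, this makes 2 L e + 2 (1 - E r(x)^2).\<close>

lemma main_estimate:
  fixes d L n :: nat and T \<eta> \<tau> s \<theta> :: real
  assumes f: "polyfun n d f" and nz: "f y \<noteq> 0" and d: "1 \<le> d" and T: "0 < T" and \<tau>: "0 < \<tau>" and \<eta>: "\<tau> * T\<^sup>2 = \<eta>" "\<eta> \<le> 1"
    and L: "1 \<le> L" and s: "0 < s" "s * sqrt L = 1" and \<theta>: "\<theta> = s\<^sup>2 * d / \<tau>" "\<theta> \<le> 1/32"
    and M: "prob_space M" and z: "\<And>j. j < L \<Longrightarrow> kwise_indep_gaussian M (4 * d) n (z j)"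
    and ind: "prob_space.indep_vars M (\<lambda>_. Rvec n) z {..<L}"
  shows "\<bar>(\<integral>\<omega>. pm_sign (f (\<lambda>i. \<Sum>j<L. s * z j \<omega> i)) \<partial>M) - (\<integral>x. pm_sign (f x) \<partial>gauss {..<n})\<bar>
    \<le> 80000 * real L * (\<theta> * sqrt \<theta>) + 2 * (2 * \<eta> + 2048 * (real d)^3 / T)"
proof -
  interpret M: prob_space M by fact
  let ?G = "gauss {..<n}" and ?c = "certainty n d \<tau> f"
  define Z where "Z \<omega> = (\<lambda>i. s * (\<Sum>j<L. z j \<omega> i))" for \<omega>
  define e where "e = 40000 * (\<theta> * sqrt \<theta>)"
  interpret R1: coord_function n ?c by (rule coord_function_certainty[OF f \<tau>])
  interpret R2: coord_function n "\<lambda>x. (?c x)\<^sup>2" by (rule coord_function_certainty[OF f \<tau>])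
  have t1: "\<bar>(\<integral>\<omega>. ?c (Z \<omega>) \<partial>M) - (\<integral>x. ?c x \<partial>?G)\<bar> \<le> real L * e"
  proof -
    have step: "\<bar>(\<integral>\<omega>. ?c (\<lambda>i. v i + s * z j \<omega> i) \<partial>M) - (\<integral>y. ?c (\<lambda>i. v i + s * y i) \<partial>?G)\<bar> \<le> e"
      if "j < L" for j v
      unfolding e_def by (rule certainty_one_step(1)[OF f \<tau> nz d s(1) \<theta> M z[OF that]])
    from telescoping[OF M ind R1.coord_function_axioms s(1) step order.refl, of "\<lambda>_. 0"]
    show ?thesis by (simp add: s(2) Z_def)
  qed
  have t2: "\<bar>(\<integral>\<omega>. (?c (Z \<omega>))\<^sup>2 \<partial>M) - (\<integral>x. (?c x)\<^sup>2 \<partial>?G)\<bar> \<le> real L * e"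
  proof -
    have step: "\<bar>(\<integral>\<omega>. (?c (\<lambda>i. v i + s * z j \<omega> i))\<^sup>2 \<partial>M) - (\<integral>y. (?c (\<lambda>i. v i + s * y i))\<^sup>2 \<partial>?G)\<bar> \<le> e"
      if "j < L" for j v
      unfolding e_def by (rule certainty_one_step(2)[OF f \<tau> nz d s(1) \<theta> M z[OF that]])
    from telescoping[OF M ind R2.coord_function_axioms s(1) step order.refl, of "\<lambda>_. 0"]
    show ?thesis by (simp add: s(2) Z_def)
  qed
  have Zm: "(\<lambda>\<omega>. Z \<omega> i) \<in> borel_measurable M" if i: "i < n" for i
  proof -
    have c: "(\<lambda>x. x i) \<in> borel_measurable (Rvec n)" by (rule measurable_component_singleton) (simp add: i)
    have zz: "(\<lambda>\<omega>. z j \<omega> i) \<in> borel_measurable M" if "j < L" for j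
    proof -
      have "z j \<in> measurable M (Rvec n)" using z[OF that] by (simp add: kwise_indep_gaussian_def)
      from measurable_compose[OF this c] show ?thesis .
    qed
    show ?thesis unfolding Z_def
      by (rule borel_measurable_times[OF borel_measurable_const borel_measurable_sum]) (rule zz, simp)
  qed
  have Gm: "(\<lambda>x. x i) \<in> borel_measurable ?G" if "i < n" for i
    by (rule measurable_gauss_coord) (simp add: that)
  have sg: "pm_sign \<in> borel_measurable borel" unfolding pm_sign_def[abs_def]
    by (rule measurable_If[OF borel_measurable_const borel_measurable_const]) simp
  have b: "\<bar>pm_sign t\<bar> \<le> 1" for t by (simp add: pm_sign_def)
  have mM: "(\<lambda>\<omega>. pm_sign (f (Z \<omega>))) \<in> borel_measurable M" "(\<lambda>\<omega>. ?c (Z \<omega>)) \<in> borel_measurable M"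
    "(\<lambda>\<omega>. (?c (Z \<omega>))\<^sup>2) \<in> borel_measurable M"
  proof -
    have "(\<lambda>\<omega>. f (Z \<omega>)) \<in> borel_measurable M" by (rule polyfun_measurable[OF f]) (rule Zm)
    from measurable_compose[OF this sg] show "(\<lambda>\<omega>. pm_sign (f (Z \<omega>))) \<in> borel_measurable M" .
    show "(\<lambda>\<omega>. ?c (Z \<omega>)) \<in> borel_measurable M" by (rule R1.F_compose_measurable) (rule Zm)
    show "(\<lambda>\<omega>. (?c (Z \<omega>))\<^sup>2) \<in> borel_measurable M" by (rule R2.F_compose_measurable) (rule Zm)
  qed
  have iM: "integrable M (\<lambda>\<omega>. pm_sign (f (Z \<omega>)))" "integrable M (\<lambda>\<omega>. ?c (Z \<omega>))" "integrable M (\<lambda>\<omega>. (?c (Z \<omega>))\<^sup>2)"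
  proof -
    show "integrable M (\<lambda>\<omega>. pm_sign (f (Z \<omega>)))" by (rule M.integrable_bounded_1[OF mM(1)]) (rule b)
    show "integrable M (\<lambda>\<omega>. ?c (Z \<omega>))" by (rule M.integrable_bounded_1[OF mM(2)]) (rule R1.F_bounded)
    show "integrable M (\<lambda>\<omega>. (?c (Z \<omega>))\<^sup>2)" by (rule M.integrable_bounded_1[OF mM(3)]) (rule R2.F_bounded)
  qed
  have mG: "(\<lambda>x. pm_sign (f x)) \<in> borel_measurable ?G" "(\<lambda>x. ?c x) \<in> borel_measurable ?G"
    "(\<lambda>x. (?c x)\<^sup>2) \<in> borel_measurable ?G"
  proof -
    have "(\<lambda>x. f x) \<in> borel_measurable ?G" by (rule polyfun_measurable[OF f]) (rule Gm)
    from measurable_compose[OF this sg] show "(\<lambda>x. pm_sign (f x)) \<in> borel_measurable ?G" .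
    show "(\<lambda>x. ?c x) \<in> borel_measurable ?G" by (rule R1.F_compose_measurable) (rule Gm)
    show "(\<lambda>x. (?c x)\<^sup>2) \<in> borel_measurable ?G" by (rule R2.F_compose_measurable) (rule Gm)
  qed
  have iG: "integrable ?G (\<lambda>x. pm_sign (f x))" "integrable ?G (\<lambda>x. ?c x)" "integrable ?G (\<lambda>x. (?c x)\<^sup>2)"
  proof -
    show "integrable ?G (\<lambda>x. pm_sign (f x))" by (rule gauss.integrable_bounded_1[OF mG(1)]) (rule b)
    show "integrable ?G (\<lambda>x. ?c x)" by (rule gauss.integrable_bounded_1[OF mG(2)]) (rule R1.F_bounded)
    show "integrable ?G (\<lambda>x. (?c x)\<^sup>2)" by (rule gauss.integrable_bounded_1[OF mG(3)]) (rule R2.F_bounded)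
  qed
  have dM: "\<bar>(\<integral>\<omega>. pm_sign (f (Z \<omega>)) \<partial>M) - (\<integral>\<omega>. ?c (Z \<omega>) \<partial>M)\<bar> \<le> 1 - (\<integral>\<omega>. (?c (Z \<omega>))\<^sup>2 \<partial>M)"
  proof -
    have "(\<integral>\<omega>. 1 - (?c (Z \<omega>))\<^sup>2 \<partial>M) = 1 - (\<integral>\<omega>. (?c (Z \<omega>))\<^sup>2 \<partial>M)"
      by (subst Bochner_Integration.integral_diff[OF M.integrable_const iM(3)]) (simp add: M.prob_space)
    with M.integral_close[OF iM(1,2) Bochner_Integration.integrable_diff[OF M.integrable_const iM(3)] pm_sign_certainty[OF f \<tau>]]
    show ?thesis by (simp only:)
  qed
  have dG: "\<bar>(\<integral>x. pm_sign (f x) \<partial>?G) - (\<integral>x. ?c x \<partial>?G)\<bar> \<le> 1 - (\<integral>x. (?c x)\<^sup>2 \<partial>?G)"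
  proof -
    have "(\<integral>x. 1 - (?c x)\<^sup>2 \<partial>?G) = 1 - (\<integral>x. (?c x)\<^sup>2 \<partial>?G)"
      by (subst Bochner_Integration.integral_diff[OF gauss.integrable_const iG(3)]) (simp add: gauss.prob_space)
    with gauss.integral_close[OF iG(1,2) Bochner_Integration.integrable_diff[OF gauss.integrable_const iG(3)] pm_sign_certainty[OF f \<tau>]]
    show ?thesis by (simp only:)
  qed
  have cG: "1 - (\<integral>x. (?c x)\<^sup>2 \<partial>?G) \<le> 2 * \<eta> + 2048 * (real d)^3 / T"
    by (rule certainty_concentrated[OF f nz d T \<tau> \<eta>])
  have E: "80000 * real L * (\<theta> * sqrt \<theta>) = 2 * (real L * e)" by (simp add: e_def)
  \<comment> \<open>\<open>a\<close>, \<open>b\<close>, \<open>c\<close> stand for the means of the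
    sign, of the certainty and of its square under \<open>Z\<close>, and \<open>g\<close>,
    \<open>h\<close>, \<open>i\<close> for those under x.\<close>
  have combine: "\<bar>a - g\<bar> \<le> E + 2 * R" if "\<bar>a - b\<bar> \<le> 1 - c" "\<bar>g - h\<bar> \<le> 1 - i" "\<bar>b - h\<bar> \<le> e1" "\<bar>c - i\<bar> \<le> e1"
    "1 - i \<le> R" "E = 2 * e1" for a b c g h i e1 E R :: real
    using that by linarith
  have "\<bar>(\<integral>\<omega>. pm_sign (f (Z \<omega>)) \<partial>M) - (\<integral>x. pm_sign (f x) \<partial>?G)\<bar>
      \<le> 80000 * real L * (\<theta> * sqrt \<theta>) + 2 * (2 * \<eta> + 2048 * (real d)^3 / T)"
    by (rule combine[OF dM dG t1 t2 cG E])
  then show ?thesis by (simp add: Z_def sum_distrib_left)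
qed

text \<open>Division by the length of the linear part turns \<open>f\<close> into b + S with S
  standard normal under the Gaussian measure. Under \<open>z\<close> only the first four moments of
  b + S are known, and they leave an error strictly below the trivial 2 and even below 1. A constant
  \<open>f\<close> has no error at all.\<close>

lemma kwise_halfspace:
  assumes M: "prob_space M" and z: "kwise_indep_gaussian M 4 n z" and f: "polyfun n 1 f"
  shows "\<bar>(\<integral>\<omega>. pm_sign (f (z \<omega>)) \<partial>M) - (\<integral>x. pm_sign (f x) \<partial>gauss {..<n})\<bar> \<le> 99/100"
proof -
  interpret M: prob_space M by fact
  let ?G = "gauss {..<n}"
  obtain b0 a0 where f0: "\<And>x. f x = b0 + (\<Sum>i<n. a0 i * x i)"
    using polyfun_affine_form[OF f] by auto
  define r where "r = sqrt (\<Sum>i<n. (a0 i)\<^sup>2)"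
  show ?thesis
  proof (cases "r = 0")
    case True
    then have "(\<Sum>i<n. (a0 i)\<^sup>2) = 0" by (simp add: r_def)
    then have "a0 i = 0" if "i < n" for i using that by (simp add: sum_nonneg_eq_0_iff)
    then have "f x = b0" for x by (simp add: f0)
    then show ?thesis by (simp add: M.prob_space gauss.prob_space)
  next
    case False
    have "0 \<le> r" by (simp add: r_def sum_nonneg)
    with False have r: "0 < r" by simp
    have r2: "r\<^sup>2 = (\<Sum>i<n. (a0 i)\<^sup>2)" by (simp add: r_def sum_nonneg)
    define b where "b = b0 / r"
    define a where "a i = a0 i / r" for i
    define S where "S x = (\<Sum>i<n. a i * x i)" for x
    define g where "g x = b + S x" for x
    have a1: "(\<Sum>i<n. (a i)\<^sup>2) = 1"
      unfolding a_def power_divide sum_divide_distrib[symmetric] r2[symmetric] using r by simp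
    have fg: "f x = r * g x" for x
      using r by (simp add: f0 g_def S_def a_def b_def distrib_left sum_distrib_left)
    have sg: "pm_sign (f x) = pm_sign (g x)" for x
      using r by (simp add: pm_sign_def fg zero_le_mult_iff)
    have pS: "polyfun n 1 S" unfolding S_def[abs_def] by (rule polyfun_sum_coords) simp
    have pg: "polyfun n 1 g" unfolding g_def[abs_def] by (rule polyfun.add[OF polyfun_const pS])
    have iS: "integrable ?G (\<lambda>x. S x ^ k)" for k by (rule polyfun_integrable_gauss[OF polyfun_power[OF pS]])
    have iS1: "integrable ?G S" using iS[of 1] by simp
    have G1: "(\<integral>x. g x \<partial>?G) = b"
    proof -
      have "(\<integral>x. S x \<partial>?G) = 0" unfolding S_def by (rule gauss_linear_moment_1)
      then show ?thesis unfolding g_def using iS1 by (simp add: gauss.prob_space)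
    qed
    have G2: "(\<integral>x. (g x)\<^sup>2 \<partial>?G) = 1 + b\<^sup>2"
    proof -
      have "(\<integral>x. (g x)\<^sup>2 \<partial>?G) = (\<integral>x. b\<^sup>2 + 2 * b * S x + (S x)\<^sup>2 \<partial>?G)"
        by (rule Bochner_Integration.integral_cong[OF refl]) (simp add: g_def power2_eq_square algebra_simps)
      also have "\<dots> = b\<^sup>2 + 2 * b * (\<integral>x. S x \<partial>?G) + (\<integral>x. (S x)\<^sup>2 \<partial>?G)"
        using iS[of 2] iS1 by (simp add: gauss.prob_space)
      also have "\<dots> = 1 + b\<^sup>2"
        unfolding S_def gauss_linear_moment_1 gauss_linear_moment_2 a1 by simp
      finally show ?thesis .
    qed
    have G4: "(\<integral>x. (g x)^4 \<partial>?G) = 3 + 6 * b\<^sup>2 + b^4"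
    proof -
      have "(\<integral>x. (g x)^4 \<partial>?G) = (\<integral>x. b^4 + 4 * b^3 * S x + 6 * b\<^sup>2 * (S x)\<^sup>2 + 4 * b * (S x)^3 + (S x)^4 \<partial>?G)"
        by (rule Bochner_Integration.integral_cong[OF refl])
          (simp add: g_def power2_eq_square power3_eq_cube power4_eq_xxxx algebra_simps)
      also have "\<dots> = b^4 + 4 * b^3 * (\<integral>x. S x \<partial>?G) + 6 * b\<^sup>2 * (\<integral>x. (S x)\<^sup>2 \<partial>?G) + 4 * b * (\<integral>x. (S x)^3 \<partial>?G) + (\<integral>x. (S x)^4 \<partial>?G)"
        using iS[of 2] iS[of 3] iS[of 4] iS1 by (simp add: gauss.prob_space)
      also have "\<dots> = 3 + 6 * b\<^sup>2 + b^4"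
        unfolding S_def gauss_linear_moment_1 gauss_linear_moment_2 gauss_linear_moment_3 gauss_linear_moment_4 a1 by simp
      finally show ?thesis .
    qed
    have pg4: "polyfun n 4 (\<lambda>x. (g x) ^ k)" if "k \<le> 4" for k
      using polyfun_mono[OF polyfun_power[OF pg, of k], of 4] that by simp
    have mom: "integrable M (\<lambda>\<omega>. (g (z \<omega>)) ^ k)" "(\<integral>\<omega>. (g (z \<omega>)) ^ k \<partial>M) = (\<integral>x. (g x) ^ k \<partial>?G)" if "k \<le> 4" for k
      using kwise_moments[OF M z pg4[OF that]] by simp_all
    have i1: "integrable M (\<lambda>\<omega>. g (z \<omega>))" and m1: "(\<integral>\<omega>. g (z \<omega>) \<partial>M) = b" using mom[of 1] G1 by simp_all
    have i2: "integrable M (\<lambda>\<omega>. (g (z \<omega>))\<^sup>2)" and m2: "(\<integral>\<omega>. (g (z \<omega>))\<^sup>2 \<partial>M) = 1 + b\<^sup>2" using mom[of 2] G2 by simp_all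
    have i4: "integrable M (\<lambda>\<omega>. (g (z \<omega>))^4)" and m4: "(\<integral>\<omega>. (g (z \<omega>))^4 \<partial>M) = 3 + 6 * b\<^sup>2 + b^4" using mom[of 4] G4 by simp_all
    have gM: "(\<lambda>\<omega>. g (z \<omega>)) \<in> borel_measurable M" using i1 by (rule borel_measurable_integrable)
    have gG: "g \<in> borel_measurable ?G" using polyfun_integrable_gauss[OF pg] by (rule borel_measurable_integrable)
    define P where "P = M.prob {\<omega> \<in> space M. 0 < g (z \<omega>)}"
    define N where "N = M.prob {\<omega> \<in> space M. 0 < - g (z \<omega>)}"
    have j1: "integrable M (\<lambda>\<omega>. - g (z \<omega>))" "integrable M (\<lambda>\<omega>. (- g (z \<omega>))\<^sup>2)" "integrable M (\<lambda>\<omega>. (- g (z \<omega>))^4)"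
      using i1 i2 i4 by simp_all
    have n1: "M.expectation (\<lambda>\<omega>. - g (z \<omega>)) = - b" "M.expectation (\<lambda>\<omega>. (- g (z \<omega>))\<^sup>2) = 1 + (- b)\<^sup>2"
      "M.expectation (\<lambda>\<omega>. (- g (z \<omega>))^4) = 3 + 6 * (- b)\<^sup>2 + (- b)^4"
      using m1 m2 m4 by simp_all
    note Pb = M.positive_part_prob_ge[OF i1 i2 i4 m1 m2 m4, folded P_def]
    note Nb = M.positive_part_prob_ge[OF j1 n1, folded N_def]
    have sP: "{\<omega> \<in> space M. 0 < g (z \<omega>)} \<in> sets M" by (rule borel_measurable_less[OF borel_measurable_const gM])
    have sL: "{\<omega> \<in> space M. g (z \<omega>) < 0} \<in> sets M" by (rule borel_measurable_less[OF gM borel_measurable_const])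
    have sE: "{\<omega> \<in> space M. 0 \<le> g (z \<omega>)} \<in> sets M" by (rule borel_measurable_le[OF borel_measurable_const gM])
    have N_eq: "N = M.prob {\<omega> \<in> space M. g (z \<omega>) < 0}" by (simp add: N_def)
    have Pn: "0 \<le> P" "0 \<le> N" by (simp_all add: P_def N_def)
    have comp: "M.prob {\<omega> \<in> space M. 0 \<le> g (z \<omega>)} + N = 1"
    proof -
      have "{\<omega> \<in> space M. 0 \<le> g (z \<omega>)} = space M - {\<omega> \<in> space M. g (z \<omega>) < 0}" by auto
      then show ?thesis using M.prob_compl[OF sL] by (simp add: N_eq)
    qed
    have dist: "distr ?G lborel S = gauss1"
      using distributed_gauss_linear[OF a1] unfolding S_def[abs_def] by (simp add: distributed_def)
    have Sm: "S \<in> borel_measurable ?G" using iS1 by (rule borel_measurable_integrable)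
    have law: "measure ?G {x \<in> space ?G. S x \<in> A} = measure gauss1 A" if "A \<in> sets borel" for A
    proof -
      have "measure gauss1 A = measure (distr ?G lborel S) A" by (simp only: dist)
      also have "\<dots> = measure ?G (S -` A \<inter> space ?G)" by (rule measure_distr) (simp_all only: measurable_lborel1 measurable_lborel2 sets_lborel Sm that)
      also have "S -` A \<inter> space ?G = {x \<in> space ?G. S x \<in> A}" by auto
      finally show ?thesis ..
    qed
    show ?thesis
    proof (cases "0 \<le> b")
      case True
      define q where "q = measure gauss1 {-b..}"
      have "{x \<in> space ?G. 0 \<le> g x} = {x \<in> space ?G. S x \<in> {-b..}}" by (auto simp: g_def)
      then have eG: "(\<integral>x. pm_sign (g x) \<partial>?G) = 2 * q - 1"
        using gauss.expectation_pm_sign(1)[OF gG] law[of "{-b..}"] by (simp add: q_def)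
      have eM: "(\<integral>\<omega>. pm_sign (g (z \<omega>)) \<partial>M) = 2 * M.prob {\<omega> \<in> space M. 0 \<le> g (z \<omega>)} - 1"
        by (rule M.expectation_pm_sign(1)[OF gM])
      have "P \<le> M.prob {\<omega> \<in> space M. 0 \<le> g (z \<omega>)}"
        unfolding P_def by (rule M.finite_measure_mono[OF _ sE]) auto
      then have "\<bar>M.prob {\<omega> \<in> space M. 0 \<le> g (z \<omega>)} - q\<bar> \<le> 99/200"
      proof (rule four_moments_gap[OF True, of P _ N q])
        show "M.prob {\<omega> \<in> space M. 0 \<le> g (z \<omega>)} + N \<le> 1" using comp by simp
        show "1/2 \<le> q" "q \<le> 1/2 + 2/5 * b" "1/5 \<le> b \<Longrightarrow> 27/50 \<le> q" unfolding q_def by (rule gauss1_tail_bounds[OF True]; assumption?)+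
        show "q \<le> 1" unfolding q_def by (rule gauss1.prob_le_1)
      qed (use Pb Nb Pn in simp_all)
      then show ?thesis unfolding sg eG eM by linarith
    next
      case False
      \<comment> \<open>For negative b the roles of the two sides are exchanged. The event is now
        that g is negative, whose probability is exactly \<open>N\<close>, and its complement
        contains the event behind \<open>P\<close>.\<close>
      then have b0: "0 \<le> - b" by simp
      define q where "q = measure gauss1 {..<-b}"
      have "{x \<in> space ?G. g x < 0} = {x \<in> space ?G. S x \<in> {..<-b}}" by (auto simp: g_def)
      then have eG: "(\<integral>x. pm_sign (g x) \<partial>?G) = 1 - 2 * q"
        using gauss.expectation_pm_sign(2)[OF gG] law[of "{..<-b}"] by (simp add: q_def)
      have eM: "(\<integral>\<omega>. pm_sign (g (z \<omega>)) \<partial>M) = 1 - 2 * N"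
        unfolding N_eq by (rule M.expectation_pm_sign(2)[OF gM])
      have le: "P \<le> M.prob {\<omega> \<in> space M. 0 \<le> g (z \<omega>)}"
        unfolding P_def by (rule M.finite_measure_mono[OF _ sE]) auto
      have "\<bar>N - q\<bar> \<le> 99/200"
      proof (rule four_moments_gap[OF b0, of N _ P q])
        show "N + P \<le> 1" using comp le by simp
        show "1/2 \<le> q" "q \<le> 1/2 + 2/5 * (- b)" "1/5 \<le> - b \<Longrightarrow> 27/50 \<le> q" unfolding q_def by (rule gauss1_tail_bounds[OF b0]; assumption?)+
        show "q \<le> 1" unfolding q_def by (rule gauss1.prob_le_1)
      qed (use Pb Nb Pn in simp_all)
      then show ?thesis unfolding sg eG eM by linarith
    qed
  qed
qed

text \<open>T makes 2048 d^3 / T equal to \<epsilon> / 16, and \<eta> does the same for 2 \<eta>, so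
  the anticoncentration costs \<epsilon> / 4. It follows that \<theta> is at most 2^35 D^7 / L, and
  the square of L \<theta>^(3/2) is at most 2^105 D^21 / L. Two further powers of D in L make L
  \<theta>^(3/2) at most 2^(-18) / D, and with the factor 80000 the replacement costs less than
  \<epsilon> / 2.\<close>

lemma parameters:
  fixes d :: nat and \<epsilon> D s :: real and L :: nat
  assumes d: "1 \<le> d" and \<epsilon>: "0 < \<epsilon>" "\<epsilon> < 1" and D: "D = d / \<epsilon>" and L: "2 ^ 141 * D ^ 23 \<le> real L"
    and s: "s = sqrt (1 / L)"
  defines "T \<equiv> 2 ^ 15 * real d ^ 3 / \<epsilon>" and "\<eta> \<equiv> \<epsilon> / 32"
  defines "\<tau> \<equiv> \<eta> / T\<^sup>2"
  defines "\<theta> \<equiv> s\<^sup>2 * d / \<tau>"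
  shows "1 \<le> L" "0 < T" "0 < \<tau>" "\<tau> * T\<^sup>2 = \<eta>" "\<eta> \<le> 1" "0 < s" "s * sqrt L = 1" "\<theta> \<le> 1/32"
    "80000 * real L * (\<theta> * sqrt \<theta>) + 2 * (2 * \<eta> + 2048 * real d ^ 3 / T) \<le> \<epsilon>"
proof -
  have D1: "1 \<le> D" using d \<epsilon> unfolding D by (simp add: le_divide_eq)
  have D0: "0 < D" using D1 by simp
  have "1 \<le> D ^ 23" using D1 by simp
  then have Lpos: "1 \<le> real L" using L by simp
  then show "1 \<le> L" by simp
  show T: "0 < T" using d \<epsilon> by (simp add: T_def)
  show \<tau>: "0 < \<tau>" using \<epsilon> T by (simp add: \<tau>_def \<eta>_def)
  show "\<tau> * T\<^sup>2 = \<eta>" using T by (simp add: \<tau>_def)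
  show "\<eta> \<le> 1" using \<epsilon> by (simp add: \<eta>_def)
  show "0 < s" using Lpos by (simp add: s)
  show "s * sqrt L = 1" using Lpos by (simp add: s real_sqrt_divide)
  have s2: "s\<^sup>2 = 1 / L" using Lpos by (simp add: s)
  have \<theta>eq: "\<theta> = 2 ^ 35 * (real d ^ 7 / \<epsilon> ^ 3) / L"
    unfolding \<theta>_def s2 \<tau>_def \<eta>_def T_def
    using \<epsilon> d Lpos by (simp add: power_divide power_mult_distrib field_simps power_numeral_reduce)
  have "real d ^ 7 / \<epsilon> ^ 3 \<le> real d ^ 7 / \<epsilon> ^ 7"
    using \<epsilon> by (intro divide_left_mono power_decreasing) auto
  then have \<theta>D: "\<theta> \<le> 2 ^ 35 * D ^ 7 / L"
    unfolding \<theta>eq D power_divide using Lpos by (intro divide_right_mono mult_left_mono) auto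
  have \<theta>0: "0 < \<theta>" using \<epsilon> d Lpos by (simp add: \<theta>eq)
  have "D ^ 7 \<le> D ^ 23" using D1 by (intro power_increasing) auto
  moreover have "2 ^ 35 * u \<le> 1/32 * (2 ^ 141 * v)" if "u \<le> v" "0 \<le> v" for u v :: real using that by simp
  ultimately have "2 ^ 35 * D ^ 7 \<le> 1/32 * (2 ^ 141 * D ^ 23)" using D0 by (metis less_imp_le zero_less_power)
  also have "\<dots> \<le> 1/32 * L" using L by simp
  finally have "2 ^ 35 * D ^ 7 / L \<le> 1/32" using Lpos by (simp add: pos_divide_le_eq)
  then show "\<theta> \<le> 1/32" using \<theta>D by linarith
  have "(L * (\<theta> * sqrt \<theta>))\<^sup>2 = L\<^sup>2 * \<theta> ^ 3"
    using \<theta>0 by (simp add: power_mult_distrib power3_eq_cube power2_eq_square)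
  also have "\<dots> \<le> L\<^sup>2 * (2 ^ 35 * D ^ 7 / L) ^ 3"
    using \<theta>D \<theta>0 by (intro mult_left_mono power_mono) auto
  also have "\<dots> = 2 ^ 105 * D ^ 21 / L"
    using Lpos by (simp add: power_divide power_mult_distrib power_mult[symmetric] power2_eq_square power3_eq_cube)
  also have "\<dots> \<le> 2 ^ 105 * D ^ 21 / (2 ^ 141 * D ^ 23)"
    using L Lpos D0 by (intro divide_left_mono) auto
  also have "\<dots> = (1 / (2 ^ 18 * D))\<^sup>2"
  proof -
    have "D ^ 23 = D ^ 21 * (D * D)" by (simp add: power_numeral_reduce)
    then show ?thesis using D0 by (simp add: power2_eq_square)
  qed
  finally have "L * (\<theta> * sqrt \<theta>) \<le> 1 / (2 ^ 18 * D)"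
    by (rule power2_le_imp_le) (use D0 in simp)
  also have "1 / (2 ^ 18 * D) = \<epsilon> / (2 ^ 18 * d)" by (simp add: D)
  also have "\<dots> \<le> \<epsilon> / (2 ^ 18 * 1)" using d \<epsilon> by (intro divide_left_mono) auto
  finally have 1: "80000 * real L * (\<theta> * sqrt \<theta>) \<le> \<epsilon> / 2" using \<epsilon> by simp
  have "2048 * real d ^ 3 / T = \<epsilon> / 16" using d \<epsilon> by (simp add: T_def)
  then show "80000 * real L * (\<theta> * sqrt \<theta>) + 2 * (2 * \<eta> + 2048 * real d ^ 3 / T) \<le> \<epsilon>"
    using 1 \<epsilon> by (simp add: \<eta>_def)
qed

theorem theorem2p1:
  "\<exists>C c\<^sub>1 c\<^sub>2 :: real. 0 < C \<and> 0 < c\<^sub>1 \<and> 0 < c\<^sub>2 \<and>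
     (\<forall>(d::nat) (\<epsilon>::real). 1 \<le> d \<and> 0 < \<epsilon> \<and> \<epsilon> < 1 \<longrightarrow>
       (\<exists>(L::nat) (k::nat) (lam::real) (a::real).
          1 \<le> L \<and> lam = 1 / real L \<and>
          lam = (\<epsilon> / real d) powr a \<and> 0 \<le> a \<and> a \<le> C \<and>
          c\<^sub>1 * real d \<le> real k \<and> real k \<le> c\<^sub>2 * real d \<and>
          (\<forall>(n::nat) (p::rpoly).
             1 \<le> n \<and> p \<in> polys_in n \<and> p \<noteq> 0 \<and> total_degree_le p d \<longrightarrow>
             (\<forall>(M::'a measure) (z::nat \<Rightarrow> 'a \<Rightarrow> nat \<Rightarrow> real).
                prob_space M \<and>
                (\<forall>j<L. kwise_indep_gaussian M k n (z j)) \<and>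
                prob_space.indep_vars M (\<lambda>_. Rvec n) z {..<L} \<longrightarrow>
                \<bar>(\<integral>\<omega>. pm_sign (eval_poly p (\<lambda>i. \<Sum>j<L. sqrt lam * z j \<omega> i)) \<partial>M)
                  - (\<integral>x. pm_sign (eval_poly p x) \<partial>std_gaussian n)\<bar> \<le> \<epsilon>))))"
proof -
  \<comment> \<open>This bounds ln L / ln D, at most 142 ln 2 / ln D + 23, for all D from 100/99
    on.\<close>
  define C :: real where "C = 142 * ln 2 / ln (100/99) + 23"
  have l0: "0 < ln (100/99 :: real)" by simp
  have C0: "0 < C" using l0 by (simp add: C_def add_pos_pos)
  have main: "\<exists>(L::nat) (k::nat) (lam::real) (a::real).
          1 \<le> L \<and> lam = 1 / real L \<and>
          lam = (\<epsilon> / real d) powr a \<and> 0 \<le> a \<and> a \<le> C \<and>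
          4 * real d \<le> real k \<and> real k \<le> 4 * real d \<and>
          (\<forall>(n::nat) (p::rpoly).
             1 \<le> n \<and> p \<in> polys_in n \<and> p \<noteq> 0 \<and> total_degree_le p d \<longrightarrow>
             (\<forall>(M::'a measure) (z::nat \<Rightarrow> 'a \<Rightarrow> nat \<Rightarrow> real).
                prob_space M \<and>
                (\<forall>j<L. kwise_indep_gaussian M k n (z j)) \<and>
                prob_space.indep_vars M (\<lambda>_. Rvec n) z {..<L} \<longrightarrow>
                \<bar>(\<integral>\<omega>. pm_sign (eval_poly p (\<lambda>i. \<Sum>j<L. sqrt lam * z j \<omega> i)) \<partial>M)
                  - (\<integral>x. pm_sign (eval_poly p x) \<partial>std_gaussian n)\<bar> \<le> \<epsilon>))"
    if d: "1 \<le> d" and \<epsilon>: "0 < \<epsilon>" "\<epsilon> < 1" for d :: nat and \<epsilon> :: real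
  \<comment> \<open>The exponent ln L / ln D is bounded only if D stays away from 1. Below the
    threshold L = 1 is taken.\<close>
  proof (cases "100/99 \<le> d / \<epsilon>")
    case True
    define D where "D = d / \<epsilon>"
    \<comment> \<open>Rounding up at most doubles the value, which is why 142 appears in
      \<open>C\<close>.\<close>
    define L where "L = nat \<lceil>2 ^ 141 * D ^ 23\<rceil>"
    define s where "s = sqrt (1 / L)"
    have D: "100/99 \<le> D" using True by (simp add: D_def)
    then have D1: "1 \<le> D" by simp
    have Lge: "2 ^ 141 * D ^ 23 \<le> real L" unfolding L_def by (rule real_nat_ceiling_ge)
    have Lle: "real L \<le> 2 ^ 142 * D ^ 23"
    proof -
      have "1 \<le> D ^ 23" using D1 by simp
      moreover have "real L \<le> 2 ^ 141 * D ^ 23 + 1"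
      proof -
        have "real (nat \<lceil>x\<rceil>) \<le> x + 1" if "0 \<le> x" for x :: real using that by linarith
        then show ?thesis unfolding L_def using D1 by simp
      qed
      ultimately show ?thesis by simp
    qed
    note par = parameters[OF d \<epsilon> D_def Lge s_def]
    \<comment> \<open>The solution of D^a = L, that is of (\<epsilon> / d)^a = 1 / L.\<close>
    define a where "a = ln L / ln D"
    have lD: "ln (100/99) \<le> ln D" "0 < ln D" using D by simp_all
    have "1 / real L = (\<epsilon> / real d) powr a"
    proof -
      have "\<epsilon> / real d = 1 / D" by (simp add: D_def)
      then have "(\<epsilon> / real d) powr a = exp (a * ln (1 / D))" using D1 by (simp add: powr_def)
      also have "a * ln (1 / D) = - ln L" using lD(2) D1 by (simp add: a_def ln_div)
      also have "exp (- ln L) = 1 / real L" using par(1) by (simp add: exp_minus inverse_eq_divide)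
      finally show ?thesis by simp
    qed
    moreover have "0 \<le> a" using lD(2) par(1) by (simp add: a_def)
    moreover have "a \<le> C"
    proof -
      have "ln L \<le> ln (2 ^ 142 * D ^ 23)" using Lle par(1) D1 by (subst ln_le_cancel_iff) auto
      also have "\<dots> = ln (2 ^ 142) + ln (D ^ 23)" using D1 by (intro ln_mult_pos) auto
      also have "\<dots> = 142 * ln 2 + 23 * ln D" using D1 by (simp only: ln_realpow)
      finally have "a \<le> (142 * ln 2 + 23 * ln D) / ln D" unfolding a_def using lD(2) by (simp add: divide_right_mono)
      also have "\<dots> = 142 * ln 2 / ln D + 23" using lD(2) by (simp add: add_divide_distrib)
      also have "142 * ln 2 / ln D \<le> 142 * ln 2 / ln (100/99)" by (intro divide_left_mono mult_pos_pos lD l0) auto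
      finally show ?thesis by (simp add: C_def)
    qed
    moreover have "\<bar>(\<integral>\<omega>. pm_sign (eval_poly p (\<lambda>i. \<Sum>j<L. sqrt (1 / real L) * z j \<omega> i)) \<partial>M)
                  - (\<integral>x. pm_sign (eval_poly p x) \<partial>std_gaussian n)\<bar> \<le> \<epsilon>"
      if p: "p \<in> polys_in n" "total_degree_le p d" and M: "prob_space M" and z: "\<And>j. j < L \<Longrightarrow> kwise_indep_gaussian M (4 * d) n (z j)"
        and ind: "prob_space.indep_vars M (\<lambda>_. Rvec n) z {..<L}"
      for n and p :: rpoly and M :: "'a measure" and z :: "nat \<Rightarrow> 'a \<Rightarrow> nat \<Rightarrow> real"
    \<comment> \<open>A point with nonzero value makes all jets nonzero. If
      \<open>eval_poly p\<close> vanishes identically, both expectations are 1.\<close>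
    proof (cases "\<exists>y. eval_poly p y \<noteq> 0")
      case True
      then obtain y where y: "eval_poly p y \<noteq> 0" by blast
      have f: "polyfun n d (eval_poly p)" by (rule polyfun_eval_poly[OF p])
      from main_estimate[OF f y d par(2-5) par(1) par(6,7) refl par(8) M z ind] par(9)
      show ?thesis unfolding std_gaussian_eq s_def by linarith
    next
      case False
      interpret M: prob_space M by fact
      from False have "eval_poly p = (\<lambda>_. 0)" by auto
      then show ?thesis using \<epsilon> by (simp add: std_gaussian_eq M.prob_space gauss.prob_space)
    qed
    ultimately show ?thesis
      using par(1) by (intro exI[of _ L] exI[of _ "4 * d"] exI[of _ "1 / real L"] exI[of _ a]) simp
  next
    case False
    then have "real d < 100/99 * \<epsilon>" using \<epsilon> by (simp add: not_le pos_divide_less_eq)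
    \<comment> \<open>As \<epsilon> is below 1, d is below 100/99 and hence 1, and \<epsilon> is at
      least the error 99/100 of the halfspace estimate.\<close>
    then have d1: "d = 1" and e: "99/100 \<le> \<epsilon>" using d \<epsilon> by simp_all
    have "\<bar>(\<integral>\<omega>. pm_sign (eval_poly p (\<lambda>i. \<Sum>j<1. sqrt 1 * z j \<omega> i)) \<partial>M)
                  - (\<integral>x. pm_sign (eval_poly p x) \<partial>std_gaussian n)\<bar> \<le> \<epsilon>"
      if p: "p \<in> polys_in n" "total_degree_le p 1" and M: "prob_space M" and z: "kwise_indep_gaussian M 4 n (z 0)"
      for n and p :: rpoly and M :: "'a measure" and z :: "nat \<Rightarrow> 'a \<Rightarrow> nat \<Rightarrow> real"
      using kwise_halfspace[OF M z polyfun_eval_poly[OF p]] e by (simp add: std_gaussian_eq)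
    then show ?thesis
      \<comment> \<open>A single summand, four-wise independence, \<lambda> = 1 and the exponent
        0.\<close>
      using d1 \<epsilon> C0 by (intro exI[of _ 1] exI[of _ 4] exI[of _ 1] exI[of _ 0]) simp
  qed
  show ?thesis (is "\<exists>C c\<^sub>1 c\<^sub>2. _ \<and> _ \<and> _ \<and> (\<forall>d \<epsilon>. _ \<longrightarrow> ?concl C c\<^sub>1 c\<^sub>2 d \<epsilon>)")
  proof (rule exI[of _ C], rule exI[of _ 4], rule exI[of _ 4], intro conjI allI impI C0)
    fix d :: nat and \<epsilon> :: real
    assume "1 \<le> d \<and> 0 < \<epsilon> \<and> \<epsilon> < 1"
    then have "1 \<le> d" "0 < \<epsilon>" "\<epsilon> < 1" by simp_all
    from main[OF this] show "?concl C 4 4 d \<epsilon>" .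
  qed simp_all
qed

end
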